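(* Let $B$ be a reduced and nice $\mathbf{FI}$-algebra that is finitely generated in width $\le 1$ over a ring $K$, assume that $1\ne 0$ in $B_0$, and set $X:=\mathrm{Spec}(B)$. Then there exist a finite set $S_0$ and a nonzero element $h\in B(S_0)$ such that $X':=(\mathrm{Sh}_{S_0}X)[1/h]$ is isomorphic (as an $\mathbf{FI}^{\mathrm{op}}$-scheme) to $S\mapsto Z^S$, where $Z=X'([1])$ and where the product is over $B(S_0)[1/h]$.
   Context: Rings and algebras are commutative with $1$; $[n]=\{1,\dots,n\}$. $\mathbf{FI}$ is the category of finite sets with injections as morphisms. An $\mathbf{FI}$-algebra $B$ over a ring $K$ is a covariant functor from $\mathbf{FI}$ to $K$-algebras; write $B_n:=B([n])$, $B_0=B(\emptyset)$. Each $B(S)$ is a $B_0$-algebra via $\emptyset\to S$, so $B$ is also an $\mathbf{FI}$-algebra over $B_0$. An affine $\mathbf{FI}^{\mathrm{op}}$-scheme over $K$ is a contravariant functor from $\mathbf{FI}$ to affine $K$-schemes; $\mathrm{Spec}(B)$ is $S\mapsto\mathrm{Spec}(B(S))$. Morphisms are natural transformations. The width of $b\in B(S)$ is the minimal $n$ such that $b\in B(\pi)(B([n]))$ for some injection $\pi:[n]\to S$. $B$ is finitely generated in width $\le 1$ if there is a finite collection of elements $b_i\in B(S_i)$ of width $\le 1$ such that, for every finite set $S$, the $K$-algebra $B(S)$ is generated by all $B(\pi)(b_i)$ with $\pi:S_i\to S$ injective. $B$ is nice if $B(\pi)$ is injective for every injection $\pi$ of finite sets. $B$ is reduced if every $B(S)$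 has no nonzero nilpotents. Shift: for a finite set $S_0$, $(\mathrm{Sh}_{S_0}B)(S)=B(S_0\sqcup S)$ and $(\mathrm{Sh}_{S_0}B)(\pi)=B(\mathrm{id}_{S_0}\sqcup\pi)$; $\mathrm{Sh}_{S_0}\mathrm{Spec}(B)=\mathrm{Spec}(\mathrm{Sh}_{S_0}B)$. This is an $\mathbf{FI}$-algebra over $B(S_0)$. For $h\in B(S_0)$, $(\mathrm{Sh}_{S_0}B)[1/h]$ is the $\mathbf{FI}$-algebra $S\mapsto B(S_0\sqcup S)[1/h]$ over $B(S_0)[1/h]$ ($h$ also denoting its image in $B(S_0\sqcup S)$), and $(\mathrm{Sh}_{S_0}X)[1/h]$ is its spectrum. For a scheme $Z$ over $\mathrm{Spec}(R)$, the $\mathbf{FI}^{\mathrm{op}}$-scheme $S\mapsto Z^S$ sends $S$ to the fibre product over $\mathrm{Spec}(R)$ of copies of $Z$ indexed by $S$, and an injection $\pi:S\to T$ to the map $Z^T\to Z^S$ given by $(z_t)_{t\in T}\mapsto(z_{\pi(s)})_{s\in S}$. *)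

theory Defs
  imports
    "HOL-Algebra.Module"
    "HOL-Algebra.QuotRing"
    "HOL-Algebra.Product_Groups"
    "HOL-Algebra.Generated_Rings"
    "HOL-Analysis.Abstract_Topology"
    "HOL-Library.FuncSet"
    "HOL-Library.Nat_Bijection"
begin

section \<open>The category of finite sets and injections\<close>

text \<open>
  The objects are the finite subsets of \<^typ>\<open>nat\<close>; this full subcategory is equivalent to the
  category of all finite sets with injections.  Morphisms are extensional functions, so that they
  are determined by their values on the source.
\<close>

definition fi_hom :: "nat set \<Rightarrow> nat set \<Rightarrow> (nat \<Rightarrow> nat) set" where
  "fi_hom S T = {\<pi> \<in> S \<rightarrow>\<^sub>E T. inj_on \<pi> S}"

text \<open>The disjoint union is realised inside \<^typ>\<open>nat\<close> through the bijection
  \<^term>\<open>sum_encode :: nat + nat \<Rightarrow> nat\<close>.\<close>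

definition fi_sum :: "nat set \<Rightarrow> nat set \<Rightarrow> nat set" where
  "fi_sum S T = sum_encode ` (S <+> T)"

definition fi_inl :: "nat set \<Rightarrow> nat \<Rightarrow> nat" where
  "fi_inl S = (\<lambda>x\<in>S. sum_encode (Inl x))"

definition fi_sum_map :: "nat set \<Rightarrow> nat set \<Rightarrow> (nat \<Rightarrow> nat) \<Rightarrow> nat \<Rightarrow> nat" where
  "fi_sum_map S\<^sub>0 S \<pi> = (\<lambda>x\<in>fi_sum S\<^sub>0 S. sum_encode (map_sum id \<pi> (sum_decode x)))"


section \<open>FI-algebras\<close>

record ('k, 'b) fi_alg =
  fobj :: "nat set \<Rightarrow> ('k, 'b) module"
  fmap :: "nat set \<Rightarrow> nat set \<Rightarrow> (nat \<Rightarrow> nat) \<Rightarrow> 'b \<Rightarrow> 'b"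

definition alg_hom ::
  "('k, 'm) ring_scheme \<Rightarrow> ('k, 'a, 'x) module_scheme \<Rightarrow> ('k, 'b, 'y) module_scheme \<Rightarrow> ('a \<Rightarrow> 'b) set" where
  "alg_hom K A B = {f \<in> ring_hom A B.
     \<forall>c\<in>carrier K. \<forall>x\<in>carrier A. f (c \<odot>\<^bsub>A\<^esub> x) = c \<odot>\<^bsub>B\<^esub> f x}"

locale fi_algebra =
  fixes K :: "('k, 'm) ring_scheme" and B :: "('k, 'b) fi_alg"
  assumes obj_algebra: "finite S \<Longrightarrow> algebra K (fobj B S)"
    and map_hom: "\<lbrakk>finite S; finite T; \<pi> \<in> fi_hom S T\<rbrakk>
      \<Longrightarrow> fmap B S T \<pi> \<in> alg_hom K (fobj B S) (fobj B T)"
    and map_id: "\<lbrakk>finite S; x \<in> carrier (fobj B S)\<rbrakk> \<Longrightarrow> fmap B S S (\<lambda>i\<in>S. i) x = x"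
    and map_comp: "\<lbrakk>finite S; finite T; finite U; \<pi> \<in> fi_hom S T; \<rho> \<in> fi_hom T U;
        x \<in> carrier (fobj B S)\<rbrakk>
      \<Longrightarrow> fmap B S U (compose S \<rho> \<pi>) x = fmap B T U \<rho> (fmap B S T \<pi> x)"

definition fi_width :: "('k, 'b) fi_alg \<Rightarrow> nat set \<Rightarrow> 'b \<Rightarrow> nat" where
  "fi_width B S b =
     (LEAST n. \<exists>\<pi>\<in>fi_hom {1..n} S. b \<in> fmap B {1..n} S \<pi> ` carrier (fobj B {1..n}))"

definition fi_fin_gen_width_le_1 :: "('k, 'm) ring_scheme \<Rightarrow> ('k, 'b) fi_alg \<Rightarrow> bool" where
  "fi_fin_gen_width_le_1 K B \<longleftrightarrow> (\<exists>G. finite G \<and>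
     (\<forall>(T, b)\<in>G. finite T \<and> b \<in> carrier (fobj B T) \<and> fi_width B T b \<le> 1) \<and>
     (\<forall>S. finite S \<longrightarrow> carrier (fobj B S) =
        generate_ring (fobj B S)
          ({c \<odot>\<^bsub>fobj B S\<^esub> \<one>\<^bsub>fobj B S\<^esub> | c. c \<in> carrier K} \<union>
           {fmap B T S \<pi> b | T b \<pi>. (T, b) \<in> G \<and> \<pi> \<in> fi_hom T S})))"

definition fi_nice :: "('k, 'b) fi_alg \<Rightarrow> bool" where
  "fi_nice B \<longleftrightarrow> (\<forall>S T \<pi>. finite S \<and> finite T \<and> \<pi> \<in> fi_hom S T
     \<longrightarrow> inj_on (fmap B S T \<pi>) (carrier (fobj B S)))"

definition fi_reduced :: "('k, 'b) fi_alg \<Rightarrow> bool" where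
  "fi_reduced B \<longleftrightarrow> (\<forall>S. finite S \<longrightarrow> (\<forall>x\<in>carrier (fobj B S). \<forall>n::nat.
     x [^]\<^bsub>fobj B S\<^esub> n = \<zero>\<^bsub>fobj B S\<^esub> \<longrightarrow> x = \<zero>\<^bsub>fobj B S\<^esub>))"

definition with_smult :: "('b, 'x) ring_scheme \<Rightarrow> ('k \<Rightarrow> 'b \<Rightarrow> 'b) \<Rightarrow> ('k, 'b) module" where
  "with_smult A sm = \<lparr>carrier = carrier A, monoid.mult = monoid.mult A, one = \<one>\<^bsub>A\<^esub>,
     ring.zero = \<zero>\<^bsub>A\<^esub>, ring.add = ring.add A, smult = sm\<rparr>"

text \<open>The shift is an FI-algebra over \<^term>\<open>fobj B S\<^sub>0\<close>.\<close>

definition fi_shift :: "nat set \<Rightarrow> ('k, 'b) fi_alg \<Rightarrow> ('b, 'b) fi_alg" where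
  "fi_shift S\<^sub>0 B =
     \<lparr>fobj = (\<lambda>S. with_smult (fobj B (fi_sum S\<^sub>0 S))
        (\<lambda>c x. fmap B S\<^sub>0 (fi_sum S\<^sub>0 S) (fi_inl S\<^sub>0) c \<otimes>\<^bsub>fobj B (fi_sum S\<^sub>0 S)\<^esub> x)),
      fmap = (\<lambda>S T \<pi>. fmap B (fi_sum S\<^sub>0 S) (fi_sum S\<^sub>0 T) (fi_sum_map S\<^sub>0 S \<pi>))\<rparr>"


section \<open>Localization\<close>

text \<open>The fraction \<open>a / s\<close> with denominator in the submonoid \<open>M\<close>, as an equivalence class of pairs.
  Operations on fractions are given as the union of the results over all representatives; as these
  results coincide, the union is the resulting class.\<close>

definition fraction :: "('a, 'm) ring_scheme \<Rightarrow> 'a set \<Rightarrow> 'a \<Rightarrow> 'a \<Rightarrow> ('a \<times> 'a) set" where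
  "fraction R M a s = {(b, t). b \<in> carrier R \<and> t \<in> M \<and>
     (\<exists>u\<in>M. u \<otimes>\<^bsub>R\<^esub> (a \<otimes>\<^bsub>R\<^esub> t) = u \<otimes>\<^bsub>R\<^esub> (b \<otimes>\<^bsub>R\<^esub> s))}"

definition localization :: "('a, 'm) ring_scheme \<Rightarrow> 'a set \<Rightarrow> ('a \<times> 'a) set ring" where
  "localization R M =
     \<lparr>carrier = {fraction R M a s | a s. a \<in> carrier R \<and> s \<in> M},
      monoid.mult = (\<lambda>X Y. \<Union>(a, s)\<in>X. \<Union>(b, t)\<in>Y. fraction R M (a \<otimes>\<^bsub>R\<^esub> b) (s \<otimes>\<^bsub>R\<^esub> t)),
      one = fraction R M \<one>\<^bsub>R\<^esub> \<one>\<^bsub>R\<^esub>,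
      ring.zero = fraction R M \<zero>\<^bsub>R\<^esub> \<one>\<^bsub>R\<^esub>,
      ring.add = (\<lambda>X Y. \<Union>(a, s)\<in>X. \<Union>(b, t)\<in>Y.
        fraction R M (a \<otimes>\<^bsub>R\<^esub> t \<oplus>\<^bsub>R\<^esub> b \<otimes>\<^bsub>R\<^esub> s) (s \<otimes>\<^bsub>R\<^esub> t))\<rparr>"

definition fraction_map ::
  "('b, 'm) ring_scheme \<Rightarrow> 'b set \<Rightarrow> ('a \<Rightarrow> 'b) \<Rightarrow> ('a \<times> 'a) set \<Rightarrow> ('b \<times> 'b) set" where
  "fraction_map R' M' f X = (\<Union>(a, s)\<in>X. fraction R' M' (f a) (f s))"

definition powers :: "('a, 'm) ring_scheme \<Rightarrow> 'a \<Rightarrow> 'a set" where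
  "powers R h = {h [^]\<^bsub>R\<^esub> (n::nat) | n. True}"

abbreviation localization_away :: "('a, 'm) ring_scheme \<Rightarrow> 'a \<Rightarrow> ('a \<times> 'a) set ring" where
  "localization_away R h \<equiv> localization R (powers R h)"

text \<open>For an FI-algebra \<open>C\<close> over \<open>K\<close> and \<open>h\<close> in \<open>K\<close>, the FI-algebra \<open>C[1/h]\<close> over \<open>K[1/h]\<close>.\<close>

definition fi_localize ::
  "'k \<Rightarrow> ('k, 'b) fi_alg \<Rightarrow> (('k \<times> 'k) set, ('b \<times> 'b) set) fi_alg" where
  "fi_localize h C = (let hh = (\<lambda>S. powers (fobj C S) (h \<odot>\<^bsub>fobj C S\<^esub> \<one>\<^bsub>fobj C S\<^esub>)) in
     \<lparr>fobj = (\<lambda>S. with_smult (localization (fobj C S) (hh S))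
        (\<lambda>X Y. \<Union>(c, s)\<in>X. \<Union>(a, t)\<in>Y. fraction (fobj C S) (hh S) (c \<odot>\<^bsub>fobj C S\<^esub> a) (s \<odot>\<^bsub>fobj C S\<^esub> t))),
      fmap = (\<lambda>S T \<pi>. fraction_map (fobj C T) (hh T) (fmap C S T \<pi>))\<rparr>)"


section \<open>Tensor powers of an algebra\<close>

text \<open>Finitely supported functions from a monoid to a ring, with convolution product.  They are
  zero (rather than undefined) outside the monoid.\<close>

definition monoid_ring ::
  "('r, 'm) ring_scheme \<Rightarrow> ('g, 'n) monoid_scheme \<Rightarrow> ('g \<Rightarrow> 'r) ring" where
  "monoid_ring R G =
     \<lparr>carrier = {f. range f \<subseteq> carrier R \<and> {m. f m \<noteq> \<zero>\<^bsub>R\<^esub>} \<subseteq> carrier G \<and> finite {m. f m \<noteq> \<zero>\<^bsub>R\<^esub>}},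
      monoid.mult = (\<lambda>f g m. \<Oplus>\<^bsub>R\<^esub>p\<in>{(x, y). f x \<noteq> \<zero>\<^bsub>R\<^esub> \<and> g y \<noteq> \<zero>\<^bsub>R\<^esub> \<and> x \<otimes>\<^bsub>G\<^esub> y = m}.
        f (fst p) \<otimes>\<^bsub>R\<^esub> g (snd p)),
      one = (\<lambda>m. if m = \<one>\<^bsub>G\<^esub> then \<one>\<^bsub>R\<^esub> else \<zero>\<^bsub>R\<^esub>),
      ring.zero = (\<lambda>m. \<zero>\<^bsub>R\<^esub>),
      ring.add = (\<lambda>f g m. f m \<oplus>\<^bsub>R\<^esub> g m)\<rparr>"

definition single :: "('r, 'm) ring_scheme \<Rightarrow> 'r \<Rightarrow> 'g \<Rightarrow> 'g \<Rightarrow> 'r" where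
  "single R c m = (\<lambda>m'. if m' = m then c else \<zero>\<^bsub>R\<^esub>)"

text \<open>The free \<open>R\<close>-module on the set \<open>A\<^sup>S\<close> of families; the product of two basis elements is the
  basis element of the componentwise product.\<close>

definition free_on_families ::
  "('r, 'm) ring_scheme \<Rightarrow> ('r, 'a, 'x) module_scheme \<Rightarrow> nat set \<Rightarrow> ((nat \<Rightarrow> 'a) \<Rightarrow> 'r) ring" where
  "free_on_families R A S = monoid_ring R (product_group S (\<lambda>_. A))"

definition multilinear_relations ::
  "('r, 'm) ring_scheme \<Rightarrow> ('r, 'a, 'x) module_scheme \<Rightarrow> nat set \<Rightarrow> ((nat \<Rightarrow> 'a) \<Rightarrow> 'r) set" where
  "multilinear_relations R A S =
     {single R \<one>\<^bsub>R\<^esub> (m(s := a \<oplus>\<^bsub>A\<^esub> b)) \<ominus>\<^bsub>free_on_families R A S\<^esub>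
        (single R \<one>\<^bsub>R\<^esub> (m(s := a)) \<oplus>\<^bsub>free_on_families R A S\<^esub> single R \<one>\<^bsub>R\<^esub> (m(s := b)))
      | m s a b. m \<in> S \<rightarrow>\<^sub>E carrier A \<and> s \<in> S \<and> a \<in> carrier A \<and> b \<in> carrier A} \<union>
     {single R \<one>\<^bsub>R\<^esub> (m(s := c \<odot>\<^bsub>A\<^esub> a)) \<ominus>\<^bsub>free_on_families R A S\<^esub> single R c (m(s := a))
      | m s a c. m \<in> S \<rightarrow>\<^sub>E carrier A \<and> s \<in> S \<and> a \<in> carrier A \<and> c \<in> carrier R}"

definition multilinear_ideal ::
  "('r, 'm) ring_scheme \<Rightarrow> ('r, 'a, 'x) module_scheme \<Rightarrow> nat set \<Rightarrow> ((nat \<Rightarrow> 'a) \<Rightarrow> 'r) set" where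
  "multilinear_ideal R A S = Idl\<^bsub>free_on_families R A S\<^esub> (multilinear_relations R A S)"

text \<open>The tensor product over \<open>R\<close> of copies of \<open>A\<close> indexed by \<open>S\<close>; for empty \<open>S\<close> this is \<open>R\<close>.\<close>

definition tensor_power ::
  "('r, 'm) ring_scheme \<Rightarrow> ('r, 'a, 'x) module_scheme \<Rightarrow> nat set \<Rightarrow> ('r, ((nat \<Rightarrow> 'a) \<Rightarrow> 'r) set) module" where
  "tensor_power R A S = with_smult (free_on_families R A S Quot multilinear_ideal R A S)
     (\<lambda>c X. \<Union>f\<in>X. multilinear_ideal R A S +>\<^bsub>free_on_families R A S\<^esub> (\<lambda>m. c \<otimes>\<^bsub>R\<^esub> f m))"

definition family_push ::
  "('a, 'm) ring_scheme \<Rightarrow> nat set \<Rightarrow> nat set \<Rightarrow> (nat \<Rightarrow> nat) \<Rightarrow> (nat \<Rightarrow> 'a) \<Rightarrow> nat \<Rightarrow> 'a" where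
  "family_push A S T \<pi> m = (\<lambda>t\<in>T. if t \<in> \<pi> ` S then m (inv_into S \<pi> t) else \<one>\<^bsub>A\<^esub>)"

text \<open>The map \<open>A\<^sup>\<otimes>\<^sup>S \<rightarrow> A\<^sup>\<otimes>\<^sup>T\<close> induced by an injection \<open>\<pi> : S \<rightarrow> T\<close>: it sends the factor with
  index \<open>s\<close> to the factor with index \<open>\<pi> s\<close>, and puts \<open>1\<close> in the remaining factors.\<close>

definition tensor_map ::
  "('r, 'm) ring_scheme \<Rightarrow> ('r, 'a, 'x) module_scheme \<Rightarrow> nat set \<Rightarrow> nat set \<Rightarrow> (nat \<Rightarrow> nat) \<Rightarrow>
   ((nat \<Rightarrow> 'a) \<Rightarrow> 'r) set \<Rightarrow> ((nat \<Rightarrow> 'a) \<Rightarrow> 'r) set" where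
  "tensor_map R A S T \<pi> X = (\<Union>f\<in>X. multilinear_ideal R A T +>\<^bsub>free_on_families R A T\<^esub>
     (\<lambda>m'. \<Oplus>\<^bsub>R\<^esub>m\<in>{m. f m \<noteq> \<zero>\<^bsub>R\<^esub> \<and> family_push A S T \<pi> m = m'}. f m))"

definition fi_tensor_powers ::
  "('r, 'm) ring_scheme \<Rightarrow> ('r, 'a, 'x) module_scheme \<Rightarrow> ('r, ((nat \<Rightarrow> 'a) \<Rightarrow> 'r) set) fi_alg" where
  "fi_tensor_powers R A = \<lparr>fobj = tensor_power R A, fmap = tensor_map R A\<rparr>"


section \<open>Ringed spaces and their morphisms\<close>

text \<open>The records here and below carry data only.  They are used for spectra, where the sheaf axioms,
  the locality of the stalks and the functor laws hold.\<close>

record ('p, 's) ringed_space =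
  rs_top :: "'p topology"
  rs_sec :: "'p set \<Rightarrow> 's ring"
  rs_res :: "'p set \<Rightarrow> 'p set \<Rightarrow> 's \<Rightarrow> 's"  \<comment> \<open>\<open>rs_res X U V\<close> restricts from \<open>U\<close> to \<open>V \<subseteq> U\<close>\<close>

record ('p, 's, 'q, 't) rs_mor =
  mor_pt :: "'p \<Rightarrow> 'q"
  mor_sec :: "'q set \<Rightarrow> 't \<Rightarrow> 's"

definition rs_preimage ::
  "('p, 's) ringed_space \<Rightarrow> ('p, 's, 'q, 't) rs_mor \<Rightarrow> 'q set \<Rightarrow> 'p set" where
  "rs_preimage X f U = {p \<in> topspace (rs_top X). mor_pt f p \<in> U}"

text \<open>For \<open>p \<in> U\<close>, this says that the germ of \<open>s \<in> \<O>(U)\<close> is a unit of the stalk at \<open>p\<close>.\<close>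

definition unit_germ :: "('p, 's) ringed_space \<Rightarrow> 'p \<Rightarrow> 'p set \<Rightarrow> 's \<Rightarrow> bool" where
  "unit_germ X p U s \<longleftrightarrow>
     (\<exists>V. openin (rs_top X) V \<and> p \<in> V \<and> V \<subseteq> U \<and> rs_res X U V s \<in> Units (rs_sec X V))"

text \<open>Morphisms of locally ringed spaces.  The last clause says that the maps on stalks are local
  homomorphisms, i.e. that they reflect units.\<close>

definition lrs_hom ::
  "('p, 's) ringed_space \<Rightarrow> ('q, 't) ringed_space \<Rightarrow> ('p, 's, 'q, 't) rs_mor set" where
  "lrs_hom X Y = {f. continuous_map (rs_top X) (rs_top Y) (mor_pt f) \<and>
     (\<forall>U. openin (rs_top Y) U \<longrightarrow>
        mor_sec f U \<in> ring_hom (rs_sec Y U) (rs_sec X (rs_preimage X f U))) \<and>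
     (\<forall>U V s. openin (rs_top Y) U \<and> openin (rs_top Y) V \<and> V \<subseteq> U \<and> s \<in> carrier (rs_sec Y U) \<longrightarrow>
        mor_sec f V (rs_res Y U V s) =
        rs_res X (rs_preimage X f U) (rs_preimage X f V) (mor_sec f U s)) \<and>
     (\<forall>U s. \<forall>p \<in> rs_preimage X f U. openin (rs_top Y) U \<and> s \<in> carrier (rs_sec Y U) \<and>
        unit_germ X p (rs_preimage X f U) (mor_sec f U s) \<longrightarrow> unit_germ Y (mor_pt f p) U s)}"

text \<open>Equality of morphisms \<open>X \<rightarrow> Y\<close>, disregarding values outside the relevant carriers.\<close>

definition rs_eq ::
  "('p, 's) ringed_space \<Rightarrow> ('q, 't) ringed_space \<Rightarrow>
   ('p, 's, 'q, 't) rs_mor \<Rightarrow> ('p, 's, 'q, 't) rs_mor \<Rightarrow> bool" where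
  "rs_eq X Y f g \<longleftrightarrow> (\<forall>p\<in>topspace (rs_top X). mor_pt f p = mor_pt g p) \<and>
     (\<forall>U. openin (rs_top Y) U \<longrightarrow> (\<forall>s\<in>carrier (rs_sec Y U). mor_sec f U s = mor_sec g U s))"

definition rs_id :: "('p, 's, 'p, 's) rs_mor" where
  "rs_id = \<lparr>mor_pt = id, mor_sec = (\<lambda>U. id)\<rparr>"

text \<open>The composite \<open>g \<circ> f\<close> of \<open>f : X \<rightarrow> Y\<close> and \<open>g : Y \<rightarrow> Z\<close>.\<close>

definition rs_comp ::
  "('q, 't) ringed_space \<Rightarrow> ('q, 't, 'w, 'v) rs_mor \<Rightarrow> ('p, 's, 'q, 't) rs_mor \<Rightarrow>
   ('p, 's, 'w, 'v) rs_mor" where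
  "rs_comp Y g f = \<lparr>mor_pt = mor_pt g \<circ> mor_pt f,
     mor_sec = (\<lambda>W s. mor_sec f (rs_preimage Y g W) (mor_sec g W s))\<rparr>"


section \<open>The spectrum of a ring\<close>

definition primes :: "('a, 'm) ring_scheme \<Rightarrow> 'a set set" where
  "primes R = {p. primeideal p R}"

definition zariski_open :: "('a, 'm) ring_scheme \<Rightarrow> 'a set set \<Rightarrow> bool" where
  "zariski_open R U \<longleftrightarrow> (\<exists>E\<subseteq>carrier R. U = {p \<in> primes R. \<not> E \<subseteq> p})"

lemma istopology_zariski_open: "istopology (zariski_open R)"
  unfolding istopology_def
proof (intro conjI allI impI)
  fix S T assume "zariski_open R S" "zariski_open R T"
  then obtain E F where E: "E \<subseteq> carrier R" "S = {p \<in> primes R. \<not> E \<subseteq> p}"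
    and F: "F \<subseteq> carrier R" "T = {p \<in> primes R. \<not> F \<subseteq> p}"
    unfolding zariski_open_def by blast
  let ?G = "{a \<otimes>\<^bsub>R\<^esub> b | a b. a \<in> E \<and> b \<in> F}"
  show "zariski_open R (S \<inter> T)"
  proof (cases "primes R = {}")
    case True
    then show ?thesis using E F by (auto simp: zariski_open_def)
  next
    case False
    then obtain q where "primeideal q R" by (auto simp: primes_def)
    then interpret R: cring R unfolding primeideal_def by blast
    have "?G \<subseteq> carrier R" using E(1) F(1) by blast
    moreover have "S \<inter> T = {p \<in> primes R. \<not> ?G \<subseteq> p}"
    proof -
      have "(\<not> E \<subseteq> p \<and> \<not> F \<subseteq> p) \<longleftrightarrow> \<not> ?G \<subseteq> p" if "p \<in> primes R" for p
      proof -
        interpret p: primeideal p R using that by (simp add: primes_def)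
        show ?thesis
        proof
          assume "\<not> E \<subseteq> p \<and> \<not> F \<subseteq> p"
          then obtain a b where "a \<in> E" "a \<notin> p" "b \<in> F" "b \<notin> p" by blast
          then have "a \<otimes>\<^bsub>R\<^esub> b \<in> ?G" "a \<otimes>\<^bsub>R\<^esub> b \<notin> p"
            using p.I_prime E(1) F(1) by blast+
          then show "\<not> ?G \<subseteq> p" by blast
        next
          assume "\<not> ?G \<subseteq> p"
          then obtain a b where "a \<in> E" "b \<in> F" "a \<otimes>\<^bsub>R\<^esub> b \<notin> p" by blast
          then show "\<not> E \<subseteq> p \<and> \<not> F \<subseteq> p"
            using p.I_l_closed p.I_r_closed E(1) F(1) by blast
        qed
      qed
      then show ?thesis using E(2) F(2) by blast
    qed
    ultimately show ?thesis unfolding zariski_open_def by blast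
  qed
next
  fix \<K> assume "\<forall>S\<in>\<K>. zariski_open R S"
  then obtain E where E: "\<And>S. S \<in> \<K> \<Longrightarrow> E S \<subseteq> carrier R \<and> S = {p \<in> primes R. \<not> E S \<subseteq> p}"
    unfolding zariski_open_def by metis
  then have "(\<Union>S\<in>\<K>. E S) \<subseteq> carrier R" by blast
  moreover have "\<Union>\<K> = {p \<in> primes R. \<not> (\<Union>S\<in>\<K>. E S) \<subseteq> p}"
    using E by blast
  ultimately show "zariski_open R (\<Union>\<K>)" unfolding zariski_open_def by blast
qed

definition zariski_topology :: "('a, 'm) ring_scheme \<Rightarrow> 'a set topology" where
  "zariski_topology R = topology (zariski_open R)"

lemma openin_zariski_topology [simp]: "openin (zariski_topology R) = zariski_open R"
  by (simp add: zariski_topology_def istopology_zariski_open)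

text \<open>Sections over \<open>U\<close> are the families of elements of the local rings \<open>R\<^sub>p\<close>, \<open>p \<in> U\<close>, that are
  locally given by a single fraction.\<close>

definition spec_sections ::
  "('a, 'm) ring_scheme \<Rightarrow> 'a set set \<Rightarrow> ('a set \<Rightarrow> ('a \<times> 'a) set) ring" where
  "spec_sections R U = (let Rp = (\<lambda>p. localization R (carrier R - p)) in
     \<lparr>carrier = {s \<in> (\<Pi>\<^sub>E p\<in>U. carrier (Rp p)).
        \<forall>p\<in>U. \<exists>V. zariski_open R V \<and> p \<in> V \<and> V \<subseteq> U \<and>
          (\<exists>a\<in>carrier R. \<exists>f\<in>carrier R. \<forall>q\<in>V. f \<notin> q \<and> s q = fraction R (carrier R - q) a f)},
      monoid.mult = (\<lambda>s t. \<lambda>p\<in>U. s p \<otimes>\<^bsub>Rp p\<^esub> t p),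
      one = (\<lambda>p\<in>U. \<one>\<^bsub>Rp p\<^esub>),
      ring.zero = (\<lambda>p\<in>U. \<zero>\<^bsub>Rp p\<^esub>),
      ring.add = (\<lambda>s t. \<lambda>p\<in>U. s p \<oplus>\<^bsub>Rp p\<^esub> t p)\<rparr>)"

type_synonym 'a spectrum = "('a set, 'a set \<Rightarrow> ('a \<times> 'a) set) ringed_space"

definition spec :: "('a, 'm) ring_scheme \<Rightarrow> 'a spectrum" where
  "spec R = \<lparr>rs_top = zariski_topology R, rs_sec = spec_sections R, rs_res = (\<lambda>U V s. restrict s V)\<rparr>"

type_synonym ('a, 'b) spectrum_mor =
  "('a set, 'a set \<Rightarrow> ('a \<times> 'a) set, 'b set, 'b set \<Rightarrow> ('b \<times> 'b) set) rs_mor"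

text \<open>The morphism \<open>spec A \<rightarrow> spec R\<close> induced by a ring homomorphism \<open>f : R \<rightarrow> A\<close>.\<close>

definition spec_map ::
  "('r, 'm) ring_scheme \<Rightarrow> ('a, 'n) ring_scheme \<Rightarrow> ('r \<Rightarrow> 'a) \<Rightarrow> ('a, 'r) spectrum_mor" where
  "spec_map R A f = (let f' = (\<lambda>p. {r \<in> carrier R. f r \<in> p}) in
     \<lparr>mor_pt = f',
      mor_sec = (\<lambda>U s. \<lambda>p\<in>{p \<in> primes A. f' p \<in> U}. fraction_map A (carrier A - p) f (s (f' p)))\<rparr>)"


section \<open>FI-op-schemes\<close>

text \<open>Contravariant functors from FI to schemes over a base scheme; the component
  \<open>sch_str\<close> gives the structure morphisms to the base.\<close>

record ('p, 's, 'q, 't) fi_op_scheme =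
  sch_obj :: "nat set \<Rightarrow> ('p, 's) ringed_space"
  sch_map :: "nat set \<Rightarrow> nat set \<Rightarrow> (nat \<Rightarrow> nat) \<Rightarrow> ('p, 's, 'p, 's) rs_mor"
  sch_str :: "nat set \<Rightarrow> ('p, 's, 'q, 't) rs_mor"

type_synonym ('b, 'k) affine_fi_op_scheme =
  "('b set, 'b set \<Rightarrow> ('b \<times> 'b) set, 'k set, 'k set \<Rightarrow> ('k \<times> 'k) set) fi_op_scheme"

definition fi_spec :: "('k, 'm) ring_scheme \<Rightarrow> ('k, 'b) fi_alg \<Rightarrow> ('b, 'k) affine_fi_op_scheme" where
  "fi_spec K B =
     \<lparr>sch_obj = (\<lambda>S. spec (fobj B S)),
      sch_map = (\<lambda>S T \<pi>. spec_map (fobj B S) (fobj B T) (fmap B S T \<pi>)),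
      sch_str = (\<lambda>S. spec_map K (fobj B S) (\<lambda>c. c \<odot>\<^bsub>fobj B S\<^esub> \<one>\<^bsub>fobj B S\<^esub>))\<rparr>"

text \<open>Morphisms of FI-op-schemes over the base \<open>Q\<close>, i.e. natural transformations.\<close>

definition fi_op_hom ::
  "('q, 't) ringed_space \<Rightarrow> ('p, 's, 'q, 't) fi_op_scheme \<Rightarrow> ('w, 'v, 'q, 't) fi_op_scheme \<Rightarrow>
   (nat set \<Rightarrow> ('p, 's, 'w, 'v) rs_mor) set" where
  "fi_op_hom Q X Y = {F.
     (\<forall>S. finite S \<longrightarrow> F S \<in> lrs_hom (sch_obj X S) (sch_obj Y S) \<and>
        rs_eq (sch_obj X S) Q (rs_comp (sch_obj Y S) (sch_str Y S) (F S)) (sch_str X S)) \<and>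
     (\<forall>S T \<pi>. finite S \<and> finite T \<and> \<pi> \<in> fi_hom S T \<longrightarrow>
        rs_eq (sch_obj X T) (sch_obj Y S)
          (rs_comp (sch_obj X S) (F S) (sch_map X S T \<pi>))
          (rs_comp (sch_obj Y T) (sch_map Y S T \<pi>) (F T)))}"

definition fi_op_isomorphic ::
  "('q, 't) ringed_space \<Rightarrow> ('p, 's, 'q, 't) fi_op_scheme \<Rightarrow> ('w, 'v, 'q, 't) fi_op_scheme \<Rightarrow> bool" where
  "fi_op_isomorphic Q X Y \<longleftrightarrow> (\<exists>F\<in>fi_op_hom Q X Y. \<exists>G\<in>fi_op_hom Q Y X. \<forall>S. finite S \<longrightarrow>
     rs_eq (sch_obj X S) (sch_obj X S) (rs_comp (sch_obj Y S) (G S) (F S)) rs_id \<and>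
     rs_eq (sch_obj Y S) (sch_obj Y S) (rs_comp (sch_obj X S) (F S) (G S)) rs_id)"

text \<open>For \<open>Z = Spec A\<close> affine over \<open>Spec R\<close>, the fibre product over \<open>Spec R\<close> of copies of \<open>Z\<close> indexed
  by \<open>S\<close> is the spectrum of the tensor product over \<open>R\<close> of copies of \<open>A\<close>; an injection
  \<open>\<pi> : S \<rightarrow> T\<close> acts by \<open>Z\<^sup>T \<rightarrow> Z\<^sup>S\<close>, whose \<open>s\<close>-th component is the \<open>\<pi> s\<close>-th projection.\<close>

definition fibre_powers ::
  "('r, 'm) ring_scheme \<Rightarrow> ('r, 'a, 'x) module_scheme \<Rightarrow>
   (((nat \<Rightarrow> 'a) \<Rightarrow> 'r) set, 'r) affine_fi_op_scheme" where
  "fibre_powers R A = fi_spec R (fi_tensor_powers R A)"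

end

theory Submission
  imports Defs "HOL-Library.List_Lenlexorder"
begin

text \<open>The generators of width \<open>0\<close> lie in the image of \<open>B\<^sub>0\<close>, so each \<open>B(S)\<close> is spanned over \<open>B\<^sub>0\<close> by
  products over \<open>s \<in> S\<close> of monomials in the copies at \<open>s\<close> of finitely many elements of \<open>B([1])\<close>.
  For a finite set \<open>T\<close> and \<open>h \<in> B(T)\<close>, collect the exponents of the monomials at a new point that are
  leading monomials of a relation with coefficients in \<open>B(T)\<close> and leading coefficient a power of
  \<open>h\<close>. This set is closed upwards, so by Dickson's lemma it is maximal for some \<open>(S\<^sub>0, h)\<close> with
  \<open>h \<noteq> 0\<close>. After inverting \<open>h\<close>, the remaining monomials span \<open>B'([1])\<close> over
  \<open>R = B(S\<^sub>0)[1/h]\<close>. They are linearly independent at a new point even over \<open>B'(S)\<close>: a relation with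
  leading coefficient \<open>g \<noteq> 0\<close> would, after clearing denominators, enlarge the set for
  \<open>(S\<^sub>0 \<squnion> S, h g)\<close>. Hence \<open>B'(S)\<close> has the products of these monomials over \<open>s \<in> S\<close> as an
  \<open>R\<close>-basis, so it is the tensor power of \<open>B'([1])\<close> over \<open>R\<close> indexed by \<open>S\<close>.\<close>

section \<open>Localization\<close>

text \<open>The rings may have zero divisors, so there is no fraction field and no generic rank to
  count with; maximality of a set of exponents replaces them. Allowing any power of \<open>h\<close>
  as leading coefficient has a purpose: clearing denominators and lifting an equation from a
  localization each cost an unknown power of \<open>h\<close>, and a relation led by a power of
  \<open>h\<close> yields one led by a power of any multiple of \<open>h\<close>.

  Independence at a new point is wanted over B'(S) and not only over \<open>R\<close>, because then
  the points of S can be added one at a time: the coefficients collected at the last point lie in B'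
  of the earlier ones. The induction starts at the empty set with the injectivity of
  \<open>R\<close> into B'({}), and this is where niceness enters.

  Spectra enter only through functoriality: a natural family of ring isomorphisms from the tensor
  powers to B'(S) is enough. The tensor power is a quotient of a monoid ring; that its ideal is the
  whole kernel follows by reducing families modulo the ideal to families of basis elements, whose
  images are independent.\<close>

locale mult_set = cring R for R (structure) +
  fixes M
  assumes M_closed: "M \<subseteq> carrier R"
    and one_in_M [simp]: "\<one> \<in> M"
    and mult_in_M [simp]: "s \<in> M \<Longrightarrow> t \<in> M \<Longrightarrow> s \<otimes> t \<in> M"
begin

abbreviation "quo \<equiv> fraction R M"
abbreviation "L \<equiv> localization R M"

lemma M_carr [simp]: "s \<in> M \<Longrightarrow> s \<in> carrier R"
  using M_closed by blast

text \<open>The witness is \<open>u \<otimes> v \<otimes> t\<close>: the middle denominator has to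
  be cancelled as well, and the free factor in the definition of \<open>fraction\<close> permits
  this even if \<open>M\<close> contains zero divisors.\<close>

lemma mem_fraction_trans:
  assumes "(b, t) \<in> quo a s" "(c, r) \<in> quo b t" and [simp]: "a \<in> carrier R" "s \<in> M"
  shows "(c, r) \<in> quo a s"
proof -
  from assms obtain u v where [simp]: "u \<in> M" "v \<in> M" "b \<in> carrier R" "t \<in> M" "c \<in> carrier R" "r \<in> M"
    and u: "u \<otimes> (a \<otimes> t) = u \<otimes> (b \<otimes> s)" and v: "v \<otimes> (b \<otimes> r) = v \<otimes> (c \<otimes> t)"
    unfolding fraction_def by blast
  have "(u \<otimes> v \<otimes> t) \<otimes> (a \<otimes> r) = (v \<otimes> r) \<otimes> (u \<otimes> (a \<otimes> t))" by (simp add: m_ac)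
  also have "\<dots> = (u \<otimes> s) \<otimes> (v \<otimes> (b \<otimes> r))" by (simp add: u) (simp add: m_ac)
  also have "\<dots> = (u \<otimes> v \<otimes> t) \<otimes> (c \<otimes> s)" by (simp add: v) (simp add: m_ac)
  finally have "(u \<otimes> v \<otimes> t) \<otimes> (a \<otimes> r) = (u \<otimes> v \<otimes> t) \<otimes> (c \<otimes> s)" .
  then show ?thesis unfolding fraction_def by (auto intro!: bexI[of _ "u \<otimes> v \<otimes> t"])
qed

lemma mem_fraction_sym:
  "(b, t) \<in> quo a s \<Longrightarrow> a \<in> carrier R \<Longrightarrow> s \<in> M \<Longrightarrow> (a, s) \<in> quo b t"
  unfolding fraction_def by (auto intro: sym)

lemma mem_fraction_refl: "a \<in> carrier R \<Longrightarrow> s \<in> M \<Longrightarrow> (a, s) \<in> quo a s"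
  unfolding fraction_def using one_in_M by blast

lemma mem_fractionD: "(b, t) \<in> quo a s \<Longrightarrow> b \<in> carrier R \<and> t \<in> M"
  unfolding fraction_def by blast

lemma mem_fraction_iff:
  assumes "a \<in> carrier R" "s \<in> M"
  shows "(b, t) \<in> quo a s \<longleftrightarrow> b \<in> carrier R \<and> t \<in> M \<and> quo b t = quo a s"
proof
  assume 1: "(b, t) \<in> quo a s"
  then have bt: "b \<in> carrier R" "t \<in> M" using mem_fractionD by blast+
  have "(c, r) \<in> quo b t \<longleftrightarrow> (c, r) \<in> quo a s" for c r
    using mem_fraction_trans[OF 1 _ assms] mem_fraction_trans[OF mem_fraction_sym[OF 1 assms] _ bt] by blast
  then show "b \<in> carrier R \<and> t \<in> M \<and> quo b t = quo a s" using bt by auto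
next
  assume "b \<in> carrier R \<and> t \<in> M \<and> quo b t = quo a s"
  then show "(b, t) \<in> quo a s" using mem_fraction_refl by metis
qed

lemma fraction_eq_iff:
  assumes "a \<in> carrier R" "s \<in> M" "b \<in> carrier R" "t \<in> M"
  shows "quo a s = quo b t \<longleftrightarrow> (\<exists>u\<in>M. u \<otimes> (a \<otimes> t) = u \<otimes> (b \<otimes> s))"
proof -
  have "(b, t) \<in> quo a s \<longleftrightarrow> (\<exists>u\<in>M. u \<otimes> (a \<otimes> t) = u \<otimes> (b \<otimes> s))"
    using assms unfolding fraction_def by simp
  then show ?thesis using mem_fraction_iff[of a s b t] assms by auto
qed

lemma fraction_eqI:
  assumes "u \<in> M" "u \<otimes> (a \<otimes> t) = u \<otimes> (b \<otimes> s)" "a \<in> carrier R" "s \<in> M" "b \<in> carrier R" "t \<in> M"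
  shows "quo a s = quo b t"
  using assms by (auto simp: fraction_eq_iff)

lemma fraction_eqI1:
  assumes "a \<otimes> t = b \<otimes> s" "a \<in> carrier R" "s \<in> M" "b \<in> carrier R" "t \<in> M"
  shows "quo a s = quo b t"
  using assms by (intro fraction_eqI[OF one_in_M]) auto

text \<open>Operations on fractions are defined as unions over all representatives. If the member of
  the union is constant on the class, the union collapses to its value at one representative; all
  evaluations of operations on fractions rest on this.\<close>

lemma Union_fraction:
  assumes "a \<in> carrier R" "s \<in> M"
    and "\<And>b t. b \<in> carrier R \<Longrightarrow> t \<in> M \<Longrightarrow> quo b t = quo a s \<Longrightarrow> F b t = F a s"
  shows "(\<Union>(b, t)\<in>quo a s. F b t) = F a s"
proof -
  have "F b t = F a s" if "(b, t) \<in> quo a s" for b t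
    using that assms(3) mem_fraction_iff[OF assms(1,2)] by blast
  then have "(\<Union>(b, t)\<in>quo a s. F b t) = (\<Union>p\<in>quo a s. F a s)"
    by (intro SUP_cong refl) (simp only: split_paired_all prod.case)
  then show ?thesis using mem_fraction_refl[OF assms(1,2)] by (metis UN_constant empty_iff)
qed

lemma carrier_L: "carrier L = {quo a s | a s. a \<in> carrier R \<and> s \<in> M}"
  by (simp add: localization_def)

lemma fraction_in_L [simp]: "a \<in> carrier R \<Longrightarrow> s \<in> M \<Longrightarrow> quo a s \<in> carrier L"
  unfolding carrier_L by blast

lemma L_cases:
  assumes "X \<in> carrier L"
  obtains a s where "X = quo a s" "a \<in> carrier R" "s \<in> M"
  using assms unfolding carrier_L by blast

end

text \<open>Two different rings are allowed because the scalar product of \<open>fi_localize\<close>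
  combines a fraction over the base with a fraction over the algebra.\<close>

lemma Union_fraction2:
  assumes "mult_set R M" "mult_set R' M'"
    and "a \<in> carrier R" "s \<in> M" "b \<in> carrier R'" "t \<in> M'"
    and F: "\<And>a' s' b' t'. a' \<in> carrier R \<Longrightarrow> s' \<in> M \<Longrightarrow> b' \<in> carrier R' \<Longrightarrow> t' \<in> M' \<Longrightarrow>
      fraction R M a' s' = fraction R M a s \<Longrightarrow> fraction R' M' b' t' = fraction R' M' b t \<Longrightarrow>
      F a' s' b' t' = F a s b t"
  shows "(\<Union>(a, s)\<in>fraction R M a s. \<Union>(b, t)\<in>fraction R' M' b t. F a s b t) = F a s b t"
proof -
  interpret R: mult_set R M by fact
  interpret R': mult_set R' M' by fact
  have 1: "(\<Union>(b, t)\<in>R'.quo b t. F a' s' b t) = F a s b t"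
    if "a' \<in> carrier R" "s' \<in> M" "R.quo a' s' = R.quo a s" for a' s'
  proof -
    have "(\<Union>(b, t)\<in>R'.quo b t. F a' s' b t) = F a' s' b t"
    proof (rule R'.Union_fraction)
      fix b' t' assume "b' \<in> carrier R'" "t' \<in> M'" "R'.quo b' t' = R'.quo b t"
      then have "F a' s' b' t' = F a s b t" using that F by metis
      also have "F a s b t = F a' s' b t" using that assms(5,6) F by metis
      finally show "F a' s' b' t' = F a' s' b t" .
    qed fact+
    then show ?thesis using that assms(5,6) F by metis
  qed
  have "(\<Union>(a, s)\<in>R.quo a s. \<Union>(b, t)\<in>R'.quo b t. F a s b t) = (\<Union>(b, t)\<in>R'.quo b t. F a s b t)"
    using assms(3,4) 1 by (intro R.Union_fraction) metis+
  also have "\<dots> = F a s b t" using 1 assms(3,4) by metis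
  finally show ?thesis .
qed

context mult_set
begin

lemma L_mult:
  assumes [simp]: "a \<in> carrier R" "s \<in> M" "b \<in> carrier R" "t \<in> M"
  shows "quo a s \<otimes>\<^bsub>L\<^esub> quo b t = quo (a \<otimes> b) (s \<otimes> t)"
  unfolding localization_def monoid.simps partial_object.simps
proof (rule Union_fraction2[OF mult_set_axioms mult_set_axioms])
  fix a' s' b' t' assume [simp]: "a' \<in> carrier R" "s' \<in> M" "b' \<in> carrier R" "t' \<in> M"
    and "quo a' s' = quo a s" "quo b' t' = quo b t"
  then obtain u v where [simp]: "u \<in> M" "v \<in> M" and u: "u \<otimes> (a' \<otimes> s) = u \<otimes> (a \<otimes> s')"
    and v: "v \<otimes> (b' \<otimes> t) = v \<otimes> (b \<otimes> t')" by (auto simp: fraction_eq_iff)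
  have "(u \<otimes> v) \<otimes> (a' \<otimes> b' \<otimes> (s \<otimes> t)) = (u \<otimes> (a' \<otimes> s)) \<otimes> (v \<otimes> (b' \<otimes> t))" by (simp add: m_ac)
  also have "\<dots> = (u \<otimes> v) \<otimes> (a \<otimes> b \<otimes> (s' \<otimes> t'))" unfolding u v by (simp add: m_ac)
  finally show "quo (a' \<otimes> b') (s' \<otimes> t') = quo (a \<otimes> b) (s \<otimes> t)"
    by (intro fraction_eqI[of "u \<otimes> v"]) auto
qed auto

lemma L_add:
  assumes [simp]: "a \<in> carrier R" "s \<in> M" "b \<in> carrier R" "t \<in> M"
  shows "quo a s \<oplus>\<^bsub>L\<^esub> quo b t = quo (a \<otimes> t \<oplus> b \<otimes> s) (s \<otimes> t)"
  unfolding localization_def ring.simps monoid.simps partial_object.simps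
proof (rule Union_fraction2[OF mult_set_axioms mult_set_axioms])
  fix a' s' b' t' assume [simp]: "a' \<in> carrier R" "s' \<in> M" "b' \<in> carrier R" "t' \<in> M"
    and "quo a' s' = quo a s" "quo b' t' = quo b t"
  then obtain u v where [simp]: "u \<in> M" "v \<in> M" and u: "u \<otimes> (a' \<otimes> s) = u \<otimes> (a \<otimes> s')"
    and v: "v \<otimes> (b' \<otimes> t) = v \<otimes> (b \<otimes> t')" by (auto simp: fraction_eq_iff)
  have "(u \<otimes> v) \<otimes> ((a' \<otimes> t' \<oplus> b' \<otimes> s') \<otimes> (s \<otimes> t)) =
      (v \<otimes> t \<otimes> t') \<otimes> (u \<otimes> (a' \<otimes> s)) \<oplus> (u \<otimes> s \<otimes> s') \<otimes> (v \<otimes> (b' \<otimes> t))"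
    by (simp add: m_ac l_distr r_distr)
  also have "\<dots> = (u \<otimes> v) \<otimes> ((a \<otimes> t \<oplus> b \<otimes> s) \<otimes> (s' \<otimes> t'))"
    unfolding u v by (simp add: m_ac l_distr r_distr)
  finally show "quo (a' \<otimes> t' \<oplus> b' \<otimes> s') (s' \<otimes> t') = quo (a \<otimes> t \<oplus> b \<otimes> s) (s \<otimes> t)"
    by (intro fraction_eqI[of "u \<otimes> v"]) auto
qed auto

lemma L_one: "\<one>\<^bsub>L\<^esub> = quo \<one> \<one>" and L_zero: "\<zero>\<^bsub>L\<^esub> = quo \<zero> \<one>"
  by (auto simp: localization_def)

lemma abelian_group_L: "abelian_group L"
proof (rule abelian_groupI)
  fix X assume "X \<in> carrier L"
  then obtain a s where [simp]: "X = quo a s" "a \<in> carrier R" "s \<in> M" by (rule L_cases)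
  show "\<zero>\<^bsub>L\<^esub> \<oplus>\<^bsub>L\<^esub> X = X" by (simp add: L_add L_zero)
  have "quo (\<ominus> a) s \<oplus>\<^bsub>L\<^esub> X = \<zero>\<^bsub>L\<^esub>"
    by (simp add: L_add L_zero) (intro fraction_eqI1; simp add: l_minus l_neg)
  then show "\<exists>Y\<in>carrier L. Y \<oplus>\<^bsub>L\<^esub> X = \<zero>\<^bsub>L\<^esub>" by (intro bexI[of _ "quo (\<ominus> a) s"]) auto
  fix Y assume "Y \<in> carrier L"
  then obtain b t where [simp]: "Y = quo b t" "b \<in> carrier R" "t \<in> M" by (rule L_cases)
  show "X \<oplus>\<^bsub>L\<^esub> Y \<in> carrier L" by (simp add: L_add)
  show "X \<oplus>\<^bsub>L\<^esub> Y = Y \<oplus>\<^bsub>L\<^esub> X"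
    by (simp add: L_add a_comm[of "a \<otimes> t"] m_comm[of s t])
  fix Z assume "Z \<in> carrier L"
  then obtain c r where [simp]: "Z = quo c r" "c \<in> carrier R" "r \<in> M" by (rule L_cases)
  show "X \<oplus>\<^bsub>L\<^esub> Y \<oplus>\<^bsub>L\<^esub> Z = X \<oplus>\<^bsub>L\<^esub> (Y \<oplus>\<^bsub>L\<^esub> Z)"
    by (simp add: L_add l_distr r_distr m_ac a_assoc)
qed (simp add: L_zero)

lemma comm_monoid_L: "comm_monoid L"
proof (rule comm_monoidI)
  fix X assume "X \<in> carrier L"
  then obtain a s where [simp]: "X = quo a s" "a \<in> carrier R" "s \<in> M" by (rule L_cases)
  show "\<one>\<^bsub>L\<^esub> \<otimes>\<^bsub>L\<^esub> X = X" by (simp add: L_mult L_one)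
  fix Y assume "Y \<in> carrier L"
  then obtain b t where [simp]: "Y = quo b t" "b \<in> carrier R" "t \<in> M" by (rule L_cases)
  show "X \<otimes>\<^bsub>L\<^esub> Y \<in> carrier L" by (simp add: L_mult)
  show "X \<otimes>\<^bsub>L\<^esub> Y = Y \<otimes>\<^bsub>L\<^esub> X"
    by (simp add: L_mult m_comm)
  fix Z assume "Z \<in> carrier L"
  then obtain c r where [simp]: "Z = quo c r" "c \<in> carrier R" "r \<in> M" by (rule L_cases)
  show "X \<otimes>\<^bsub>L\<^esub> Y \<otimes>\<^bsub>L\<^esub> Z = X \<otimes>\<^bsub>L\<^esub> (Y \<otimes>\<^bsub>L\<^esub> Z)"
    by (simp add: L_mult m_assoc)
qed (simp add: L_one)

lemma cring_L: "cring L"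
proof (rule cringI[OF abelian_group_L comm_monoid_L])
  fix X Y Z assume "X \<in> carrier L" "Y \<in> carrier L" "Z \<in> carrier L"
  then obtain a s b t c r where [simp]: "X = quo a s" "a \<in> carrier R" "s \<in> M"
    "Y = quo b t" "b \<in> carrier R" "t \<in> M" "Z = quo c r" "c \<in> carrier R" "r \<in> M"
    by (elim L_cases)
  show "(X \<oplus>\<^bsub>L\<^esub> Y) \<otimes>\<^bsub>L\<^esub> Z = X \<otimes>\<^bsub>L\<^esub> Z \<oplus>\<^bsub>L\<^esub> Y \<otimes>\<^bsub>L\<^esub> Z"
    by (simp add: L_mult L_add) (rule fraction_eqI1; simp add: l_distr r_distr m_ac)
qed

lemma fraction_eq_zero_iff:
  assumes "a \<in> carrier R" "s \<in> M"
  shows "quo a s = \<zero>\<^bsub>L\<^esub> \<longleftrightarrow> (\<exists>u\<in>M. u \<otimes> a = \<zero>)"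
  unfolding L_zero using assms by (auto simp: fraction_eq_iff)

lemma fraction_hom: "(\<lambda>a. quo a \<one>) \<in> ring_hom R L"
  by (rule ring_hom_memI) (auto simp: L_mult L_add L_one)

lemma fraction_self: "s \<in> M \<Longrightarrow> quo s s = \<one>\<^bsub>L\<^esub>"
  unfolding L_one by (rule fraction_eqI1) auto

end

text \<open>Applying \<open>f\<close> to an identity that witnesses the equality of two fractions
  gives a witness for their images, because \<open>f\<close> sends \<open>M\<close> into
  \<open>M'\<close>.\<close>

lemma fraction_map_eq:
  assumes "mult_set R M" "mult_set R' M'" "f \<in> ring_hom R R'" "f ` M \<subseteq> M'" "a \<in> carrier R" "s \<in> M"
  shows "fraction_map R' M' f (fraction R M a s) = fraction R' M' (f a) (f s)"
proof -
  interpret R: mult_set R M by fact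
  interpret R': mult_set R' M' by fact
  have [simp]: "f x \<in> M'" if "x \<in> M" for x using that assms(4) by blast
  note [simp] = ring_hom_closed[OF assms(3)] assms(5,6)
  show ?thesis unfolding fraction_map_def
  proof (rule R.Union_fraction)
    fix b t assume [simp]: "b \<in> carrier R" "t \<in> M" and "R.quo b t = R.quo a s"
    then obtain u where [simp]: "u \<in> M" and "u \<otimes>\<^bsub>R\<^esub> (b \<otimes>\<^bsub>R\<^esub> s) = u \<otimes>\<^bsub>R\<^esub> (a \<otimes>\<^bsub>R\<^esub> t)"
      by (auto simp: R.fraction_eq_iff)
    then have "f (u \<otimes>\<^bsub>R\<^esub> (b \<otimes>\<^bsub>R\<^esub> s)) = f (u \<otimes>\<^bsub>R\<^esub> (a \<otimes>\<^bsub>R\<^esub> t))" by simp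
    then show "R'.quo (f b) (f t) = R'.quo (f a) (f s)"
      by (intro R'.fraction_eqI[of "f u"]) (auto simp: ring_hom_mult[OF assms(3)])
  qed auto
qed

lemma fraction_map_hom:
  assumes "mult_set R M" "mult_set R' M'" "f \<in> ring_hom R R'" "f ` M \<subseteq> M'"
  shows "fraction_map R' M' f \<in> ring_hom (localization R M) (localization R' M')"
proof -
  interpret R: mult_set R M by fact
  interpret R': mult_set R' M' by fact
  have [simp]: "f x \<in> M'" if "x \<in> M" for x using that assms(4) by blast
  note [simp] = ring_hom_closed[OF assms(3)] ring_hom_mult[OF assms(3)] ring_hom_add[OF assms(3)]
    ring_hom_one[OF assms(3)] fraction_map_eq[OF assms]
  show ?thesis
  proof (rule ring_hom_memI)
    fix X assume "X \<in> carrier R.L"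
    then obtain a s where [simp]: "X = R.quo a s" "a \<in> carrier R" "s \<in> M" by (rule R.L_cases)
    show "fraction_map R' M' f X \<in> carrier R'.L" by simp
    fix Y assume "Y \<in> carrier R.L"
    then obtain b t where [simp]: "Y = R.quo b t" "b \<in> carrier R" "t \<in> M" by (rule R.L_cases)
    show "fraction_map R' M' f (X \<otimes>\<^bsub>R.L\<^esub> Y) = fraction_map R' M' f X \<otimes>\<^bsub>R'.L\<^esub> fraction_map R' M' f Y"
      by (simp add: R.L_mult R'.L_mult)
    show "fraction_map R' M' f (X \<oplus>\<^bsub>R.L\<^esub> Y) = fraction_map R' M' f X \<oplus>\<^bsub>R'.L\<^esub> fraction_map R' M' f Y"
      by (simp add: R.L_add R'.L_add)
  qed (simp add: R.L_one R'.L_one)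
qed

lemma mult_set_powers:
  assumes "cring R" "h \<in> carrier R"
  shows "mult_set R (powers R h)"
proof -
  interpret cring R by fact
  show ?thesis
  proof
    show "powers R h \<subseteq> carrier R" using assms(2) by (auto simp: powers_def)
    show "\<one>\<^bsub>R\<^esub> \<in> powers R h" by (auto simp: powers_def intro!: exI[of _ "0::nat"])
    show "s \<otimes>\<^bsub>R\<^esub> t \<in> powers R h" if "s \<in> powers R h" "t \<in> powers R h" for s t
      using that nat_pow_mult[OF assms(2)] unfolding powers_def by blast
  qed
qed

lemma powers_hom_image:
  assumes "cring R" "cring R'" "f \<in> ring_hom R R'" "h \<in> carrier R"
  shows "f ` powers R h \<subseteq> powers R' (f h)"
proof -
  interpret R: cring R by fact
  interpret R': cring R' by fact
  interpret f: ring_hom_cring R R' f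
    by (simp add: assms ring_hom_cring.intro ring_hom_cring_axioms.intro)
  show ?thesis using assms(4) unfolding powers_def by (auto simp: f.hom_pow) 
qed

section \<open>Shifts and localizations of FI-algebras\<close>

lemma with_smult_simps [simp]:
  "carrier (with_smult A sm) = carrier A" "monoid.mult (with_smult A sm) = monoid.mult A"
  "one (with_smult A sm) = one A" "ring.zero (with_smult A sm) = ring.zero A"
  "ring.add (with_smult A sm) = ring.add A" "smult (with_smult A sm) = sm"
  by (simp_all add: with_smult_def)

lemma cring_with_smult:
  assumes "cring A" shows "cring (with_smult A sm)"
proof -
  interpret cring A by fact
  show ?thesis
  proof (rule cringI)
    show "abelian_group (with_smult A sm)"
      by (rule abelian_groupI) (auto simp: a_assoc intro: a_comm l_neg)
    show "comm_monoid (with_smult A sm)"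
      by (rule comm_monoidI) (auto simp: m_assoc intro: m_comm)
  qed (auto simp: l_distr)
qed

lemma ring_hom_with_smult [simp]:
  "ring_hom (with_smult A sm) B = ring_hom A B" "ring_hom B (with_smult A sm) = ring_hom B A"
  by (simp_all add: ring_hom_def)

lemma ring_iso_with_smult [simp]:
  "ring_iso (with_smult A sm) B = ring_iso A B" "ring_iso B (with_smult A sm) = ring_iso B A"
  by (simp_all add: ring_iso_def)

lemma nat_pow_with_smult [simp]: "x [^]\<^bsub>with_smult A sm\<^esub> (n::nat) = x [^]\<^bsub>A\<^esub> n"
  by (simp add: nat_pow_def)

lemma powers_with_smult [simp]: "powers (with_smult A sm) = powers A"
  by (simp add: powers_def fun_eq_iff)

lemma fraction_with_smult [simp]: "fraction (with_smult A sm) = fraction A"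
  by (simp add: fraction_def fun_eq_iff)

lemma localization_with_smult [simp]: "localization (with_smult A sm) = localization A"
  by (simp add: localization_def fun_eq_iff)

lemma fraction_map_with_smult [simp]: "fraction_map (with_smult A sm) = fraction_map A"
  by (simp add: fraction_map_def fun_eq_iff)

text \<open>The scalar product is compared with \<open>g\<close> on the carriers only: for a
  localization it is a union over representatives, which is controlled on genuine fractions and
  nowhere else.\<close>

lemma algebra_with_smult:
  assumes R: "cring R" and A: "cring A" and g: "g \<in> ring_hom R A"
    and sm: "\<And>c x. c \<in> carrier R \<Longrightarrow> x \<in> carrier A \<Longrightarrow> sm c x = g c \<otimes>\<^bsub>A\<^esub> x"
  shows "algebra R (with_smult A sm)"
proof -
  interpret R: cring R by fact
  interpret A: cring A by fact
  note [simp] = ring_hom_closed[OF g] ring_hom_add[OF g] ring_hom_mult[OF g] ring_hom_one[OF g] sm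
  show ?thesis
    by (rule algebraI[OF R cring_with_smult[OF A]]) (auto simp: A.l_distr A.r_distr A.m_assoc)
qed

context algebra
begin

lemma smult_eq_mult: "c \<in> carrier R \<Longrightarrow> x \<in> carrier M \<Longrightarrow> c \<odot>\<^bsub>M\<^esub> x = (c \<odot>\<^bsub>M\<^esub> \<one>\<^bsub>M\<^esub>) \<otimes>\<^bsub>M\<^esub> x"
  by (simp add: smult_assoc2)

lemma unit_hom: "(\<lambda>c. c \<odot>\<^bsub>M\<^esub> \<one>\<^bsub>M\<^esub>) \<in> ring_hom R M"
  by (rule ring_hom_memI) (auto simp: smult_l_distr smult_assoc1 smult_assoc2)

end

context fi_algebra
begin

lemma cring_obj: "finite S \<Longrightarrow> cring (fobj B S)"
  using obj_algebra algebra.M_cring by blast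

lemma cring_base: "cring K"
  using obj_algebra[of "{}"] algebra.R_cring by blast

lemma map_ring_hom:
  "\<lbrakk>finite S; finite T; \<pi> \<in> fi_hom S T\<rbrakk> \<Longrightarrow> fmap B S T \<pi> \<in> ring_hom (fobj B S) (fobj B T)"
  using map_hom unfolding alg_hom_def by blast

lemma map_smult:
  "\<lbrakk>finite S; finite T; \<pi> \<in> fi_hom S T; c \<in> carrier K; x \<in> carrier (fobj B S)\<rbrakk> \<Longrightarrow>
    fmap B S T \<pi> (c \<odot>\<^bsub>fobj B S\<^esub> x) = c \<odot>\<^bsub>fobj B T\<^esub> fmap B S T \<pi> x"
  using map_hom unfolding alg_hom_def by blast

lemma map_unit:
  assumes "finite S" "finite T" "\<pi> \<in> fi_hom S T" "c \<in> carrier K"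
  shows "fmap B S T \<pi> (c \<odot>\<^bsub>fobj B S\<^esub> \<one>\<^bsub>fobj B S\<^esub>) = c \<odot>\<^bsub>fobj B T\<^esub> \<one>\<^bsub>fobj B T\<^esub>"
proof -
  interpret S: cring "fobj B S" using assms cring_obj by blast
  show ?thesis using assms map_smult ring_hom_one[OF map_ring_hom] by simp
qed

end

lemma fi_homI: "\<pi> \<in> S \<rightarrow>\<^sub>E T \<Longrightarrow> inj_on \<pi> S \<Longrightarrow> \<pi> \<in> fi_hom S T"
  by (simp add: fi_hom_def)

lemma fi_hom_mem: "\<pi> \<in> fi_hom S T \<Longrightarrow> x \<in> S \<Longrightarrow> \<pi> x \<in> T"
  by (auto simp: fi_hom_def)

lemma fi_hom_eq_iff: "\<pi> \<in> fi_hom S T \<Longrightarrow> x \<in> S \<Longrightarrow> y \<in> S \<Longrightarrow> \<pi> x = \<pi> y \<longleftrightarrow> x = y"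
  by (auto simp: fi_hom_def inj_on_def)

lemma fi_hom_compose: "\<pi> \<in> fi_hom S T \<Longrightarrow> \<rho> \<in> fi_hom T U \<Longrightarrow> compose S \<rho> \<pi> \<in> fi_hom S U"
  by (rule fi_homI) (auto simp: compose_def inj_on_def fi_hom_mem fi_hom_eq_iff)

lemma fi_hom_id: "(\<lambda>i\<in>S. i) \<in> fi_hom S S"
  by (auto simp: fi_hom_def inj_on_def)

lemma fi_hom_subset: "S \<subseteq> T \<Longrightarrow> (\<lambda>i\<in>S. i) \<in> fi_hom S T"
  by (auto simp: fi_hom_def inj_on_def)

lemma finite_fi_sum [simp]: "finite S \<Longrightarrow> finite T \<Longrightarrow> finite (fi_sum S T)"
  by (simp add: fi_sum_def)

abbreviation "enl x \<equiv> sum_encode (Inl x)"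
abbreviation "enr x \<equiv> sum_encode (Inr x)"

lemma fi_sum_eq: "fi_sum S T = enl ` S \<union> enr ` T"
  unfolding fi_sum_def Sum_Type.Plus_def by (auto simp: image_Un image_image)

lemma sum_encode_inject [simp]: "sum_encode x = sum_encode y \<longleftrightarrow> x = y"
  using inj_sum_encode by (metis injD)

lemma fi_inl_hom: "fi_inl S \<in> fi_hom S (fi_sum S T)"
  by (auto simp: fi_hom_def fi_inl_def fi_sum_eq inj_on_def)

lemma fi_sum_map_simps [simp]:
  "x \<in> S\<^sub>0 \<Longrightarrow> fi_sum_map S\<^sub>0 S \<pi> (enl x) = enl x"
  "y \<in> S \<Longrightarrow> fi_sum_map S\<^sub>0 S \<pi> (enr y) = enr (\<pi> y)"
  by (auto simp: fi_sum_map_def fi_sum_eq)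

lemma fi_sum_map_hom: "\<pi> \<in> fi_hom S T \<Longrightarrow> fi_sum_map S\<^sub>0 S \<pi> \<in> fi_hom (fi_sum S\<^sub>0 S) (fi_sum S\<^sub>0 T)"
  by (rule fi_homI) (auto simp: inj_on_def fi_sum_eq fi_sum_map_def fi_hom_mem fi_hom_eq_iff)

lemma fi_sum_map_id: "fi_sum_map S\<^sub>0 S (\<lambda>i\<in>S. i) = (\<lambda>i\<in>fi_sum S\<^sub>0 S. i)"
  by (rule ext) (auto simp: fi_sum_map_def fi_sum_eq)

lemma fi_sum_map_compose:
  "\<pi> \<in> fi_hom S T \<Longrightarrow> fi_sum_map S\<^sub>0 S (compose S \<rho> \<pi>) =
    compose (fi_sum S\<^sub>0 S) (fi_sum_map S\<^sub>0 T \<rho>) (fi_sum_map S\<^sub>0 S \<pi>)"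
  by (rule ext) (auto simp: fi_sum_map_def fi_sum_eq compose_def fi_hom_mem)

lemma fi_sum_map_inl: "compose S\<^sub>0 (fi_sum_map S\<^sub>0 S \<pi>) (fi_inl S\<^sub>0) = fi_inl S\<^sub>0"
  by (rule ext) (auto simp: fi_inl_def compose_def)

lemma fobj_fi_shift: "fobj (fi_shift S\<^sub>0 B) S = with_smult (fobj B (fi_sum S\<^sub>0 S))
        (\<lambda>c x. fmap B S\<^sub>0 (fi_sum S\<^sub>0 S) (fi_inl S\<^sub>0) c \<otimes>\<^bsub>fobj B (fi_sum S\<^sub>0 S)\<^esub> x)"
  and fmap_fi_shift: "fmap (fi_shift S\<^sub>0 B) S T \<pi> =
    fmap B (fi_sum S\<^sub>0 S) (fi_sum S\<^sub>0 T) (fi_sum_map S\<^sub>0 S \<pi>)"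
  by (simp_all add: fi_shift_def)

lemma fi_algebra_shift:
  assumes "fi_algebra K B" "finite S\<^sub>0"
  shows "fi_algebra (fobj B S\<^sub>0) (fi_shift S\<^sub>0 B)"
proof -
  interpret fi_algebra K B by fact
  note [simp] = \<open>finite S\<^sub>0\<close>
  have hom: "fmap B S\<^sub>0 (fi_sum S\<^sub>0 S) (fi_inl S\<^sub>0) \<in> ring_hom (fobj B S\<^sub>0) (fobj B (fi_sum S\<^sub>0 S))"
    if "finite S" for S
    using that by (intro map_ring_hom fi_inl_hom) auto
  show ?thesis
  proof (rule fi_algebra.intro)
    fix S :: "nat set" assume S [simp]: "finite S"
    show "algebra (fobj B S\<^sub>0) (fobj (fi_shift S\<^sub>0 B) S)"
      unfolding fobj_fi_shift by (rule algebra_with_smult[OF _ _ hom]) (auto intro: cring_obj)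
    show "fmap (fi_shift S\<^sub>0 B) S S (\<lambda>i\<in>S. i) x = x" if "x \<in> carrier (fobj (fi_shift S\<^sub>0 B) S)" for x
      using that by (simp add: fobj_fi_shift fmap_fi_shift fi_sum_map_id map_id)
    fix T :: "nat set" and \<pi> assume T [simp]: "finite T" and pi: "\<pi> \<in> fi_hom S T"
    have 1: "fmap B (fi_sum S\<^sub>0 S) (fi_sum S\<^sub>0 T) (fi_sum_map S\<^sub>0 S \<pi>)
        \<in> ring_hom (fobj B (fi_sum S\<^sub>0 S)) (fobj B (fi_sum S\<^sub>0 T))"
      using pi by (intro map_ring_hom fi_sum_map_hom) auto
    \<comment> \<open>\<open>fi_sum_map\<close> is the identity on the left summand, so the
      transition maps of the shift commute with the structure maps from
      \<open>fobj B S\<^sub>0\<close>. This is their linearity over the new base.\<close>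
    have "fmap B (fi_sum S\<^sub>0 S) (fi_sum S\<^sub>0 T) (fi_sum_map S\<^sub>0 S \<pi>) (fmap B S\<^sub>0 (fi_sum S\<^sub>0 S) (fi_inl S\<^sub>0) c)
        = fmap B S\<^sub>0 (fi_sum S\<^sub>0 T) (fi_inl S\<^sub>0) c" if "c \<in> carrier (fobj B S\<^sub>0)" for c
      using that pi by (subst map_comp[symmetric]) (auto simp: fi_sum_map_inl intro: fi_inl_hom fi_sum_map_hom)
    then show "fmap (fi_shift S\<^sub>0 B) S T \<pi> \<in>
        alg_hom (fobj B S\<^sub>0) (fobj (fi_shift S\<^sub>0 B) S) (fobj (fi_shift S\<^sub>0 B) T)"
      unfolding alg_hom_def using 1
      by (auto simp: fobj_fi_shift fmap_fi_shift ring_hom_mult ring_hom_closed[OF hom])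
    fix U :: "nat set" and \<rho> x assume "finite U" "\<rho> \<in> fi_hom T U" "x \<in> carrier (fobj (fi_shift S\<^sub>0 B) S)"
    then show "fmap (fi_shift S\<^sub>0 B) S U (compose S \<rho> \<pi>) x =
        fmap (fi_shift S\<^sub>0 B) T U \<rho> (fmap (fi_shift S\<^sub>0 B) S T \<pi> x)"
      using pi by (simp add: fobj_fi_shift fmap_fi_shift fi_sum_map_compose)
        (rule map_comp; auto intro: fi_sum_map_hom)
  qed
qed

text \<open>A name for the denominators \<open>hh S\<close> that are local to the body of
  \<open>fi_localize\<close>.\<close>

definition loc_dens :: "'k \<Rightarrow> ('k, 'b) fi_alg \<Rightarrow> nat set \<Rightarrow> 'b set" where
  "loc_dens h C S = powers (fobj C S) (h \<odot>\<^bsub>fobj C S\<^esub> \<one>\<^bsub>fobj C S\<^esub>)"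

lemma fobj_fi_localize: "fobj (fi_localize h C) S = with_smult (localization (fobj C S) (loc_dens h C S))
    (\<lambda>X Y. \<Union>(c, s)\<in>X. \<Union>(a, t)\<in>Y.
      fraction (fobj C S) (loc_dens h C S) (c \<odot>\<^bsub>fobj C S\<^esub> a) (s \<odot>\<^bsub>fobj C S\<^esub> t))"
  and fmap_fi_localize: "fmap (fi_localize h C) S T \<pi> =
    fraction_map (fobj C T) (loc_dens h C T) (fmap C S T \<pi>)"
  by (simp_all add: fi_localize_def loc_dens_def)

locale fi_localization = fi_algebra K C for K :: "('k, 'm) ring_scheme" and C :: "('k, 'b) fi_alg" +
  fixes h assumes h_closed: "h \<in> carrier K"
begin

abbreviation "D \<equiv> loc_dens h C"
abbreviation "C' \<equiv> fi_localize h C"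

lemma mult_set_base: "mult_set K (powers K h)"
  by (intro mult_set_powers cring_base h_closed)

lemma unit_hom_obj: "finite S \<Longrightarrow> (\<lambda>c. c \<odot>\<^bsub>fobj C S\<^esub> \<one>\<^bsub>fobj C S\<^esub>) \<in> ring_hom K (fobj C S)"
  by (intro algebra.unit_hom obj_algebra)

lemma mult_set_dens: "finite S \<Longrightarrow> mult_set (fobj C S) (D S)"
  unfolding loc_dens_def by (intro mult_set_powers cring_obj ring_hom_closed[OF unit_hom_obj] h_closed)

lemma unit_dens: "finite S \<Longrightarrow> (\<lambda>c. c \<odot>\<^bsub>fobj C S\<^esub> \<one>\<^bsub>fobj C S\<^esub>) ` powers K h \<subseteq> D S"
  unfolding loc_dens_def by (intro powers_hom_image cring_base cring_obj unit_hom_obj h_closed)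

lemma map_dens:
  assumes "finite S" "finite T" "\<pi> \<in> fi_hom S T"
  shows "fmap C S T \<pi> ` D S \<subseteq> D T"
proof -
  have "fmap C S T \<pi> ` D S \<subseteq> powers (fobj C T) (fmap C S T \<pi> (h \<odot>\<^bsub>fobj C S\<^esub> \<one>\<^bsub>fobj C S\<^esub>))"
    unfolding loc_dens_def using assms
    by (intro powers_hom_image cring_obj map_ring_hom ring_hom_closed[OF unit_hom_obj] h_closed)
  then show ?thesis using map_unit[OF assms h_closed] by (simp add: loc_dens_def)
qed

abbreviation "unit' S \<equiv> fraction_map (fobj C S) (D S) (\<lambda>c. c \<odot>\<^bsub>fobj C S\<^esub> \<one>\<^bsub>fobj C S\<^esub>)"

lemma unit'_hom: "finite S \<Longrightarrow> unit' S \<in> ring_hom (localization K (powers K h)) (localization (fobj C S) (D S))"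
  by (intro fraction_map_hom mult_set_base mult_set_dens unit_hom_obj unit_dens)

lemma unit'_fraction:
  "finite S \<Longrightarrow> c \<in> carrier K \<Longrightarrow> s \<in> powers K h \<Longrightarrow> unit' S (fraction K (powers K h) c s) =
    fraction (fobj C S) (D S) (c \<odot>\<^bsub>fobj C S\<^esub> \<one>\<^bsub>fobj C S\<^esub>) (s \<odot>\<^bsub>fobj C S\<^esub> \<one>\<^bsub>fobj C S\<^esub>)"
  by (intro fraction_map_eq mult_set_base mult_set_dens unit_hom_obj unit_dens)

text \<open>Multiplying by a scalar fraction is multiplying by its image under \<open>unit'\<close>.
  Independence of the representatives is inherited from the ring product: equal fractions have equal
  images, hence equal products.\<close>

lemma smult_localize:
  assumes S: "finite S" and X: "X \<in> carrier (localization K (powers K h))"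
    and Y: "Y \<in> carrier (localization (fobj C S) (D S))"
  shows "X \<odot>\<^bsub>fobj C' S\<^esub> Y = unit' S X \<otimes>\<^bsub>localization (fobj C S) (D S)\<^esub> Y"
proof -
  interpret K: mult_set K "powers K h" by (rule mult_set_base)
  interpret C: mult_set "fobj C S" "D S" using S by (rule mult_set_dens)
  interpret A: algebra K "fobj C S" using S by (rule obj_algebra)
  have [simp]: "s \<odot>\<^bsub>fobj C S\<^esub> t \<in> D S" if "s \<in> powers K h" "t \<in> D S" for s t
    using unit_dens[OF S] that A.smult_eq_mult[of s t] by auto
  have [simp]: "s \<odot>\<^bsub>fobj C S\<^esub> \<one>\<^bsub>fobj C S\<^esub> \<in> D S" if "s \<in> powers K h" for s
    using unit_dens[OF S] that by auto
  obtain c s where [simp]: "X = K.quo c s" "c \<in> carrier K" "s \<in> powers K h" using X by (rule K.L_cases)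
  obtain a t where [simp]: "Y = C.quo a t" "a \<in> carrier (fobj C S)" "t \<in> D S" using Y by (rule C.L_cases)
  have "(\<Union>(c, s)\<in>K.quo c s. \<Union>(a, t)\<in>C.quo a t. C.quo (c \<odot>\<^bsub>fobj C S\<^esub> a) (s \<odot>\<^bsub>fobj C S\<^esub> t)) =
      C.quo (c \<odot>\<^bsub>fobj C S\<^esub> a) (s \<odot>\<^bsub>fobj C S\<^esub> t)"
  proof (rule Union_fraction2[OF mult_set_base mult_set_dens[OF S]])
    fix c' s' a' t' assume [simp]: "c' \<in> carrier K" "s' \<in> powers K h" "a' \<in> carrier (fobj C S)" "t' \<in> D S"
      and 1: "K.quo c' s' = K.quo c s" and 2: "C.quo a' t' = C.quo a t"
    have "unit' S (K.quo c' s') \<otimes>\<^bsub>C.L\<^esub> C.quo a' t' = unit' S (K.quo c s) \<otimes>\<^bsub>C.L\<^esub> C.quo a t"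
      using 1 2 by simp
    then show "C.quo (c' \<odot>\<^bsub>fobj C S\<^esub> a') (s' \<odot>\<^bsub>fobj C S\<^esub> t') = C.quo (c \<odot>\<^bsub>fobj C S\<^esub> a) (s \<odot>\<^bsub>fobj C S\<^esub> t)"
      by (simp add: unit'_fraction[OF S] C.L_mult A.smult_eq_mult[symmetric])
  qed auto
  then show ?thesis
    by (simp add: fobj_fi_localize unit'_fraction[OF S] C.L_mult A.smult_eq_mult[symmetric])
qed

lemma map_fraction:
  assumes "finite S" "finite T" "\<pi> \<in> fi_hom S T" "a \<in> carrier (fobj C S)" "s \<in> D S"
  shows "fmap C' S T \<pi> (fraction (fobj C S) (D S) a s) =
    fraction (fobj C T) (D T) (fmap C S T \<pi> a) (fmap C S T \<pi> s)"
  unfolding fmap_fi_localize using assms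
  by (intro fraction_map_eq mult_set_dens map_ring_hom map_dens)

lemma fi_algebra_localize: "fi_algebra (localization_away K h) C'"
proof (rule fi_algebra.intro)
  interpret K: mult_set K "powers K h" by (rule mult_set_base)
  fix S :: "nat set" assume S [simp]: "finite S"
  interpret S: mult_set "fobj C S" "D S" by (rule mult_set_dens) simp
  interpret AS: algebra K "fobj C S" by (rule obj_algebra) simp
  have sm: "X \<odot>\<^bsub>fobj C' S\<^esub> Y = unit' S X \<otimes>\<^bsub>S.L\<^esub> Y" if "X \<in> carrier K.L" "Y \<in> carrier S.L" for X Y
    by (rule smult_localize[OF S that])
  show "algebra (localization_away K h) (fobj C' S)"
    unfolding fobj_fi_localize
    by (rule algebra_with_smult[OF K.cring_L S.cring_L unit'_hom[OF S]])
      (use sm in \<open>simp add: fobj_fi_localize\<close>)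
  have carS: "carrier (fobj C' S) = carrier S.L" by (simp add: fobj_fi_localize)
  show "fmap C' S S (\<lambda>i\<in>S. i) x = x" if "x \<in> carrier (fobj C' S)" for x
    using that unfolding carS by (auto elim!: S.L_cases simp: map_fraction fi_hom_id map_id)
  fix T :: "nat set" and \<pi> assume T [simp]: "finite T" and pi [simp]: "\<pi> \<in> fi_hom S T"
  interpret T: mult_set "fobj C T" "D T" by (rule mult_set_dens) simp
  have carT: "carrier (fobj C' T) = carrier T.L" by (simp add: fobj_fi_localize)
  have hom: "fmap C' S T \<pi> \<in> ring_hom S.L T.L"
    unfolding fmap_fi_localize by (intro fraction_map_hom mult_set_dens map_ring_hom map_dens) auto
  have unit: "fmap C' S T \<pi> (unit' S X) = unit' T X" if "X \<in> carrier K.L" for X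
  proof -
    obtain c s where [simp]: "X = K.quo c s" "c \<in> carrier K" "s \<in> powers K h" using \<open>X \<in> carrier K.L\<close> by (rule K.L_cases)
    have [simp]: "s \<odot>\<^bsub>fobj C S\<^esub> \<one>\<^bsub>fobj C S\<^esub> \<in> D S" using unit_dens[OF S] by auto
    show ?thesis by (simp add: unit'_fraction map_fraction map_unit)
  qed
  show "fmap C' S T \<pi> \<in> alg_hom (localization_away K h) (fobj C' S) (fobj C' T)"
    unfolding alg_hom_def
  proof (intro CollectI conjI ballI)
    show "fmap C' S T \<pi> \<in> ring_hom (fobj C' S) (fobj C' T)" using hom by (simp add: fobj_fi_localize)
    fix X Y assume X: "X \<in> carrier K.L" and Y: "Y \<in> carrier (fobj C' S)"
    show "fmap C' S T \<pi> (X \<odot>\<^bsub>fobj C' S\<^esub> Y) = X \<odot>\<^bsub>fobj C' T\<^esub> fmap C' S T \<pi> Y"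
      using X Y[unfolded carS] unit[OF X] ring_hom_closed[OF hom] ring_hom_closed[OF unit'_hom[OF S]]
      by (simp add: smult_localize ring_hom_mult[OF hom])
  qed
  fix U :: "nat set" and \<rho> x assume U [simp]: "finite U" and rho [simp]: "\<rho> \<in> fi_hom T U" and x: "x \<in> carrier (fobj C' S)"
  obtain a s where [simp]: "x = S.quo a s" "a \<in> carrier (fobj C S)" "s \<in> D S"
    using x[unfolded carS] by (rule S.L_cases)
  have [simp]: "fmap C S T \<pi> s \<in> D T" using map_dens[OF S T pi] by auto
  show "fmap C' S U (compose S \<rho> \<pi>) x = fmap C' T U \<rho> (fmap C' S T \<pi> x)"
    by (simp add: map_fraction fi_hom_compose[of _ S T] ring_hom_closed[OF map_ring_hom[OF S T pi]] map_comp[of S T U])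
qed

end

section \<open>Functoriality of the spectrum\<close>

text \<open>Structure maps are total functions of which only the values on the carrier matter; the
  lemma passes between two functions that agree there.\<close>

lemma ring_hom_cong:
  assumes f: "f \<in> ring_hom R A" and "ring R" and g: "\<And>x. x \<in> carrier R \<Longrightarrow> g x = f x"
  shows "g \<in> ring_hom R A"
proof -
  interpret ring R by fact
  show ?thesis
    using ring_hom_closed[OF f] ring_hom_mult[OF f] ring_hom_add[OF f] ring_hom_one[OF f] g
    by (intro ring_hom_memI) simp_all
qed

lemma mult_set_prime:
  assumes "primeideal p R"
  shows "mult_set R (carrier R - p)"
proof -
  interpret primeideal p R by fact
  show ?thesis
  proof
    show "\<one>\<^bsub>R\<^esub> \<in> carrier R - p" using one_imp_carrier I_notcarr by auto
  qed (use I_prime in auto)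
qed

lemma prime_vimage:
  assumes "cring R" "f \<in> ring_hom R A" "p \<in> primes A"
  shows "{r \<in> carrier R. f r \<in> p} \<in> primes R"
proof -
  interpret p: primeideal p A using assms by (simp add: primes_def)
  interpret R: cring R by fact
  interpret f: ring_hom_ring R A f
    using assms(2) R.ring_axioms p.ring_axioms by (intro ring_hom_ringI2)
  show ?thesis using f.primeideal_vimage[OF assms(1) p.primeideal_axioms] by (simp add: primes_def)
qed

lemma zariski_open_primes: "zariski_open R (primes R)"
proof -
  have "\<not> carrier R \<subseteq> p" if "p \<in> primes R" for p
  proof -
    interpret primeideal p R using that by (simp add: primes_def)
    show ?thesis using I_notcarr a_subset by blast
  qed
  then show ?thesis unfolding zariski_open_def by blast
qed

lemma zariski_open_subset: "zariski_open R U \<Longrightarrow> U \<subseteq> primes R"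
  unfolding zariski_open_def by blast

lemma zariski_open_Int: "zariski_open R U \<Longrightarrow> zariski_open R V \<Longrightarrow> zariski_open R (U \<inter> V)"
  using istopology_zariski_open unfolding istopology_def by blast

lemma topspace_zariski [simp]: "topspace (zariski_topology R) = primes R"
  unfolding topspace_def using zariski_open_subset[of R] zariski_open_primes[of R] by auto

lemma spec_simps [simp]:
  "rs_top (spec R) = zariski_topology R" "rs_sec (spec R) = spec_sections R"
  "rs_res (spec R) U V s = restrict s V"
  by (simp_all add: spec_def)

lemma spec_map_simps:
  "mor_pt (spec_map R A f) p = {r \<in> carrier R. f r \<in> p}"
  "mor_sec (spec_map R A f) U s =
    (\<lambda>p\<in>{p \<in> primes A. {r \<in> carrier R. f r \<in> p} \<in> U}. fraction_map A (carrier A - p) f (s {r \<in> carrier R. f r \<in> p}))"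
  by (simp_all add: spec_map_def Let_def)

lemma spec_sections_carrierD:
  assumes "s \<in> carrier (spec_sections R U)" "p \<in> U"
  obtains V a g where "zariski_open R V" "p \<in> V" "V \<subseteq> U" "a \<in> carrier R" "g \<in> carrier R"
    "\<forall>q\<in>V. g \<notin> q \<and> s q = fraction R (carrier R - q) a g"
  using assms unfolding spec_sections_def Let_def by simp blast

lemma spec_sections_carrier:
  "s \<in> carrier (spec_sections R U) \<longleftrightarrow> s \<in> (\<Pi>\<^sub>E p\<in>U. carrier (localization R (carrier R - p))) \<and>
    (\<forall>p\<in>U. \<exists>V. zariski_open R V \<and> p \<in> V \<and> V \<subseteq> U \<and>
          (\<exists>a\<in>carrier R. \<exists>f\<in>carrier R. \<forall>q\<in>V. f \<notin> q \<and> s q = fraction R (carrier R - q) a f))"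
  by (simp add: spec_sections_def Let_def)

lemma spec_sections_mem:
  assumes "s \<in> carrier (spec_sections R U)" "p \<in> U"
  shows "s p \<in> carrier (localization R (carrier R - p))"
proof -
  have "s \<in> (\<Pi>\<^sub>E p\<in>U. carrier (localization R (carrier R - p)))"
    using assms(1) unfolding spec_sections_carrier by (rule conjunct1)
  then show ?thesis using assms(2) by (rule PiE_mem)
qed

lemma spec_sections_ops:
  "s \<otimes>\<^bsub>spec_sections R U\<^esub> t = (\<lambda>p\<in>U. s p \<otimes>\<^bsub>localization R (carrier R - p)\<^esub> t p)"
  "s \<oplus>\<^bsub>spec_sections R U\<^esub> t = (\<lambda>p\<in>U. s p \<oplus>\<^bsub>localization R (carrier R - p)\<^esub> t p)"
  "\<one>\<^bsub>spec_sections R U\<^esub> = (\<lambda>p\<in>U. \<one>\<^bsub>localization R (carrier R - p)\<^esub>)"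
  by (simp_all add: spec_sections_def Let_def)

lemma spec_section_value:
  assumes "s \<in> carrier (spec_sections R U)" "p \<in> U" "U \<subseteq> primes R"
  obtains a g where "a \<in> carrier R" "g \<in> carrier R - p" "s p = fraction R (carrier R - p) a g"
proof -
  obtain V a g where "zariski_open R V" "p \<in> V" "V \<subseteq> U" "a \<in> carrier R" "g \<in> carrier R"
    "\<forall>q\<in>V. g \<notin> q \<and> s q = fraction R (carrier R - q) a g"
    using assms(1,2) by (rule spec_sections_carrierD)
  then show ?thesis using that by blast
qed

locale spec_hom = R: cring R + A: cring A for R (structure) and A (structure) +
  fixes f assumes f_hom: "f \<in> ring_hom R A"
begin

abbreviation "f' p \<equiv> {r \<in> carrier R. f r \<in> p}"
abbreviation "F \<equiv> spec_map R A f"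

lemma f'_prime: "p \<in> primes A \<Longrightarrow> f' p \<in> primes R"
  using prime_vimage[OF R.cring_axioms f_hom] .

lemma mult_sets:
  assumes "p \<in> primes A"
  shows "mult_set R (carrier R - f' p)" "mult_set A (carrier A - p)" "f ` (carrier R - f' p) \<subseteq> carrier A - p"
proof -
  show "mult_set R (carrier R - f' p)" using f'_prime[OF assms] by (intro mult_set_prime) (simp add: primes_def)
  show "mult_set A (carrier A - p)" using assms by (intro mult_set_prime) (simp add: primes_def)
  show "f ` (carrier R - f' p) \<subseteq> carrier A - p" using ring_hom_closed[OF f_hom] by auto
qed

lemma fraction_map_value:
  assumes "p \<in> primes A" "a \<in> carrier R" "g \<in> carrier R - f' p"
  shows "fraction_map A (carrier A - p) f (fraction R (carrier R - f' p) a g) =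
    fraction A (carrier A - p) (f a) (f g)"
  using mult_sets[OF assms(1)] assms(2,3) f_hom by (intro fraction_map_eq)

lemma preimage_eq: "rs_preimage (spec A) F U = {p \<in> primes A. f' p \<in> U}"
  by (simp add: rs_preimage_def spec_map_simps)

lemma preimage_open:
  assumes "zariski_open R U"
  shows "zariski_open A {p \<in> primes A. f' p \<in> U}"
proof -
  obtain E where E: "E \<subseteq> carrier R" "U = {p \<in> primes R. \<not> E \<subseteq> p}"
    using assms unfolding zariski_open_def by blast
  have "{p \<in> primes A. f' p \<in> U} = {p \<in> primes A. \<not> f ` E \<subseteq> p}"
  proof (intro Collect_cong conj_cong refl)
    fix p assume "p \<in> primes A"
    then show "f' p \<in> U \<longleftrightarrow> \<not> f ` E \<subseteq> p" unfolding E(2) using E(1) f'_prime by blast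
  qed
  moreover have "f ` E \<subseteq> carrier A" using E ring_hom_closed[OF f_hom] by blast
  ultimately show ?thesis unfolding zariski_open_def by blast
qed

lemma mor_sec_eq: "mor_sec F U s = (\<lambda>p\<in>{p \<in> primes A. f' p \<in> U}. fraction_map A (carrier A - p) f (s (f' p)))"
  by (rule spec_map_simps)

text \<open>A section that is \<open>a / g\<close> on \<open>V\<close> becomes
  \<open>f a / f g\<close> on the preimage of \<open>V\<close>, so being locally a fraction is
  preserved.\<close>

lemma mor_sec_closed:
  assumes U: "zariski_open R U" and s: "s \<in> carrier (spec_sections R U)"
  shows "mor_sec F U s \<in> carrier (spec_sections A {p \<in> primes A. f' p \<in> U})"
  unfolding spec_sections_carrier
proof (intro conjI ballI)
  show "mor_sec F U s \<in> (\<Pi>\<^sub>E p\<in>{p \<in> primes A. f' p \<in> U}. carrier (localization A (carrier A - p)))"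
    unfolding mor_sec_eq
  proof (rule restrict_PiE_iff[THEN iffD2], intro ballI)
    fix p assume p: "p \<in> {p \<in> primes A. f' p \<in> U}"
    then have "s (f' p) \<in> carrier (localization R (carrier R - f' p))"
      using s by (intro spec_sections_mem) auto
    with p show "fraction_map A (carrier A - p) f (s (f' p)) \<in> carrier (localization A (carrier A - p))"
      by (intro ring_hom_closed[OF fraction_map_hom[OF mult_sets(1,2) f_hom mult_sets(3)]]) auto
  qed
  fix p assume p: "p \<in> {p \<in> primes A. f' p \<in> U}"
  then have "f' p \<in> U" by blast
  with s obtain V a g where V: "zariski_open R V" "f' p \<in> V" "V \<subseteq> U" "a \<in> carrier R" "g \<in> carrier R"
    "\<forall>q\<in>V. g \<notin> q \<and> s q = fraction R (carrier R - q) a g"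
    by (rule spec_sections_carrierD)
  show "\<exists>V. zariski_open A V \<and> p \<in> V \<and> V \<subseteq> {p \<in> primes A. f' p \<in> U} \<and>
    (\<exists>a\<in>carrier A. \<exists>g\<in>carrier A. \<forall>q\<in>V. g \<notin> q \<and> mor_sec F U s q = fraction A (carrier A - q) a g)"
  proof (intro exI conjI bexI ballI)
    show "zariski_open A {p \<in> primes A. f' p \<in> V}" using V(1) by (rule preimage_open)
    show "p \<in> {p \<in> primes A. f' p \<in> V}" using p V(2) by blast
    show "{p \<in> primes A. f' p \<in> V} \<subseteq> {p \<in> primes A. f' p \<in> U}" using V(3) by blast
    fix q assume q: "q \<in> {p \<in> primes A. f' p \<in> V}"
    then have g: "g \<in> carrier R - f' q" using V(5) bspec[OF V(6)] by blast
    then show "f g \<notin> q" by blast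
    show "mor_sec F U s q = fraction A (carrier A - q) (f a) (f g)"
    proof -
      have *: "q \<in> primes A" "f' q \<in> V" using q by auto
      then have "f' q \<in> U" "s (f' q) = fraction R (carrier R - f' q) a g" using V(3) bspec[OF V(6)] by auto
      then show ?thesis using *(1) fraction_map_value[OF *(1) V(4) g] by (simp only: mor_sec_eq restrict_apply mem_Collect_eq simp_thms if_True)
    qed
  qed (intro ring_hom_closed[OF f_hom] V(4,5))+
qed

lemma mor_sec_hom:
  assumes U: "zariski_open R U"
  shows "mor_sec F U \<in> ring_hom (spec_sections R U) (spec_sections A {p \<in> primes A. f' p \<in> U})"
proof -
  have hom: "fraction_map A (carrier A - p) f \<in>
      ring_hom (localization R (carrier R - f' p)) (localization A (carrier A - p))" if "p \<in> primes A" for p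
    using mult_sets[OF that] f_hom by (intro fraction_map_hom)
  have val: "s (f' p) \<in> carrier (localization R (carrier R - f' p))"
    if "s \<in> carrier (spec_sections R U)" "f' p \<in> U" for s p
    using that by (rule spec_sections_mem)
  show ?thesis
  proof (rule ring_hom_memI)
    fix s t assume st: "s \<in> carrier (spec_sections R U)" "t \<in> carrier (spec_sections R U)"
    show "mor_sec F U (s \<otimes>\<^bsub>spec_sections R U\<^esub> t) =
        mor_sec F U s \<otimes>\<^bsub>spec_sections A {p \<in> primes A. f' p \<in> U}\<^esub> mor_sec F U t"
    proof (rule ext)
      fix p show "mor_sec F U (s \<otimes>\<^bsub>spec_sections R U\<^esub> t) p =
        (mor_sec F U s \<otimes>\<^bsub>spec_sections A {p \<in> primes A. f' p \<in> U}\<^esub> mor_sec F U t) p"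
        using ring_hom_mult[OF hom val[OF st(1)] val[OF st(2)], of p]
        by (simp add: mor_sec_eq spec_sections_ops)
    qed
    show "mor_sec F U (s \<oplus>\<^bsub>spec_sections R U\<^esub> t) =
        mor_sec F U s \<oplus>\<^bsub>spec_sections A {p \<in> primes A. f' p \<in> U}\<^esub> mor_sec F U t"
    proof (rule ext)
      fix p show "mor_sec F U (s \<oplus>\<^bsub>spec_sections R U\<^esub> t) p =
        (mor_sec F U s \<oplus>\<^bsub>spec_sections A {p \<in> primes A. f' p \<in> U}\<^esub> mor_sec F U t) p"
        using ring_hom_add[OF hom val[OF st(1)] val[OF st(2)], of p]
        by (simp add: mor_sec_eq spec_sections_ops)
    qed
  next
    show "mor_sec F U \<one>\<^bsub>spec_sections R U\<^esub> = \<one>\<^bsub>spec_sections A {p \<in> primes A. f' p \<in> U}\<^esub>"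
      by (rule ext) (simp add: mor_sec_eq spec_sections_ops ring_hom_one[OF hom])
  qed (rule mor_sec_closed[OF U])
qed

lemma mor_sec_res:
  assumes "V \<subseteq> U"
  shows "mor_sec F V (restrict s V) = restrict (mor_sec F U s) {p \<in> primes A. f' p \<in> V}"
  by (rule ext) (use assms in \<open>auto simp: mor_sec_eq\<close>)

text \<open>Near the contraction of \<open>p\<close> the section is \<open>a / g\<close>. An inverse
  \<open>b / e\<close> of its pullback at \<open>p\<close> gives \<open>u b f(a) = u e f(g)\<close>
  with the right side outside \<open>p\<close>, hence \<open>f a \<notin> p\<close>. So
  \<open>a\<close> lies outside the contraction, and \<open>g / a\<close> is an inverse on the open
  set where \<open>a\<close> does not vanish.\<close>

lemma mor_sec_reflects_units:
  assumes U: "zariski_open R U" and s: "s \<in> carrier (spec_sections R U)"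
    and p: "p \<in> primes A" "f' p \<in> U"
    and unit: "unit_germ (spec A) p {p \<in> primes A. f' p \<in> U} (mor_sec F U s)"
  shows "unit_germ (spec R) (f' p) U s"
proof -
  from unit obtain W where W: "zariski_open A W" "p \<in> W" "W \<subseteq> {p \<in> primes A. f' p \<in> U}"
    "restrict (mor_sec F U s) W \<in> Units (spec_sections A W)" unfolding unit_germ_def by auto
  then obtain t where t: "t \<in> carrier (spec_sections A W)"
    "t \<otimes>\<^bsub>spec_sections A W\<^esub> restrict (mor_sec F U s) W = \<one>\<^bsub>spec_sections A W\<^esub>"
    unfolding Units_def by blast
  obtain V a g where V: "zariski_open R V" "f' p \<in> V" "V \<subseteq> U" and [simp]: "a \<in> carrier R" "g \<in> carrier R"
    and "\<forall>q\<in>V. g \<notin> q \<and> s q = fraction R (carrier R - q) a g"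
    using s p(2) by (rule spec_sections_carrierD)
  then have Vg: "\<And>q. q \<in> V \<Longrightarrow> g \<notin> q" and Vs: "\<And>q. q \<in> V \<Longrightarrow> s q = fraction R (carrier R - q) a g"
    by blast+
  obtain b e where be: "b \<in> carrier A" "e \<in> carrier A - p" "t p = fraction A (carrier A - p) b e"
    using t(1) W(2) zariski_open_subset[OF W(1)] by (rule spec_section_value)
  interpret Ap: mult_set A "carrier A - p" using mult_sets[OF p(1)] by blast
  interpret p: primeideal p A using p by (simp add: primes_def)
  have tp: "t p \<otimes>\<^bsub>Ap.L\<^esub> mor_sec F U s p = \<one>\<^bsub>Ap.L\<^esub>"
    using fun_cong[OF t(2), of p] W(2) by (simp add: spec_sections_ops)
  have g: "g \<in> carrier R - f' p" using Vg[OF V(2)] by simp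
  then have fg: "f g \<in> carrier A - p" using mult_sets(3)[OF p(1)] by blast
  have efg: "e \<otimes>\<^bsub>A\<^esub> f g \<in> carrier A - p" using be(2) fg by (rule Ap.mult_in_M)
  have fa: "f a \<in> carrier A" "b \<otimes>\<^bsub>A\<^esub> f a \<in> carrier A" using be(1) ring_hom_closed[OF f_hom] by auto
  have "mor_sec F U s p = Ap.quo (f a) (f g)"
    using p V(2) Vs[of "f' p"] fraction_map_value[OF p(1) _ g] by (simp add: mor_sec_eq)
  with tp have "Ap.quo (b \<otimes>\<^bsub>A\<^esub> f a) (e \<otimes>\<^bsub>A\<^esub> f g) = Ap.quo \<one>\<^bsub>A\<^esub> \<one>\<^bsub>A\<^esub>"
    using Ap.L_mult[OF be(1,2) fa(1) fg] be(3) by (simp only: Ap.L_one)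
  then obtain u where u: "u \<in> carrier A - p" "u \<otimes>\<^bsub>A\<^esub> (b \<otimes>\<^bsub>A\<^esub> f a) = u \<otimes>\<^bsub>A\<^esub> (e \<otimes>\<^bsub>A\<^esub> f g)"
    using Ap.fraction_eq_iff[OF fa(2) efg A.one_closed Ap.one_in_M] efg fa by auto
  have "u \<otimes>\<^bsub>A\<^esub> (e \<otimes>\<^bsub>A\<^esub> f g) \<notin> p"
    using Ap.mult_in_M[OF u(1) efg] by blast
  then have "f a \<notin> p" using u be p.I_l_closed fa by (metis DiffD1)
  then have ap: "a \<notin> f' p" by simp
  \<comment> \<open>The part of \<open>V\<close> on which \<open>a\<close> is invertible; both
    \<open>a / g\<close> and \<open>g / a\<close> are sections there.\<close>
  define V' where "V' = V \<inter> {q \<in> primes R. \<not> {a} \<subseteq> q}"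
  have V'open: "zariski_open R V'"
    unfolding V'_def by (intro zariski_open_Int V(1)) (auto simp: zariski_open_def intro!: exI[of _ "{a}"])
  have V'sub: "V' \<subseteq> primes R" using V'open by (rule zariski_open_subset)
  have pV': "f' p \<in> V'" using ap V(2) f'_prime[OF p(1)] by (simp add: V'_def)
  have q: "a \<in> carrier R - q" "g \<in> carrier R - q" "s q = fraction R (carrier R - q) a g"
    if "q \<in> V'" for q using that Vg Vs by (auto simp: V'_def)
  define r where "r = (\<lambda>q\<in>V'. fraction R (carrier R - q) g a)"
  have ms: "mult_set R (carrier R - q)" if "q \<in> V'" for q
    using that V'sub mult_set_prime by (auto simp: primes_def)
  have "r \<in> carrier (spec_sections R V')"
    unfolding spec_sections_carrier
  proof (intro conjI ballI)
    show "r \<in> (\<Pi>\<^sub>E p\<in>V'. carrier (localization R (carrier R - p)))"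
      unfolding r_def using q mult_set.fraction_in_L[OF ms] by auto
    show "\<exists>V. zariski_open R V \<and> p \<in> V \<and> V \<subseteq> V' \<and>
      (\<exists>a\<in>carrier R. \<exists>f\<in>carrier R. \<forall>q\<in>V. f \<notin> q \<and> r q = fraction R (carrier R - q) a f)" if "p \<in> V'" for p
    proof (intro exI conjI bexI ballI)
      fix q' assume "q' \<in> V'"
      then show "a \<notin> q'" "r q' = fraction R (carrier R - q') g a" using q(1) by (auto simp: r_def)
    qed (use that V'open in auto)
  qed
  moreover have "restrict s V' \<in> carrier (spec_sections R V')"
    unfolding spec_sections_carrier
  proof (intro conjI ballI)
    show "restrict s V' \<in> (\<Pi>\<^sub>E p\<in>V'. carrier (localization R (carrier R - p)))"
      using q mult_set.fraction_in_L[OF ms] by auto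
    show "\<exists>V. zariski_open R V \<and> p \<in> V \<and> V \<subseteq> V' \<and>
      (\<exists>a\<in>carrier R. \<exists>f\<in>carrier R. \<forall>q\<in>V. f \<notin> q \<and> restrict s V' q = fraction R (carrier R - q) a f)" if "p \<in> V'" for p
    proof (intro exI conjI bexI ballI)
      fix q' assume "q' \<in> V'"
      then show "g \<notin> q'" "restrict s V' q' = fraction R (carrier R - q') a g" using q(2,3) by auto
    qed (use that V'open in auto)
  qed
  moreover have "r \<otimes>\<^bsub>spec_sections R V'\<^esub> restrict s V' = \<one>\<^bsub>spec_sections R V'\<^esub>"
    and "restrict s V' \<otimes>\<^bsub>spec_sections R V'\<^esub> r = \<one>\<^bsub>spec_sections R V'\<^esub>"
  proof -
    have "fraction R (carrier R - q) g a \<otimes>\<^bsub>localization R (carrier R - q)\<^esub> fraction R (carrier R - q) a g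
        = \<one>\<^bsub>localization R (carrier R - q)\<^esub>"
      "fraction R (carrier R - q) a g \<otimes>\<^bsub>localization R (carrier R - q)\<^esub> fraction R (carrier R - q) g a
        = \<one>\<^bsub>localization R (carrier R - q)\<^esub>" if "q \<in> V'" for q
    proof -
      interpret q: mult_set R "carrier R - q" using that by (rule ms)
      have "a \<otimes> g \<in> carrier R - q" using q[OF that] by (intro q.mult_in_M)
      then show "q.quo g a \<otimes>\<^bsub>q.L\<^esub> q.quo a g = \<one>\<^bsub>q.L\<^esub>" "q.quo a g \<otimes>\<^bsub>q.L\<^esub> q.quo g a = \<one>\<^bsub>q.L\<^esub>"
        using q[OF that] q.fraction_self[of "a \<otimes> g"] by (simp_all only: q.L_mult R.m_comm[of g a] DiffD1)
    qed
    then show "r \<otimes>\<^bsub>spec_sections R V'\<^esub> restrict s V' = \<one>\<^bsub>spec_sections R V'\<^esub>"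
      "restrict s V' \<otimes>\<^bsub>spec_sections R V'\<^esub> r = \<one>\<^bsub>spec_sections R V'\<^esub>"
      using q(3) by (auto simp: spec_sections_ops r_def fun_eq_iff)
  qed
  ultimately have "restrict s V' \<in> Units (spec_sections R V')" unfolding Units_def by blast
  moreover have "V' \<subseteq> U" using V by (auto simp: V'_def)
  ultimately show ?thesis unfolding unit_germ_def using V'open pV' by auto
qed

lemma spec_map_lrs_hom: "F \<in> lrs_hom (spec A) (spec R)"
  unfolding lrs_hom_def
proof (intro CollectI conjI allI impI ballI)
  show "continuous_map (rs_top (spec A)) (rs_top (spec R)) (mor_pt F)"
    unfolding continuous_map_def using f'_prime preimage_open by (auto simp: spec_map_simps)
qed (auto simp: preimage_eq mor_sec_hom mor_sec_res spec_map_simps(1) intro: mor_sec_reflects_units)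

end

lemma spec_homI: "cring R \<Longrightarrow> cring A \<Longrightarrow> f \<in> ring_hom R A \<Longrightarrow> spec_hom R A f"
  by (simp add: spec_hom_def spec_hom_axioms_def)

text \<open>\<open>k\<close> is any function that agrees with the composite on the carrier. In this
  form the lemma covers composition, compatibility with structure maps, and both sides of a
  naturality square. Sections are compared pointwise, where each value is a single fraction.\<close>

lemma spec_map_comp:
  assumes "cring R" "cring A" "cring C" and f: "f \<in> ring_hom R A" and g: "g \<in> ring_hom A C"
    and k: "\<And>x. x \<in> carrier R \<Longrightarrow> k x = g (f x)"
  shows "rs_eq (spec C) (spec R) (rs_comp (spec A) (spec_map R A f) (spec_map A C g)) (spec_map R C k)"
proof -
  interpret f: spec_hom R A f using assms by (intro spec_homI)
  interpret g: spec_hom A C g using assms by (intro spec_homI)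
  have "k \<in> ring_hom R C"
    by (rule ring_hom_cong[OF ring_hom_trans[OF f g] f.R.ring_axioms]) (simp add: k)
  then interpret k: spec_hom R C k using assms by (intro spec_homI)
  have pts: "f.f' (g.f' p) = k.f' p" and pts': "{r \<in> carrier R. f r \<in> carrier A \<and> g (f r) \<in> p} = k.f' p" for p
    using k ring_hom_closed[OF f] by auto
  have "mor_sec (spec_map A C g) {p \<in> primes A. f.f' p \<in> U} (mor_sec (spec_map R A f) U s) p = mor_sec (spec_map R C k) U s p"
    if U: "zariski_open R U" and s: "s \<in> carrier (spec_sections R U)" for U s p
  proof (cases "p \<in> primes C \<and> k.f' p \<in> U")
    case True
    then have p: "p \<in> primes C" "k.f' p \<in> U" by auto
    obtain a t where at: "a \<in> carrier R" "t \<in> carrier R - k.f' p" "s (k.f' p) = fraction R (carrier R - k.f' p) a t"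
      using zariski_open_subset[OF U] by (rule spec_section_value[OF s p(2)])
    have gp: "g.f' p \<in> primes A" using g.f'_prime p by blast
    have ft: "f a \<in> carrier A" "f t \<in> carrier A - g.f' p"
      using at ring_hom_closed[OF f] k by auto
    have "fraction_map C (carrier C - p) g (fraction_map A (carrier A - g.f' p) f (s (k.f' p))) =
        fraction_map C (carrier C - p) g (fraction A (carrier A - g.f' p) (f a) (f t))"
      using f.fraction_map_value[OF gp at(1)] at(2,3) unfolding pts by simp
    also have "\<dots> = fraction C (carrier C - p) (g (f a)) (g (f t))"
      using g.fraction_map_value[OF p(1) ft] .
    also have "\<dots> = fraction_map C (carrier C - p) k (s (k.f' p))"
      using k.fraction_map_value[OF p(1) at(1,2)] at k by simp
    finally show ?thesis using p gp by (simp add: g.mor_sec_eq f.mor_sec_eq k.mor_sec_eq pts pts')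
  next
    case False
    then show ?thesis by (auto simp: g.mor_sec_eq k.mor_sec_eq pts')
  qed
  then show ?thesis
    unfolding rs_eq_def rs_comp_def by (auto simp: spec_map_simps(1) pts' f.preimage_eq fun_eq_iff)
qed

lemma spec_map_id:
  assumes R: "cring R" and k: "\<And>x. x \<in> carrier R \<Longrightarrow> k x = x"
  shows "rs_eq (spec R) (spec R) (spec_map R R k) rs_id"
proof -
  have "k \<in> ring_hom R R"
    by (rule ring_hom_cong[OF id_ring_hom]) (use R k in \<open>auto simp: cring_def\<close>)
  then interpret k: spec_hom R R k using assms by (intro spec_homI)
  have sub: "p \<subseteq> carrier R" if "p \<in> primes R" for p
  proof -
    interpret primeideal p R using that by (simp add: primes_def)
    show ?thesis using a_subset .
  qed
  have pts: "k.f' p = p" if "p \<in> primes R" for p using k sub[OF that] by auto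
  have "mor_sec (spec_map R R k) U s p = s p"
    if U: "zariski_open R U" and s: "s \<in> carrier (spec_sections R U)" for U s p
  proof (cases "p \<in> U")
    case True
    then have p: "p \<in> primes R" using zariski_open_subset[OF U] by blast
    obtain a t where at: "a \<in> carrier R" "t \<in> carrier R - p" "s p = fraction R (carrier R - p) a t"
      using zariski_open_subset[OF U] by (rule spec_section_value[OF s True])
    show ?thesis using k.fraction_map_value[OF p at(1)] at p True k by (simp add: k.mor_sec_eq pts)
  next
    case False
    \<comment> \<open>Outside \<open>U\<close> both sides are \<open>undefined\<close>.\<close>
    have "s \<in> extensional U" using s unfolding spec_sections_carrier by (auto simp: PiE_iff)
    then show ?thesis using False pts by (auto simp: k.mor_sec_eq extensional_def)
  qed
  then show ?thesis
    unfolding rs_eq_def rs_id_def by (auto simp: spec_map_simps(1) pts fun_eq_iff)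
qed

lemma rs_eq_sym: "rs_eq X Y f g \<Longrightarrow> rs_eq X Y g f"
  unfolding rs_eq_def by simp

lemma rs_eq_trans: "rs_eq X Y f g \<Longrightarrow> rs_eq X Y g k \<Longrightarrow> rs_eq X Y f k"
  unfolding rs_eq_def by simp

lemma fi_spec_simps [simp]:
  "sch_obj (fi_spec K B) S = spec (fobj B S)"
  "sch_map (fi_spec K B) S T \<pi> = spec_map (fobj B S) (fobj B T) (fmap B S T \<pi>)"
  "sch_str (fi_spec K B) S = spec_map K (fobj B S) (\<lambda>c. c \<odot>\<^bsub>fobj B S\<^esub> \<one>\<^bsub>fobj B S\<^esub>)"
  by (simp_all add: fi_spec_def)

lemma fi_op_hom_fi_specI:
  assumes K: "cring K"
    and cr: "\<And>S. finite S \<Longrightarrow> cring (fobj B S)" "\<And>S. finite S \<Longrightarrow> cring (fobj C S)"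
    and unit: "\<And>S. finite S \<Longrightarrow> (\<lambda>c. c \<odot>\<^bsub>fobj C S\<^esub> \<one>\<^bsub>fobj C S\<^esub>) \<in> ring_hom K (fobj C S)"
    and mapB: "\<And>S T \<pi>. finite S \<Longrightarrow> finite T \<Longrightarrow> \<pi> \<in> fi_hom S T \<Longrightarrow> fmap B S T \<pi> \<in> ring_hom (fobj B S) (fobj B T)"
    and mapC: "\<And>S T \<pi>. finite S \<Longrightarrow> finite T \<Longrightarrow> \<pi> \<in> fi_hom S T \<Longrightarrow> fmap C S T \<pi> \<in> ring_hom (fobj C S) (fobj C T)"
    and \<phi>: "\<And>S. finite S \<Longrightarrow> \<phi> S \<in> ring_hom (fobj C S) (fobj B S)"
    and \<phi>_unit: "\<And>S c. finite S \<Longrightarrow> c \<in> carrier K \<Longrightarrow>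
      \<phi> S (c \<odot>\<^bsub>fobj C S\<^esub> \<one>\<^bsub>fobj C S\<^esub>) = c \<odot>\<^bsub>fobj B S\<^esub> \<one>\<^bsub>fobj B S\<^esub>"
    and \<phi>_nat: "\<And>S T \<pi> x. finite S \<Longrightarrow> finite T \<Longrightarrow> \<pi> \<in> fi_hom S T \<Longrightarrow> x \<in> carrier (fobj C S) \<Longrightarrow>
      \<phi> T (fmap C S T \<pi> x) = fmap B S T \<pi> (\<phi> S x)"
  shows "(\<lambda>S. spec_map (fobj C S) (fobj B S) (\<phi> S)) \<in> fi_op_hom (spec K) (fi_spec K B) (fi_spec K C)"
  unfolding fi_op_hom_def
proof (intro CollectI conjI allI impI)
  fix S :: "nat set" assume S: "finite S"
  show "spec_map (fobj C S) (fobj B S) (\<phi> S) \<in> lrs_hom (sch_obj (fi_spec K B) S) (sch_obj (fi_spec K C) S)"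
    unfolding fi_spec_simps by (intro spec_hom.spec_map_lrs_hom spec_homI cr \<phi> S)
  show "rs_eq (sch_obj (fi_spec K B) S) (spec K)
      (rs_comp (sch_obj (fi_spec K C) S) (sch_str (fi_spec K C) S) (spec_map (fobj C S) (fobj B S) (\<phi> S)))
      (sch_str (fi_spec K B) S)"
    unfolding fi_spec_simps using S K by (intro spec_map_comp) (auto intro: cr unit \<phi> simp: \<phi>_unit)
next
  fix S T :: "nat set" and \<pi> assume "finite S \<and> finite T \<and> \<pi> \<in> fi_hom S T"
  then have a: "finite S" "finite T" "\<pi> \<in> fi_hom S T" by auto
  \<comment> \<open>The naturality square is cut along its diagonal: both composites are compared
    with the map induced by \<open>\<lambda>x. fmap B S T \<pi> (\<phi> S x)\<close>, which by
    naturality of \<open>\<phi>\<close> agrees on the carrier with the other way round.\<close>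
  have "rs_eq (spec (fobj B T)) (spec (fobj C S))
      (rs_comp (spec (fobj B S)) (spec_map (fobj C S) (fobj B S) (\<phi> S))
        (spec_map (fobj B S) (fobj B T) (fmap B S T \<pi>)))
      (spec_map (fobj C S) (fobj B T) (\<lambda>x. fmap B S T \<pi> (\<phi> S x)))"
    using a by (intro spec_map_comp) (auto intro: cr mapB \<phi>)
  moreover have "rs_eq (spec (fobj B T)) (spec (fobj C S))
      (rs_comp (spec (fobj C T)) (spec_map (fobj C S) (fobj C T) (fmap C S T \<pi>))
        (spec_map (fobj C T) (fobj B T) (\<phi> T)))
      (spec_map (fobj C S) (fobj B T) (\<lambda>x. fmap B S T \<pi> (\<phi> S x)))"
    using a by (intro spec_map_comp) (auto intro: cr mapC \<phi> simp: \<phi>_nat)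
  ultimately show "rs_eq (sch_obj (fi_spec K B) T) (sch_obj (fi_spec K C) S)
      (rs_comp (sch_obj (fi_spec K B) S) (spec_map (fobj C S) (fobj B S) (\<phi> S)) (sch_map (fi_spec K B) S T \<pi>))
      (rs_comp (sch_obj (fi_spec K C) T) (sch_map (fi_spec K C) S T \<pi>) (spec_map (fobj C T) (fobj B T) (\<phi> T)))"
    unfolding fi_spec_simps using rs_eq_sym rs_eq_trans by blast
qed

text \<open>That the unit and the transition maps of \<open>C\<close> are ring homomorphisms is
  transported from \<open>B\<close> through the inverse of \<open>\<phi>\<close>. For tensor powers
  this leaves only closure of these maps and compatibility with \<open>\<phi>\<close> to be shown,
  and no direct computation with \<open>tensor_map\<close> on products.\<close>

lemma fi_op_isomorphic_fi_specI:
  assumes K: "cring K"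
    and cr: "\<And>S. finite S \<Longrightarrow> cring (fobj B S)" "\<And>S. finite S \<Longrightarrow> cring (fobj C S)"
    and unitB: "\<And>S. finite S \<Longrightarrow> (\<lambda>c. c \<odot>\<^bsub>fobj B S\<^esub> \<one>\<^bsub>fobj B S\<^esub>) \<in> ring_hom K (fobj B S)"
    and clC: "\<And>S c. finite S \<Longrightarrow> c \<in> carrier K \<Longrightarrow> c \<odot>\<^bsub>fobj C S\<^esub> \<one>\<^bsub>fobj C S\<^esub> \<in> carrier (fobj C S)"
    and mapB: "\<And>S T \<pi>. finite S \<Longrightarrow> finite T \<Longrightarrow> \<pi> \<in> fi_hom S T \<Longrightarrow> fmap B S T \<pi> \<in> ring_hom (fobj B S) (fobj B T)"
    and mapC: "\<And>S T \<pi> x. finite S \<Longrightarrow> finite T \<Longrightarrow> \<pi> \<in> fi_hom S T \<Longrightarrow> x \<in> carrier (fobj C S) \<Longrightarrow>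
      fmap C S T \<pi> x \<in> carrier (fobj C T)"
    and \<phi>: "\<And>S. finite S \<Longrightarrow> \<phi> S \<in> ring_iso (fobj C S) (fobj B S)"
    and \<phi>_unit: "\<And>S c. finite S \<Longrightarrow> c \<in> carrier K \<Longrightarrow>
      \<phi> S (c \<odot>\<^bsub>fobj C S\<^esub> \<one>\<^bsub>fobj C S\<^esub>) = c \<odot>\<^bsub>fobj B S\<^esub> \<one>\<^bsub>fobj B S\<^esub>"
    and \<phi>_nat: "\<And>S T \<pi> x. finite S \<Longrightarrow> finite T \<Longrightarrow> \<pi> \<in> fi_hom S T \<Longrightarrow> x \<in> carrier (fobj C S) \<Longrightarrow>
      \<phi> T (fmap C S T \<pi> x) = fmap B S T \<pi> (\<phi> S x)"
  shows "fi_op_isomorphic (spec K) (fi_spec K B) (fi_spec K C)"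
proof -
  define \<psi> where "\<psi> S = inv_into (carrier (fobj C S)) (\<phi> S)" for S
  have hom: "\<phi> S \<in> ring_hom (fobj C S) (fobj B S)" and bij: "bij_betw (\<phi> S) (carrier (fobj C S)) (carrier (fobj B S))"
    if "finite S" for S using \<phi>[OF that] by (auto simp: ring_iso_def)
  have \<psi>_iso: "\<psi> S \<in> ring_iso (fobj B S) (fobj C S)" if "finite S" for S
    unfolding \<psi>_def using \<phi>[OF that] cr(2)[OF that] by (intro ring_iso_set_sym) (auto simp: cring_def)
  have \<psi>_hom: "\<psi> S \<in> ring_hom (fobj B S) (fobj C S)" if "finite S" for S
    using \<psi>_iso[OF that] by (auto simp: ring_iso_def)
  have \<psi>\<phi>: "\<psi> S (\<phi> S x) = x" if "finite S" "x \<in> carrier (fobj C S)" for S x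
    unfolding \<psi>_def using bij[OF that(1)] that(2) by (simp add: bij_betw_inv_into_left)
  have \<phi>\<psi>: "\<phi> S (\<psi> S y) = y" if "finite S" "y \<in> carrier (fobj B S)" for S y
    unfolding \<psi>_def using bij[OF that(1)] that(2) by (simp add: bij_betw_inv_into_right)
  have unit_eq: "c \<odot>\<^bsub>fobj C S\<^esub> \<one>\<^bsub>fobj C S\<^esub> = \<psi> S (c \<odot>\<^bsub>fobj B S\<^esub> \<one>\<^bsub>fobj B S\<^esub>)"
    if "finite S" "c \<in> carrier K" for S c
    using \<psi>\<phi>[OF that(1) clC[OF that]] \<phi>_unit[OF that] by simp
  have unitC: "(\<lambda>c. c \<odot>\<^bsub>fobj C S\<^esub> \<one>\<^bsub>fobj C S\<^esub>) \<in> ring_hom K (fobj C S)" if S: "finite S" for S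
  proof -
    have "(\<lambda>c. \<psi> S (c \<odot>\<^bsub>fobj B S\<^esub> \<one>\<^bsub>fobj B S\<^esub>)) \<in> ring_hom K (fobj C S)"
      using ring_hom_trans[OF unitB[OF S] \<psi>_hom[OF S]] by (simp add: comp_def)
    then show ?thesis
      by (rule ring_hom_cong) (use K unit_eq[OF S] in \<open>auto simp: cring_def\<close>)
  qed
  have map_eq: "fmap C S T \<pi> x = \<psi> T (fmap B S T \<pi> (\<phi> S x))"
    if "finite S" "finite T" "\<pi> \<in> fi_hom S T" "x \<in> carrier (fobj C S)" for S T \<pi> x
    using \<psi>\<phi>[OF that(2) mapC[OF that]] \<phi>_nat[OF that] by simp
  have mapC': "fmap C S T \<pi> \<in> ring_hom (fobj C S) (fobj C T)"
    if "finite S" "finite T" "\<pi> \<in> fi_hom S T" for S T \<pi>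
  proof -
    interpret S: cring "fobj C S" using that cr by blast
    have "(\<lambda>x. \<psi> T (fmap B S T \<pi> (\<phi> S x))) \<in> ring_hom (fobj C S) (fobj C T)"
      using ring_hom_trans[OF hom ring_hom_trans[OF mapB \<psi>_hom]] that by (simp add: comp_def)
    then show ?thesis by (rule ring_hom_cong[OF _ S.ring_axioms]) (simp add: map_eq[OF that])
  qed
  let ?F = "\<lambda>S. spec_map (fobj C S) (fobj B S) (\<phi> S)"
  let ?G = "\<lambda>S. spec_map (fobj B S) (fobj C S) (\<psi> S)"
  have F: "?F \<in> fi_op_hom (spec K) (fi_spec K B) (fi_spec K C)"
    by (rule fi_op_hom_fi_specI[OF K cr unitC mapB mapC' hom \<phi>_unit \<phi>_nat])
  have "\<psi> T (fmap B S T \<pi> y) = fmap C S T \<pi> (\<psi> S y)"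
    if "finite S" "finite T" "\<pi> \<in> fi_hom S T" "y \<in> carrier (fobj B S)" for S T \<pi> y
    using map_eq[OF that(1-3), of "\<psi> S y"] that \<phi>\<psi> ring_hom_closed[OF \<psi>_hom] by simp
  then have G: "?G \<in> fi_op_hom (spec K) (fi_spec K C) (fi_spec K B)"
    by (intro fi_op_hom_fi_specI[OF K cr(2,1) unitB mapC' mapB \<psi>_hom unit_eq[symmetric]])
  have 1: "rs_eq (spec (fobj B S)) (spec (fobj B S)) (rs_comp (spec (fobj C S)) (?G S) (?F S)) rs_id"
    if S: "finite S" for S
    using S by (intro rs_eq_trans[OF spec_map_comp[OF cr(1,2,1) \<psi>_hom hom refl] spec_map_id[OF cr(1) \<phi>\<psi>]])
  have 2: "rs_eq (spec (fobj C S)) (spec (fobj C S)) (rs_comp (spec (fobj B S)) (?F S) (?G S)) rs_id"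
    if S: "finite S" for S
    using S by (intro rs_eq_trans[OF spec_map_comp[OF cr(2,1,2) hom \<psi>_hom refl] spec_map_id[OF cr(2) \<psi>\<phi>]])
  show ?thesis
    unfolding fi_op_isomorphic_def fi_spec_simps
    by (intro bexI[OF _ F] bexI[OF _ G] allI impI conjI 1 2)
qed

section \<open>Monoid rings\<close>

lemma (in abelian_monoid) finsum_swap:
  assumes "finite A" "finite B" "\<And>a b. a \<in> A \<Longrightarrow> b \<in> B \<Longrightarrow> f a b \<in> carrier G"
  shows "(\<Oplus>a\<in>A. \<Oplus>b\<in>B. f a b) = (\<Oplus>b\<in>B. \<Oplus>a\<in>A. f a b)"
  using assms(1,3)
proof (induction A rule: finite_induct)
  case empty
  then show ?case by (simp add: finsum_zero)
next
  case (insert a A)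
  have "(\<Oplus>b\<in>B. \<Oplus>a'\<in>insert a A. f a' b) = (\<Oplus>b\<in>B. f a b \<oplus> (\<Oplus>a'\<in>A. f a' b))"
    using insert by (intro finsum_cong') (auto simp: Pi_iff finsum_insert)
  also have "\<dots> = (\<Oplus>b\<in>B. f a b) \<oplus> (\<Oplus>b\<in>B. \<Oplus>a'\<in>A. f a' b)"
    using insert by (intro finsum_addf) (auto simp: Pi_iff)
  also have "\<dots> = (\<Oplus>a'\<in>insert a A. \<Oplus>b\<in>B. f a' b)"
    using insert by (simp add: Pi_iff finsum_insert)
  finally show ?case ..
qed

lemma (in abelian_monoid) finsum_Times:
  assumes "finite A" "finite B" "\<And>a b. a \<in> A \<Longrightarrow> b \<in> B \<Longrightarrow> f (a, b) \<in> carrier G"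
  shows "(\<Oplus>p\<in>A \<times> B. f p) = (\<Oplus>a\<in>A. \<Oplus>b\<in>B. f (a, b))"
  using assms(1,3)
proof (induction A rule: finite_induct)
  case empty
  then show ?case by simp
next
  case (insert a A)
  have "(\<Oplus>p\<in>insert a A \<times> B. f p) = (\<Oplus>p\<in>Pair a ` B \<union> A \<times> B. f p)"
    by (rule arg_cong[of _ _ "finsum G f"]) auto
  also have "\<dots> = (\<Oplus>p\<in>Pair a ` B. f p) \<oplus> (\<Oplus>p\<in>A \<times> B. f p)"
    using insert assms(2) by (intro finsum_Un_disjoint) auto
  also have "(\<Oplus>p\<in>Pair a ` B. f p) = (\<Oplus>b\<in>B. f (a, b))"
    using insert by (intro finsum_reindex) (auto intro: inj_onI)
  finally show ?case using insert by (simp add: Pi_iff finsum_insert)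
qed

lemma (in abelian_monoid) finsum_neutral_superset:
  assumes "finite W" "V \<subseteq> W" "\<And>x. x \<in> W - V \<Longrightarrow> f x = \<zero>" "\<And>x. x \<in> V \<Longrightarrow> f x \<in> carrier G"
  shows "finsum G f V = finsum G f W"
proof (rule add.finprod_mono_neutral_cong_left[OF assms(1,2)])
  show "f \<in> W \<rightarrow> carrier G" using assms(3,4) by (metis DiffI Pi_I zero_closed)
qed (use assms(3) in auto)

abbreviation supp :: "('r, 'm) ring_scheme \<Rightarrow> ('g \<Rightarrow> 'r) \<Rightarrow> 'g set" where
  "supp R f \<equiv> {m. f m \<noteq> \<zero>\<^bsub>R\<^esub>}"

text \<open>The linear extension of \<open>\<psi>\<close> along \<open>\<iota>\<close>. The sum runs
  over the support, which is finite for elements of the monoid ring even if the monoid is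
  infinite.\<close>

definition monoid_ring_eval ::
  "('r, 'm) ring_scheme \<Rightarrow> ('c, 'n) ring_scheme \<Rightarrow> ('r \<Rightarrow> 'c) \<Rightarrow> ('g \<Rightarrow> 'c) \<Rightarrow> ('g \<Rightarrow> 'r) \<Rightarrow> 'c" where
  "monoid_ring_eval R C \<iota> \<psi> f = (\<Oplus>\<^bsub>C\<^esub>m\<in>supp R f. \<iota> (f m) \<otimes>\<^bsub>C\<^esub> \<psi> m)"

locale comm_monoid_ring = R: cring R + G: comm_monoid G
  for R :: "('r, 'm) ring_scheme" (structure) and G :: "('g, 'n) monoid_scheme"
begin

abbreviation "P \<equiv> monoid_ring R G"

lemma carrier_P: "f \<in> carrier P \<longleftrightarrow> (\<forall>m. f m \<in> carrier R) \<and> supp R f \<subseteq> carrier G \<and> finite (supp R f)"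
  unfolding monoid_ring_def by (simp add: image_subset_iff)

lemma P_closed: "f \<in> carrier P \<Longrightarrow> f m \<in> carrier R"
  and P_finite: "f \<in> carrier P \<Longrightarrow> finite (supp R f)"
  and P_supp: "f \<in> carrier P \<Longrightarrow> supp R f \<subseteq> carrier G"
  by (simp_all add: carrier_P)

lemma P_supp_mem: "f \<in> carrier P \<Longrightarrow> f m \<noteq> \<zero> \<Longrightarrow> m \<in> carrier G"
  by (rule subsetD[OF P_supp]) simp_all

lemma P_add: "(f \<oplus>\<^bsub>P\<^esub> g) m = f m \<oplus> g m"
  and P_zero: "\<zero>\<^bsub>P\<^esub> = (\<lambda>m. \<zero>)"
  and P_one: "\<one>\<^bsub>P\<^esub> = single R \<one> \<one>\<^bsub>G\<^esub>"
  by (simp_all add: monoid_ring_def single_def)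

text \<open>The definition sums over a set of pairs that depends on \<open>m\<close>. A rectangle
  containing the supports is an index set independent of \<open>m\<close>, so sums can be exchanged,
  and it can be chosen in common for several functions, as distributivity requires.\<close>

lemma P_mult:
  assumes f: "f \<in> carrier P" and g: "g \<in> carrier P"
    and F: "finite F" "supp R f \<subseteq> F" and H: "finite H" "supp R g \<subseteq> H"
  shows "(f \<otimes>\<^bsub>P\<^esub> g) m = (\<Oplus>x\<in>F. \<Oplus>y\<in>H. if x \<otimes>\<^bsub>G\<^esub> y = m then f x \<otimes> g y else \<zero>)"
proof -
  note [simp] = P_closed[OF f] P_finite[OF f] P_closed[OF g] P_finite[OF g]
  let ?D = "{(x, y). f x \<noteq> \<zero> \<and> g y \<noteq> \<zero> \<and> x \<otimes>\<^bsub>G\<^esub> y = m}"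
  let ?t = "\<lambda>p. if fst p \<otimes>\<^bsub>G\<^esub> snd p = m then f (fst p) \<otimes> g (snd p) else \<zero>"
  have "(f \<otimes>\<^bsub>P\<^esub> g) m = (\<Oplus>p\<in>?D. f (fst p) \<otimes> g (snd p))" by (simp add: monoid_ring_def)
  also have "\<dots> = (\<Oplus>p\<in>?D. ?t p)" using f g by (intro R.finsum_cong') auto
  also have "\<dots> = (\<Oplus>p\<in>F \<times> H. ?t p)"
    using F H f g by (intro R.finsum_neutral_superset) auto
  also have "\<dots> = (\<Oplus>x\<in>F. \<Oplus>y\<in>H. if x \<otimes>\<^bsub>G\<^esub> y = m then f x \<otimes> g y else \<zero>)"
    using F H by (subst R.finsum_Times) (auto cong: if_cong)
  finally show ?thesis .
qed

lemma P_mult_supp: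
  assumes f: "f \<in> carrier P" and g: "g \<in> carrier P"
  shows "supp R (f \<otimes>\<^bsub>P\<^esub> g) \<subseteq> (\<lambda>(x, y). x \<otimes>\<^bsub>G\<^esub> y) ` (supp R f \<times> supp R g)"
proof
  fix m assume m: "m \<in> supp R (f \<otimes>\<^bsub>P\<^esub> g)"
  show "m \<in> (\<lambda>(x, y). x \<otimes>\<^bsub>G\<^esub> y) ` (supp R f \<times> supp R g)"
  proof (rule ccontr)
    assume "m \<notin> (\<lambda>(x, y). x \<otimes>\<^bsub>G\<^esub> y) ` (supp R f \<times> supp R g)"
    then have empty: "{(x, y). f x \<noteq> \<zero> \<and> g y \<noteq> \<zero> \<and> x \<otimes>\<^bsub>G\<^esub> y = m} = {}" by auto
    have "(f \<otimes>\<^bsub>P\<^esub> g) m = \<zero>" unfolding monoid_ring_def monoid.simps empty by simp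
    then show False using m by simp
  qed
qed

lemma P_mult_closed:
  assumes f: "f \<in> carrier P" and g: "g \<in> carrier P"
  shows "f \<otimes>\<^bsub>P\<^esub> g \<in> carrier P"
  unfolding carrier_P
proof (intro conjI allI)
  note [simp] = P_closed[OF f] P_finite[OF f] P_closed[OF g] P_finite[OF g]
  show "(f \<otimes>\<^bsub>P\<^esub> g) m \<in> carrier R" for m
    unfolding P_mult[OF f g P_finite[OF f] order_refl P_finite[OF g] order_refl]
    using f g by (intro R.finsum_closed) auto
  have fin: "finite ((\<lambda>(x, y). x \<otimes>\<^bsub>G\<^esub> y) ` (supp R f \<times> supp R g))" using f g by simp
  show "finite (supp R (f \<otimes>\<^bsub>P\<^esub> g))"
    by (rule finite_subset[OF P_mult_supp[OF f g] fin])
  show "supp R (f \<otimes>\<^bsub>P\<^esub> g) \<subseteq> carrier G"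
    by (rule order_trans[OF P_mult_supp[OF f g]]) (use P_supp[OF f] P_supp[OF g] in auto)
qed

lemma P_add_closed:
  assumes "f \<in> carrier P" "g \<in> carrier P"
  shows "f \<oplus>\<^bsub>P\<^esub> g \<in> carrier P"
proof -
  note [simp] = P_closed[OF assms(1)] P_closed[OF assms(2)] P_finite[OF assms(1)] P_finite[OF assms(2)]
  have "supp R (f \<oplus>\<^bsub>P\<^esub> g) \<subseteq> supp R f \<union> supp R g" by (auto simp: P_add)
  then have "finite (supp R (f \<oplus>\<^bsub>P\<^esub> g))" "supp R (f \<oplus>\<^bsub>P\<^esub> g) \<subseteq> carrier G"
    using P_supp[OF assms(1)] P_supp[OF assms(2)] by (auto intro: finite_subset)
  then show ?thesis unfolding carrier_P by (simp add: P_add)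
qed

lemma P_single_closed: "c \<in> carrier R \<Longrightarrow> m \<in> carrier G \<Longrightarrow> single R c m \<in> carrier P"
  unfolding carrier_P by (auto simp: single_def)

lemma P_smult_closed:
  assumes c: "c \<in> carrier R" and f: "f \<in> carrier P"
  shows "(\<lambda>m. c \<otimes> f m) \<in> carrier P"
proof -
  note [simp] = P_closed[OF f] P_finite[OF f]
  have sub: "supp R (\<lambda>m. c \<otimes> f m) \<subseteq> supp R f" using c by auto
  show ?thesis unfolding carrier_P
    using c finite_subset[OF sub] order_trans[OF sub P_supp[OF f]] by simp
qed

lemma single_apply: "single R c m x = (if x = m then c else \<zero>)"
  by (simp add: single_def)

text \<open>Evaluating the convolution against an arbitrary function \<open>\<psi>\<close> on the monoid; with the delta
  functions for \<open>\<psi>\<close> this gives associativity, with a character it gives multiplicativity.\<close>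

lemma mult_eval:
  assumes C: "cring C" and \<iota>: "\<iota> \<in> ring_hom R C"
    and f: "f \<in> carrier P" and g: "g \<in> carrier P" and \<psi>: "\<And>m. m \<in> carrier G \<Longrightarrow> \<psi> m \<in> carrier C"
  shows "monoid_ring_eval R C \<iota> \<psi> (f \<otimes>\<^bsub>P\<^esub> g) =
    (\<Oplus>\<^bsub>C\<^esub>x\<in>supp R f. \<Oplus>\<^bsub>C\<^esub>y\<in>supp R g. \<iota> (f x) \<otimes>\<^bsub>C\<^esub> \<iota> (g y) \<otimes>\<^bsub>C\<^esub> \<psi> (x \<otimes>\<^bsub>G\<^esub> y))"
proof -
  note [simp] = P_closed[OF f] P_finite[OF f] P_closed[OF g] P_finite[OF g]
  interpret C: cring C by fact
  interpret \<iota>: ring_hom_cring R C \<iota> using \<iota> by (simp add: ring_hom_cring_def ring_hom_cring_axioms_def R.cring_axioms C)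
  let ?F = "supp R f" and ?H = "supp R g"
  let ?W = "(\<lambda>(x, y). x \<otimes>\<^bsub>G\<^esub> y) ` (?F \<times> ?H)"
  have F: "finite ?F" "\<And>x. x \<in> ?F \<Longrightarrow> x \<in> carrier G" using f P_supp[OF f] by auto
  have H: "finite ?H" "\<And>x. x \<in> ?H \<Longrightarrow> x \<in> carrier G" using g P_supp[OF g] by auto
  have W: "finite ?W" "\<And>m. m \<in> ?W \<Longrightarrow> m \<in> carrier G" using F H by auto
  have fc: "\<And>m. f m \<in> carrier R" and gc: "\<And>m. g m \<in> carrier R" using f g by auto
  note [simp] = fc gc
  note [simp] = P_closed[OF P_mult_closed[OF f g]]
  let ?t = "\<lambda>x y m. if x \<otimes>\<^bsub>G\<^esub> y = m then \<iota> (f x) \<otimes>\<^bsub>C\<^esub> \<iota> (g y) \<otimes>\<^bsub>C\<^esub> \<psi> m else \<zero>\<^bsub>C\<^esub>"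
  have tc: "?t x y m \<in> carrier C" if "m \<in> ?W" for x y m using \<psi> W(2)[OF that] by auto
  have "monoid_ring_eval R C \<iota> \<psi> (f \<otimes>\<^bsub>P\<^esub> g) = (\<Oplus>\<^bsub>C\<^esub>m\<in>?W. \<iota> ((f \<otimes>\<^bsub>P\<^esub> g) m) \<otimes>\<^bsub>C\<^esub> \<psi> m)"
    unfolding monoid_ring_eval_def
    using P_mult_supp[OF f g] P_mult_closed[OF f g] \<psi> W
    by (intro C.finsum_neutral_superset) (auto simp: P_supp_mem)
  also have "\<dots> = (\<Oplus>\<^bsub>C\<^esub>m\<in>?W. \<Oplus>\<^bsub>C\<^esub>x\<in>?F. \<Oplus>\<^bsub>C\<^esub>y\<in>?H. ?t x y m)"
  proof (rule C.finsum_cong'[OF refl])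
    fix m assume m: "m \<in> ?W"
    have \<psi>m: "\<psi> m \<in> carrier C" using \<psi> W(2)[OF m] by blast
    have "\<iota> ((f \<otimes>\<^bsub>P\<^esub> g) m) = (\<Oplus>\<^bsub>C\<^esub>x\<in>?F. \<Oplus>\<^bsub>C\<^esub>y\<in>?H. if x \<otimes>\<^bsub>G\<^esub> y = m then \<iota> (f x) \<otimes>\<^bsub>C\<^esub> \<iota> (g y) else \<zero>\<^bsub>C\<^esub>)"
      unfolding P_mult[OF f g F(1) order_refl H(1) order_refl]
      by (subst \<iota>.hom_finsum; (subst o_def)?; (intro C.finsum_cong' refl)?)
        (auto simp: \<iota>.hom_finsum o_def if_distrib[of \<iota>] cong: if_cong intro!: R.finsum_closed C.finsum_cong' C.finsum_closed)
    then have "\<iota> ((f \<otimes>\<^bsub>P\<^esub> g) m) \<otimes>\<^bsub>C\<^esub> \<psi> m =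
      (\<Oplus>\<^bsub>C\<^esub>x\<in>?F. (\<Oplus>\<^bsub>C\<^esub>y\<in>?H. if x \<otimes>\<^bsub>G\<^esub> y = m then \<iota> (f x) \<otimes>\<^bsub>C\<^esub> \<iota> (g y) else \<zero>\<^bsub>C\<^esub>) \<otimes>\<^bsub>C\<^esub> \<psi> m)"
      using F \<psi>m by (simp add: C.finsum_ldistr Pi_iff)
    also have "\<dots> = (\<Oplus>\<^bsub>C\<^esub>x\<in>?F. \<Oplus>\<^bsub>C\<^esub>y\<in>?H. ?t x y m)"
      using H \<psi>m
      by (intro C.finsum_cong' refl) (auto simp: C.finsum_ldistr Pi_iff intro!: C.finsum_cong' C.finsum_closed)
    finally show "\<iota> ((f \<otimes>\<^bsub>P\<^esub> g) m) \<otimes>\<^bsub>C\<^esub> \<psi> m = (\<Oplus>\<^bsub>C\<^esub>x\<in>?F. \<Oplus>\<^bsub>C\<^esub>y\<in>?H. ?t x y m)" .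
  qed (use tc in \<open>auto intro!: C.finsum_closed\<close>)
  also have "\<dots> = (\<Oplus>\<^bsub>C\<^esub>x\<in>?F. \<Oplus>\<^bsub>C\<^esub>m\<in>?W. \<Oplus>\<^bsub>C\<^esub>y\<in>?H. ?t x y m)"
    using tc W F by (intro C.finsum_swap) (auto intro!: C.finsum_closed)
  also have "\<dots> = (\<Oplus>\<^bsub>C\<^esub>x\<in>?F. \<Oplus>\<^bsub>C\<^esub>y\<in>?H. \<Oplus>\<^bsub>C\<^esub>m\<in>?W. ?t x y m)"
    using tc W H by (intro C.finsum_cong' refl C.finsum_swap) (auto intro!: C.finsum_closed)
  also have "\<dots> = (\<Oplus>\<^bsub>C\<^esub>x\<in>?F. \<Oplus>\<^bsub>C\<^esub>y\<in>?H. \<iota> (f x) \<otimes>\<^bsub>C\<^esub> \<iota> (g y) \<otimes>\<^bsub>C\<^esub> \<psi> (x \<otimes>\<^bsub>G\<^esub> y))"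
  proof (intro C.finsum_cong' refl)
    fix x y assume xy: "x \<in> ?F" "y \<in> ?H"
    then have "x \<otimes>\<^bsub>G\<^esub> y \<in> ?W" by auto
    then show "(\<Oplus>\<^bsub>C\<^esub>m\<in>?W. ?t x y m) = \<iota> (f x) \<otimes>\<^bsub>C\<^esub> \<iota> (g y) \<otimes>\<^bsub>C\<^esub> \<psi> (x \<otimes>\<^bsub>G\<^esub> y)"
      using W \<psi> by (intro C.finsum_singleton[where f = "\<lambda>m. \<iota> (f x) \<otimes>\<^bsub>C\<^esub> \<iota> (g y) \<otimes>\<^bsub>C\<^esub> \<psi> m"]) auto
  qed (use \<psi> F H in \<open>auto intro!: C.finsum_closed\<close>)
  finally show ?thesis .
qed

lemma P_mult_comm:
  assumes f: "f \<in> carrier P" and g: "g \<in> carrier P"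
  shows "f \<otimes>\<^bsub>P\<^esub> g = g \<otimes>\<^bsub>P\<^esub> f"
proof
  note [simp] = P_closed[OF f] P_finite[OF f] P_closed[OF g] P_finite[OF g]
  fix m
  have "(f \<otimes>\<^bsub>P\<^esub> g) m = (\<Oplus>x\<in>supp R f. \<Oplus>y\<in>supp R g. if x \<otimes>\<^bsub>G\<^esub> y = m then f x \<otimes> g y else \<zero>)"
    using f g by (intro P_mult) auto
  also have "\<dots> = (\<Oplus>y\<in>supp R g. \<Oplus>x\<in>supp R f. if x \<otimes>\<^bsub>G\<^esub> y = m then f x \<otimes> g y else \<zero>)"
    using f g by (intro R.finsum_swap) auto
  also have "\<dots> = (\<Oplus>y\<in>supp R g. \<Oplus>x\<in>supp R f. if y \<otimes>\<^bsub>G\<^esub> x = m then g y \<otimes> f x else \<zero>)"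
    using f g by (intro R.finsum_cong' refl) 
      (auto simp: R.m_comm G.m_comm[OF P_supp_mem[OF f] P_supp_mem[OF g]] intro!: R.finsum_closed)
  also have "\<dots> = (g \<otimes>\<^bsub>P\<^esub> f) m"
    using f g by (intro P_mult[symmetric]) auto
  finally show "(f \<otimes>\<^bsub>P\<^esub> g) m = (g \<otimes>\<^bsub>P\<^esub> f) m" .
qed

text \<open>This is \<open>mult_eval\<close> for the identity of \<open>R\<close> and the function
  that sends \<open>m\<close> to the sum of \<open>h w\<close> over all \<open>w\<close> with
  \<open>m \<otimes> w = z\<close>. The triple sum puts the three factors on an equal footing, so
  that associativity becomes a permutation of sums.\<close>

lemma P_mult3:
  assumes f: "f \<in> carrier P" and g: "g \<in> carrier P" and h: "h \<in> carrier P"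
  shows "(f \<otimes>\<^bsub>P\<^esub> g \<otimes>\<^bsub>P\<^esub> h) z = (\<Oplus>x\<in>supp R f. \<Oplus>y\<in>supp R g. \<Oplus>w\<in>supp R h.
    if x \<otimes>\<^bsub>G\<^esub> y \<otimes>\<^bsub>G\<^esub> w = z then f x \<otimes> g y \<otimes> h w else \<zero>)"
proof -
  note [simp] = P_closed[OF f] P_finite[OF f] P_closed[OF g] P_finite[OF g] P_closed[OF h] P_finite[OF h]
  let ?\<psi> = "\<lambda>m. \<Oplus>w\<in>supp R h. if m \<otimes>\<^bsub>G\<^esub> w = z then h w else \<zero>"
  have fg: "f \<otimes>\<^bsub>P\<^esub> g \<in> carrier P" using f g by (rule P_mult_closed)
  note [simp] = P_closed[OF fg] P_finite[OF fg]
  have hc: "finite (supp R h)" and [simp]: "\<And>m. h m \<in> carrier R" using h by auto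
  have [simp]: "\<And>m. f m \<in> carrier R" "\<And>m. g m \<in> carrier R" "\<And>m. (f \<otimes>\<^bsub>P\<^esub> g) m \<in> carrier R"
    using f g fg by auto
  have dist: "a \<otimes> ?\<psi> m = (\<Oplus>w\<in>supp R h. if m \<otimes>\<^bsub>G\<^esub> w = z then a \<otimes> h w else \<zero>)" if "a \<in> carrier R" for a m
    using that hc by (subst R.finsum_rdistr) (auto intro!: R.finsum_cong')
  have "(f \<otimes>\<^bsub>P\<^esub> g \<otimes>\<^bsub>P\<^esub> h) z = (\<Oplus>m\<in>supp R (f \<otimes>\<^bsub>P\<^esub> g). \<Oplus>w\<in>supp R h.
      if m \<otimes>\<^bsub>G\<^esub> w = z then (f \<otimes>\<^bsub>P\<^esub> g) m \<otimes> h w else \<zero>)"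
    using fg h by (intro P_mult) auto
  also have "\<dots> = monoid_ring_eval R R id ?\<psi> (f \<otimes>\<^bsub>P\<^esub> g)"
    unfolding monoid_ring_eval_def by (simp add: dist)
  also have "\<dots> = (\<Oplus>x\<in>supp R f. \<Oplus>y\<in>supp R g. f x \<otimes> g y \<otimes> ?\<psi> (x \<otimes>\<^bsub>G\<^esub> y))"
    using mult_eval[OF R.cring_axioms id_ring_hom f g, of ?\<psi>] hc by (simp add: Pi_iff)
  finally show ?thesis by (simp add: dist)
qed

lemma P_mult_assoc:
  assumes f: "f \<in> carrier P" and g: "g \<in> carrier P" and h: "h \<in> carrier P"
  shows "f \<otimes>\<^bsub>P\<^esub> g \<otimes>\<^bsub>P\<^esub> h = f \<otimes>\<^bsub>P\<^esub> (g \<otimes>\<^bsub>P\<^esub> h)"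
proof
  note [simp] = P_closed[OF f] P_finite[OF f] P_closed[OF g] P_finite[OF g] P_closed[OF h] P_finite[OF h]
  fix z
  let ?F = "supp R f" and ?G = "supp R g" and ?H = "supp R h"
  note P_closed[OF f, simp] P_closed[OF g, simp] P_closed[OF h, simp]
  note fin = P_finite[OF f] P_finite[OF g] P_finite[OF h]
  \<comment> \<open>By commutativity the other bracketing is also a product of the form handled by
    \<open>P_mult3\<close>, with the factors in cyclic order.\<close>
  have "(f \<otimes>\<^bsub>P\<^esub> (g \<otimes>\<^bsub>P\<^esub> h)) z = (g \<otimes>\<^bsub>P\<^esub> h \<otimes>\<^bsub>P\<^esub> f) z"
    using P_mult_comm[OF f P_mult_closed[OF g h]] by simp
  also have "\<dots> = (\<Oplus>y\<in>?G. \<Oplus>w\<in>?H. \<Oplus>x\<in>?F. if y \<otimes>\<^bsub>G\<^esub> w \<otimes>\<^bsub>G\<^esub> x = z then g y \<otimes> h w \<otimes> f x else \<zero>)"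
    using g h f by (rule P_mult3)
  also have "\<dots> = (\<Oplus>y\<in>?G. \<Oplus>w\<in>?H. \<Oplus>x\<in>?F. if x \<otimes>\<^bsub>G\<^esub> y \<otimes>\<^bsub>G\<^esub> w = z then f x \<otimes> g y \<otimes> h w else \<zero>)"
  proof (intro R.finsum_cong' refl)
    fix x y w assume "x \<in> ?F" "y \<in> ?G" "w \<in> ?H"
    then have "x \<in> carrier G" "y \<in> carrier G" "w \<in> carrier G" using P_supp_mem f g h by auto
    then show "(if y \<otimes>\<^bsub>G\<^esub> w \<otimes>\<^bsub>G\<^esub> x = z then g y \<otimes> h w \<otimes> f x else \<zero>) =
      (if x \<otimes>\<^bsub>G\<^esub> y \<otimes>\<^bsub>G\<^esub> w = z then f x \<otimes> g y \<otimes> h w else \<zero>)"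
      by (simp add: R.m_ac G.m_ac)
  qed (auto intro!: R.finsum_closed)
  also have "\<dots> = (\<Oplus>y\<in>?G. \<Oplus>x\<in>?F. \<Oplus>w\<in>?H. if x \<otimes>\<^bsub>G\<^esub> y \<otimes>\<^bsub>G\<^esub> w = z then f x \<otimes> g y \<otimes> h w else \<zero>)"
    using fin by (intro R.finsum_cong' refl R.finsum_swap) (auto intro!: R.finsum_closed)
  also have "\<dots> = (\<Oplus>x\<in>?F. \<Oplus>y\<in>?G. \<Oplus>w\<in>?H. if x \<otimes>\<^bsub>G\<^esub> y \<otimes>\<^bsub>G\<^esub> w = z then f x \<otimes> g y \<otimes> h w else \<zero>)"
    using fin by (intro R.finsum_swap) (auto intro!: R.finsum_closed)
  also have "\<dots> = (f \<otimes>\<^bsub>P\<^esub> g \<otimes>\<^bsub>P\<^esub> h) z" using f g h by (rule P_mult3[symmetric])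
  finally show "(f \<otimes>\<^bsub>P\<^esub> g \<otimes>\<^bsub>P\<^esub> h) z = (f \<otimes>\<^bsub>P\<^esub> (g \<otimes>\<^bsub>P\<^esub> h)) z" ..
qed

lemma P_single_mult:
  assumes c: "c \<in> carrier R" and m: "m \<in> carrier G" and f: "f \<in> carrier P"
  shows "(single R c m \<otimes>\<^bsub>P\<^esub> f) z = (\<Oplus>y\<in>supp R f. if m \<otimes>\<^bsub>G\<^esub> y = z then c \<otimes> f y else \<zero>)"
proof -
  note [simp] = P_closed[OF f] P_finite[OF f]
  have "(single R c m \<otimes>\<^bsub>P\<^esub> f) z =
      (\<Oplus>x\<in>{m}. \<Oplus>y\<in>supp R f. if x \<otimes>\<^bsub>G\<^esub> y = z then single R c m x \<otimes> f y else \<zero>)"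
    by (intro P_mult P_single_closed c m f) (auto simp: single_apply)
  then show ?thesis using c by (simp add: R.finsum_insert Pi_iff single_apply R.finsum_closed cong: if_cong)
qed

lemma P_smult_eq:
  assumes c: "c \<in> carrier R" and f: "f \<in> carrier P"
  shows "single R c \<one>\<^bsub>G\<^esub> \<otimes>\<^bsub>P\<^esub> f = (\<lambda>m. c \<otimes> f m)"
proof
  note [simp] = P_closed[OF f] P_finite[OF f]
  fix z
  have "(single R c \<one>\<^bsub>G\<^esub> \<otimes>\<^bsub>P\<^esub> f) z = (\<Oplus>y\<in>supp R f. if \<one>\<^bsub>G\<^esub> \<otimes>\<^bsub>G\<^esub> y = z then c \<otimes> f y else \<zero>)"
    using c f by (intro P_single_mult) auto
  also have "\<dots> = (\<Oplus>y\<in>supp R f. if z = y then c \<otimes> f y else \<zero>)"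
    using c f by (intro R.finsum_cong') (auto simp: P_supp_mem[OF f])
  also have "\<dots> = (\<Oplus>y\<in>insert z (supp R f). if z = y then c \<otimes> f y else \<zero>)"
    using c f by (intro R.finsum_neutral_superset) auto
  also have "\<dots> = c \<otimes> f z" using c f by (intro R.finsum_singleton) auto
  finally show "(single R c \<one>\<^bsub>G\<^esub> \<otimes>\<^bsub>P\<^esub> f) z = c \<otimes> f z" .
qed

lemma P_distrib:
  assumes f: "f \<in> carrier P" and g: "g \<in> carrier P" and h: "h \<in> carrier P"
  shows "(f \<oplus>\<^bsub>P\<^esub> g) \<otimes>\<^bsub>P\<^esub> h = f \<otimes>\<^bsub>P\<^esub> h \<oplus>\<^bsub>P\<^esub> g \<otimes>\<^bsub>P\<^esub> h"
proof
  note [simp] = P_closed[OF f] P_finite[OF f] P_closed[OF g] P_finite[OF g] P_closed[OF h] P_finite[OF h]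
  fix z
  let ?F = "supp R f \<union> supp R g" and ?H = "supp R h"
  note P_closed[OF f, simp] P_closed[OF g, simp] P_closed[OF h, simp]
  note fin = P_finite[OF f] P_finite[OF g] P_finite[OF h]
  have "((f \<oplus>\<^bsub>P\<^esub> g) \<otimes>\<^bsub>P\<^esub> h) z = (\<Oplus>x\<in>?F. \<Oplus>y\<in>?H. if x \<otimes>\<^bsub>G\<^esub> y = z then (f \<oplus>\<^bsub>P\<^esub> g) x \<otimes> h y else \<zero>)"
    using fin by (intro P_mult P_add_closed f g h) (auto simp: P_add)
  also have "\<dots> = (\<Oplus>x\<in>?F. \<Oplus>y\<in>?H. (if x \<otimes>\<^bsub>G\<^esub> y = z then f x \<otimes> h y else \<zero>) \<oplus> (if x \<otimes>\<^bsub>G\<^esub> y = z then g x \<otimes> h y else \<zero>))"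
    by (intro R.finsum_cong' refl) (auto simp: P_add R.l_distr intro!: R.finsum_closed)
  also have "\<dots> = (\<Oplus>x\<in>?F. (\<Oplus>y\<in>?H. if x \<otimes>\<^bsub>G\<^esub> y = z then f x \<otimes> h y else \<zero>) \<oplus>
      (\<Oplus>y\<in>?H. if x \<otimes>\<^bsub>G\<^esub> y = z then g x \<otimes> h y else \<zero>))"
    by (intro R.finsum_cong' refl R.finsum_addf) (auto intro!: R.finsum_closed)
  also have "\<dots> = (\<Oplus>x\<in>?F. \<Oplus>y\<in>?H. if x \<otimes>\<^bsub>G\<^esub> y = z then f x \<otimes> h y else \<zero>) \<oplus>
      (\<Oplus>x\<in>?F. \<Oplus>y\<in>?H. if x \<otimes>\<^bsub>G\<^esub> y = z then g x \<otimes> h y else \<zero>)"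
    by (intro R.finsum_addf) (auto intro!: R.finsum_closed)
  also have "(\<Oplus>x\<in>?F. \<Oplus>y\<in>?H. if x \<otimes>\<^bsub>G\<^esub> y = z then f x \<otimes> h y else \<zero>) = (f \<otimes>\<^bsub>P\<^esub> h) z"
    using fin by (intro P_mult[symmetric] f h) auto
  also have "(\<Oplus>x\<in>?F. \<Oplus>y\<in>?H. if x \<otimes>\<^bsub>G\<^esub> y = z then g x \<otimes> h y else \<zero>) = (g \<otimes>\<^bsub>P\<^esub> h) z"
    using fin by (intro P_mult[symmetric] g h) auto
  finally show "((f \<oplus>\<^bsub>P\<^esub> g) \<otimes>\<^bsub>P\<^esub> h) z = (f \<otimes>\<^bsub>P\<^esub> h \<oplus>\<^bsub>P\<^esub> g \<otimes>\<^bsub>P\<^esub> h) z"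
    unfolding P_add[of "f \<otimes>\<^bsub>P\<^esub> h"] .
qed

lemma cring_P: "cring P"
proof (rule cringI)
  show "abelian_group P"
  proof (rule abelian_groupI)
    show "\<zero>\<^bsub>P\<^esub> \<in> carrier P" unfolding carrier_P by (simp add: P_zero)
    fix f assume f: "f \<in> carrier P"
    note [simp] = P_closed[OF f] P_finite[OF f]
    show "\<zero>\<^bsub>P\<^esub> \<oplus>\<^bsub>P\<^esub> f = f" using f by (simp add: fun_eq_iff P_add P_zero)
    \<comment> \<open>The negative is taken as a scalar multiple, so that its closure is an instance
      of \<open>P_smult_closed\<close>.\<close>
    have "(\<lambda>m. \<ominus> \<one> \<otimes> f m) \<in> carrier P" using f by (intro P_smult_closed) auto
    moreover have "(\<lambda>m. \<ominus> \<one> \<otimes> f m) \<oplus>\<^bsub>P\<^esub> f = \<zero>\<^bsub>P\<^esub>"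
      using f by (auto simp: fun_eq_iff P_add P_zero R.l_minus R.l_neg)
    ultimately show "\<exists>y\<in>carrier P. y \<oplus>\<^bsub>P\<^esub> f = \<zero>\<^bsub>P\<^esub>" by blast
  qed (auto simp: fun_eq_iff P_add R.a_ac P_closed intro: P_add_closed)
  show "comm_monoid P"
  proof (rule comm_monoidI)
    show "\<one>\<^bsub>P\<^esub> \<in> carrier P" unfolding P_one by (intro P_single_closed) auto
    fix f assume f: "f \<in> carrier P"
    show "\<one>\<^bsub>P\<^esub> \<otimes>\<^bsub>P\<^esub> f = f" unfolding P_one using f by (subst P_smult_eq) (auto simp: P_closed[OF f])
  qed (auto intro: P_mult_closed P_mult_assoc P_mult_comm)
qed (rule P_distrib)

lemma eval_eq:
  assumes "cring C" "\<iota> \<in> ring_hom R C" "\<And>m. m \<in> carrier G \<Longrightarrow> \<psi> m \<in> carrier C"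
    and "f \<in> carrier P" "finite W" "supp R f \<subseteq> W" "W \<subseteq> carrier G"
  shows "monoid_ring_eval R C \<iota> \<psi> f = (\<Oplus>\<^bsub>C\<^esub>m\<in>W. \<iota> (f m) \<otimes>\<^bsub>C\<^esub> \<psi> m)"
proof -
  interpret C: cring C by fact
  interpret \<iota>: ring_hom_cring R C \<iota> using assms by (simp add: ring_hom_cring_def ring_hom_cring_axioms_def R.cring_axioms)
  show ?thesis unfolding monoid_ring_eval_def
    using assms(3-) P_closed[OF assms(4)] by (intro C.finsum_neutral_superset) (auto simp: subset_iff)
qed

lemma eval_single:
  assumes "cring C" "\<iota> \<in> ring_hom R C" "\<And>m. m \<in> carrier G \<Longrightarrow> \<psi> m \<in> carrier C"
    and "c \<in> carrier R" "m \<in> carrier G"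
  shows "monoid_ring_eval R C \<iota> \<psi> (single R c m) = \<iota> c \<otimes>\<^bsub>C\<^esub> \<psi> m"
proof -
  interpret C: cring C by fact
  have "monoid_ring_eval R C \<iota> \<psi> (single R c m) = (\<Oplus>\<^bsub>C\<^esub>x\<in>{m}. \<iota> (single R c m x) \<otimes>\<^bsub>C\<^esub> \<psi> x)"
    using assms by (intro eval_eq P_single_closed) (auto simp: single_apply)
  then show ?thesis using assms ring_hom_closed[OF assms(2)] by (simp add: C.finsum_insert single_apply)
qed

text \<open>The universal property of the monoid ring: multiplicativity of \<open>\<psi>\<close>
  splits each term of the double sum in \<open>mult_eval\<close>, which then factors into the
  product of two sums.\<close>

lemma eval_hom:
  assumes C: "cring C" and \<iota>: "\<iota> \<in> ring_hom R C" and \<psi>: "\<And>m. m \<in> carrier G \<Longrightarrow> \<psi> m \<in> carrier C"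
    and \<psi>_mult: "\<And>m n. m \<in> carrier G \<Longrightarrow> n \<in> carrier G \<Longrightarrow> \<psi> (m \<otimes>\<^bsub>G\<^esub> n) = \<psi> m \<otimes>\<^bsub>C\<^esub> \<psi> n"
    and \<psi>_one: "\<psi> \<one>\<^bsub>G\<^esub> = \<one>\<^bsub>C\<^esub>"
  shows "monoid_ring_eval R C \<iota> \<psi> \<in> ring_hom P C"
proof -
  interpret C: cring C by fact
  interpret \<iota>: ring_hom_cring R C \<iota> using \<iota> by (simp add: ring_hom_cring_def ring_hom_cring_axioms_def R.cring_axioms C)
  show ?thesis
  proof (rule ring_hom_memI)
    fix f assume f: "f \<in> carrier P"
    note [simp] = P_closed[OF f] P_finite[OF f]
    have fs: "\<psi> m \<in> carrier C" if "m \<in> supp R f" for m using P_supp[OF f] that \<psi> by auto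
    show "monoid_ring_eval R C \<iota> \<psi> f \<in> carrier C"
      unfolding monoid_ring_eval_def using fs f by (intro C.finsum_closed) auto
    fix g assume g: "g \<in> carrier P"
    note [simp] = P_closed[OF g] P_finite[OF g]
    have gs: "\<psi> m \<in> carrier C" if "m \<in> supp R g" for m using P_supp[OF g] that \<psi> by auto
    let ?W = "supp R f \<union> supp R g"
    have W: "finite ?W" "?W \<subseteq> carrier G" using f g P_supp[OF f] P_supp[OF g] by auto
    have Ws: "\<psi> m \<in> carrier C" if "m \<in> ?W" for m using fs gs that by auto
    have "monoid_ring_eval R C \<iota> \<psi> (f \<oplus>\<^bsub>P\<^esub> g) = (\<Oplus>\<^bsub>C\<^esub>m\<in>?W. \<iota> ((f \<oplus>\<^bsub>P\<^esub> g) m) \<otimes>\<^bsub>C\<^esub> \<psi> m)"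
      using W by (intro eval_eq[OF C \<iota> \<psi>] P_add_closed f g) (auto simp: P_add)
    also have "\<dots> = (\<Oplus>\<^bsub>C\<^esub>m\<in>?W. \<iota> (f m) \<otimes>\<^bsub>C\<^esub> \<psi> m \<oplus>\<^bsub>C\<^esub> \<iota> (g m) \<otimes>\<^bsub>C\<^esub> \<psi> m)"
      using Ws f g by (intro C.finsum_cong' refl) (auto simp: P_add C.l_distr)
    also have "\<dots> = (\<Oplus>\<^bsub>C\<^esub>m\<in>?W. \<iota> (f m) \<otimes>\<^bsub>C\<^esub> \<psi> m) \<oplus>\<^bsub>C\<^esub> (\<Oplus>\<^bsub>C\<^esub>m\<in>?W. \<iota> (g m) \<otimes>\<^bsub>C\<^esub> \<psi> m)"
      using Ws f g by (intro C.finsum_addf) auto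
    finally show "monoid_ring_eval R C \<iota> \<psi> (f \<oplus>\<^bsub>P\<^esub> g) =
        monoid_ring_eval R C \<iota> \<psi> f \<oplus>\<^bsub>C\<^esub> monoid_ring_eval R C \<iota> \<psi> g"
      using eval_eq[OF C \<iota> \<psi> f W(1) _ W(2)] eval_eq[OF C \<iota> \<psi> g W(1) _ W(2)] by simp
    have "monoid_ring_eval R C \<iota> \<psi> (f \<otimes>\<^bsub>P\<^esub> g) =
        (\<Oplus>\<^bsub>C\<^esub>x\<in>supp R f. \<Oplus>\<^bsub>C\<^esub>y\<in>supp R g. \<iota> (f x) \<otimes>\<^bsub>C\<^esub> \<iota> (g y) \<otimes>\<^bsub>C\<^esub> \<psi> (x \<otimes>\<^bsub>G\<^esub> y))"
      by (rule mult_eval[OF C \<iota> f g \<psi>])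
    also have "\<dots> = (\<Oplus>\<^bsub>C\<^esub>x\<in>supp R f. \<Oplus>\<^bsub>C\<^esub>y\<in>supp R g. (\<iota> (f x) \<otimes>\<^bsub>C\<^esub> \<psi> x) \<otimes>\<^bsub>C\<^esub> (\<iota> (g y) \<otimes>\<^bsub>C\<^esub> \<psi> y))"
    proof (intro C.finsum_cong' refl)
      fix x y assume xy: "x \<in> supp R f" "y \<in> supp R g"
      then have "x \<in> carrier G" "y \<in> carrier G" using P_supp_mem f g by auto
      then show "\<iota> (f x) \<otimes>\<^bsub>C\<^esub> \<iota> (g y) \<otimes>\<^bsub>C\<^esub> \<psi> (x \<otimes>\<^bsub>G\<^esub> y) = (\<iota> (f x) \<otimes>\<^bsub>C\<^esub> \<psi> x) \<otimes>\<^bsub>C\<^esub> (\<iota> (g y) \<otimes>\<^bsub>C\<^esub> \<psi> y)"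
        using f g by (simp add: \<psi> \<psi>_mult C.m_ac)
    qed (use fs gs f g in \<open>auto intro!: C.finsum_closed\<close>)
    also have "\<dots> = (\<Oplus>\<^bsub>C\<^esub>x\<in>supp R f. (\<iota> (f x) \<otimes>\<^bsub>C\<^esub> \<psi> x) \<otimes>\<^bsub>C\<^esub> monoid_ring_eval R C \<iota> \<psi> g)"
      unfolding monoid_ring_eval_def
      using fs gs f g by (intro C.finsum_cong' refl C.finsum_rdistr[symmetric]) (auto intro!: C.finsum_closed)
    also have "\<dots> = monoid_ring_eval R C \<iota> \<psi> f \<otimes>\<^bsub>C\<^esub> monoid_ring_eval R C \<iota> \<psi> g"
      unfolding monoid_ring_eval_def
      using fs gs f g by (intro C.finsum_ldistr[symmetric]) (auto intro!: C.finsum_closed)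
    finally show "monoid_ring_eval R C \<iota> \<psi> (f \<otimes>\<^bsub>P\<^esub> g) =
        monoid_ring_eval R C \<iota> \<psi> f \<otimes>\<^bsub>C\<^esub> monoid_ring_eval R C \<iota> \<psi> g" .
  next
    show "monoid_ring_eval R C \<iota> \<psi> \<one>\<^bsub>P\<^esub> = \<one>\<^bsub>C\<^esub>"
      unfolding P_one using \<psi>_one by (subst eval_single[OF C \<iota> \<psi>]) auto
  qed
qed

end

section \<open>Tensor powers\<close>

text \<open>Coefficients come from a subset \<open>P\<close> of the ring itself and not from a
  separate ring of scalars. In the applications \<open>P\<close> is the image of a ring homomorphism
  into \<open>C\<close>, so one notion serves for scalars from \<open>R\<close>, from
  \<open>fobj B S\<^sub>0\<close> and from B'(S).\<close>

inductive_set gspan :: "('c, 'n) ring_scheme \<Rightarrow> 'c set \<Rightarrow> 'c set \<Rightarrow> 'c set" for C P X where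
  zero: "\<zero>\<^bsub>C\<^esub> \<in> gspan C P X"
| add: "y \<in> gspan C P X \<Longrightarrow> c \<in> P \<Longrightarrow> x \<in> X \<Longrightarrow> y \<oplus>\<^bsub>C\<^esub> c \<otimes>\<^bsub>C\<^esub> x \<in> gspan C P X"

lemma comm_monoid_product_group:
  assumes "\<And>i. i \<in> I \<Longrightarrow> comm_monoid (H i)"
  shows "comm_monoid (product_group I H)"
proof (rule comm_monoidI)
  have mon: "monoid (H i)" if "i \<in> I" for i using assms[OF that] by (rule comm_monoid.axioms(1))
  fix x y z assume x: "x \<in> carrier (product_group I H)" and y: "y \<in> carrier (product_group I H)"
    and z: "z \<in> carrier (product_group I H)"
  have mem: "x i \<in> carrier (H i)" "y i \<in> carrier (H i)" "z i \<in> carrier (H i)" if "i \<in> I" for i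
    using x y z that by (auto simp: PiE_mem)
  have "x i \<otimes>\<^bsub>H i\<^esub> y i \<in> carrier (H i)" if "i \<in> I" for i
    using monoid.m_closed[OF mon mem(1,2)] that by blast
  then show "x \<otimes>\<^bsub>product_group I H\<^esub> y \<in> carrier (product_group I H)" by simp
  have "x i \<otimes>\<^bsub>H i\<^esub> y i \<otimes>\<^bsub>H i\<^esub> z i = x i \<otimes>\<^bsub>H i\<^esub> (y i \<otimes>\<^bsub>H i\<^esub> z i)" if "i \<in> I" for i
    using monoid.m_assoc[OF mon mem] that by blast
  then show "x \<otimes>\<^bsub>product_group I H\<^esub> y \<otimes>\<^bsub>product_group I H\<^esub> z =
      x \<otimes>\<^bsub>product_group I H\<^esub> (y \<otimes>\<^bsub>product_group I H\<^esub> z)"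
    by (auto intro: restrict_ext)
  have "x i \<otimes>\<^bsub>H i\<^esub> y i = y i \<otimes>\<^bsub>H i\<^esub> x i" if "i \<in> I" for i
    using comm_monoid.m_comm[OF assms mem(1,2)] that by blast
  then show "x \<otimes>\<^bsub>product_group I H\<^esub> y = y \<otimes>\<^bsub>product_group I H\<^esub> x"
    by (auto intro: restrict_ext)
  have "(\<one>\<^bsub>product_group I H\<^esub> \<otimes>\<^bsub>product_group I H\<^esub> x) i = x i" for i
  proof (cases "i \<in> I")
    case True
    then show ?thesis using monoid.l_one[OF mon mem(1)] by simp
  next
    case False
    then show ?thesis using x PiE_arb[of x I "\<lambda>i. carrier (H i)" i] by simp
  qed
  then show "\<one>\<^bsub>product_group I H\<^esub> \<otimes>\<^bsub>product_group I H\<^esub> x = x" by (rule ext)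
next
  have "\<one>\<^bsub>H i\<^esub> \<in> carrier (H i)" if "i \<in> I" for i
    using monoid.one_closed[OF comm_monoid.axioms(1)[OF assms]] that by blast
  then show "\<one>\<^bsub>product_group I H\<^esub> \<in> carrier (product_group I H)" by simp
qed

text \<open>A criterion for \<open>C\<close> to be the tensor power of \<open>A\<close> indexed by
  \<open>S\<close>. \<open>E_span\<close> makes products of elements of \<open>E\<close> generate
  the tensor power, \<open>E_indep\<close> makes their images in \<open>C\<close> independent, and
  together they give injectivity; \<open>C_gen\<close> gives surjectivity.\<close>

locale tensor_setup = algebra R A + C: cring C
  for R :: "('r, 'm) ring_scheme" (structure) and A :: "('r, 'a, 'x) module_scheme"
    and C :: "('c, 'n) ring_scheme" +
  fixes S :: "nat set" and \<iota> :: "'r \<Rightarrow> 'c" and j :: "nat \<Rightarrow> 'a \<Rightarrow> 'c" and E :: "'a set"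
  assumes fin_S: "finite S"
    and \<iota>_hom: "\<iota> \<in> ring_hom R C"
    and j_hom: "s \<in> S \<Longrightarrow> j s \<in> ring_hom A C"
    and j_unit: "s \<in> S \<Longrightarrow> c \<in> carrier R \<Longrightarrow> j s (c \<odot>\<^bsub>A\<^esub> \<one>\<^bsub>A\<^esub>) = \<iota> c"
    and E_sub: "E \<subseteq> carrier A"
    and E_span: "carrier A \<subseteq> gspan A {c \<odot>\<^bsub>A\<^esub> \<one>\<^bsub>A\<^esub> | c. c \<in> carrier R} E"
    and E_indep: "finite W \<Longrightarrow> W \<subseteq> (S \<rightarrow>\<^sub>E E) \<Longrightarrow> k \<in> W \<rightarrow> carrier R \<Longrightarrow>
      (\<Oplus>\<^bsub>C\<^esub>w\<in>W. \<iota> (k w) \<otimes>\<^bsub>C\<^esub> (\<Otimes>\<^bsub>C\<^esub>s\<in>S. j s (w s))) = \<zero>\<^bsub>C\<^esub> \<Longrightarrow> w \<in> W \<Longrightarrow> k w = \<zero>"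
    and C_gen: "carrier C \<subseteq> generate_ring C (\<iota> ` carrier R \<union> (\<Union>s\<in>S. j s ` carrier A))"
begin

abbreviation "G \<equiv> product_group S (\<lambda>_. A)"
abbreviation "P \<equiv> free_on_families R A S"
abbreviation "J \<equiv> multilinear_ideal R A S"

definition "\<psi> w = (\<Otimes>\<^bsub>C\<^esub>s\<in>S. j s (w s))"
definition "ev = monoid_ring_eval R C \<iota> \<psi>"

lemma carrier_G [simp]: "carrier G = (S \<rightarrow>\<^sub>E carrier A)"
  by simp

lemma comm_monoid_G: "comm_monoid G"
  by (intro comm_monoid_product_group cring.axioms(2) M_cring)

sublocale MR: comm_monoid_ring R G
  by (simp add: comm_monoid_ring_def R.cring_axioms comm_monoid_G)

lemma P_eq: "P = MR.P"
  by (simp add: free_on_families_def)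

sublocale P: cring P
  unfolding P_eq by (rule MR.cring_P)

lemma j_closed: "s \<in> S \<Longrightarrow> a \<in> carrier A \<Longrightarrow> j s a \<in> carrier C"
  using ring_hom_closed[OF j_hom] .

lemma \<psi>_closed: "m \<in> S \<rightarrow>\<^sub>E carrier A \<Longrightarrow> \<psi> m \<in> carrier C"
  unfolding \<psi>_def by (intro C.finprod_closed) (auto intro!: j_closed)

text \<open>The cofactor of \<open>j s a\<close> does not involve \<open>a\<close>. Hence the two
  kinds of multilinear relations are sent to zero as soon as \<open>j s\<close> is additive and
  compatible with scalars.\<close>

lemma \<psi>_upd:
  assumes "s \<in> S" "m \<in> S \<rightarrow>\<^sub>E carrier A" "a \<in> carrier A"
  shows "\<psi> (m(s := a)) = j s a \<otimes>\<^bsub>C\<^esub> (\<Otimes>\<^bsub>C\<^esub>t\<in>S - {s}. j t (m t))"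
proof -
  have "\<psi> (m(s := a)) = (\<Otimes>\<^bsub>C\<^esub>t\<in>insert s (S - {s}). j t ((m(s := a)) t))"
    unfolding \<psi>_def using assms(1) by (simp add: insert_absorb)
  also have "\<dots> = j s a \<otimes>\<^bsub>C\<^esub> (\<Otimes>\<^bsub>C\<^esub>t\<in>S - {s}. j t ((m(s := a)) t))"
    using assms fin_S by (subst C.finprod_insert) (auto intro!: j_closed)
  also have "(\<Otimes>\<^bsub>C\<^esub>t\<in>S - {s}. j t ((m(s := a)) t)) = (\<Otimes>\<^bsub>C\<^esub>t\<in>S - {s}. j t (m t))"
    using assms by (intro C.finprod_cong') (auto intro!: j_closed)
  finally show ?thesis .
qed

lemma rest_closed: "m \<in> S \<rightarrow>\<^sub>E carrier A \<Longrightarrow> (\<Otimes>\<^bsub>C\<^esub>t\<in>S - {s}. j t (m t)) \<in> carrier C"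
  by (intro C.finprod_closed) (auto intro!: j_closed)

lemma ev_hom: "ev \<in> ring_hom P C"
  unfolding ev_def P_eq
proof (rule MR.eval_hom[OF C.cring_axioms \<iota>_hom])
  fix m n assume m: "m \<in> carrier G" and n: "n \<in> carrier G"
  show "\<psi> m \<in> carrier C" using m by (intro \<psi>_closed) simp
  have mn: "m s \<in> carrier A" "n s \<in> carrier A" if "s \<in> S" for s using m n that by (auto simp: PiE_mem)
  have "\<psi> (m \<otimes>\<^bsub>G\<^esub> n) = (\<Otimes>\<^bsub>C\<^esub>s\<in>S. j s (m s) \<otimes>\<^bsub>C\<^esub> j s (n s))"
    unfolding \<psi>_def using mn by (intro C.finprod_cong') (auto intro!: j_closed simp: ring_hom_mult[OF j_hom])
  also have "\<dots> = \<psi> m \<otimes>\<^bsub>C\<^esub> \<psi> n"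
    unfolding \<psi>_def using mn by (intro C.finprod_multf) (auto intro!: j_closed)
  finally show "\<psi> (m \<otimes>\<^bsub>G\<^esub> n) = \<psi> m \<otimes>\<^bsub>C\<^esub> \<psi> n" .
next
  show "\<psi> \<one>\<^bsub>G\<^esub> = \<one>\<^bsub>C\<^esub>"
    unfolding \<psi>_def by (intro C.finprod_one_eqI) (simp add: ring_hom_one[OF j_hom])
qed

sublocale ev: ring_hom_ring P C ev
  using ev_hom P.ring_axioms C.ring_axioms by (intro ring_hom_ringI2)

lemma single_closed: "c \<in> carrier R \<Longrightarrow> m \<in> S \<rightarrow>\<^sub>E carrier A \<Longrightarrow> single R c m \<in> carrier P"
  unfolding P_eq by (intro MR.P_single_closed) simp_all

lemma ev_single: "c \<in> carrier R \<Longrightarrow> m \<in> S \<rightarrow>\<^sub>E carrier A \<Longrightarrow> ev (single R c m) = \<iota> c \<otimes>\<^bsub>C\<^esub> \<psi> m"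
  unfolding ev_def by (intro MR.eval_single[OF C.cring_axioms \<iota>_hom]) (auto intro: \<psi>_closed)

lemma upd_closed: "s \<in> S \<Longrightarrow> m \<in> S \<rightarrow>\<^sub>E carrier A \<Longrightarrow> a \<in> carrier A \<Longrightarrow> m(s := a) \<in> S \<rightarrow>\<^sub>E carrier A"
  by (auto simp: PiE_iff extensional_def)

definition "add_rel m s a b = single R \<one> (m(s := a \<oplus>\<^bsub>A\<^esub> b)) \<ominus>\<^bsub>P\<^esub>
        (single R \<one> (m(s := a)) \<oplus>\<^bsub>P\<^esub> single R \<one> (m(s := b)))"
definition "smult_rel m s a c = single R \<one> (m(s := c \<odot>\<^bsub>A\<^esub> a)) \<ominus>\<^bsub>P\<^esub> single R c (m(s := a))"

lemma relations_eq: "multilinear_relations R A S =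
    {add_rel m s a b | m s a b. m \<in> S \<rightarrow>\<^sub>E carrier A \<and> s \<in> S \<and> a \<in> carrier A \<and> b \<in> carrier A} \<union>
    {smult_rel m s a c | m s a c. m \<in> S \<rightarrow>\<^sub>E carrier A \<and> s \<in> S \<and> a \<in> carrier A \<and> c \<in> carrier R}"
  unfolding multilinear_relations_def add_rel_def smult_rel_def ..

lemma add_rel_closed:
  "m \<in> S \<rightarrow>\<^sub>E carrier A \<Longrightarrow> s \<in> S \<Longrightarrow> a \<in> carrier A \<Longrightarrow> b \<in> carrier A \<Longrightarrow> add_rel m s a b \<in> carrier P"
  unfolding add_rel_def by (intro P.minus_closed P.a_closed single_closed upd_closed) auto

lemma smult_rel_closed:
  "m \<in> S \<rightarrow>\<^sub>E carrier A \<Longrightarrow> s \<in> S \<Longrightarrow> a \<in> carrier A \<Longrightarrow> c \<in> carrier R \<Longrightarrow> smult_rel m s a c \<in> carrier P"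
  unfolding smult_rel_def by (intro P.minus_closed P.a_closed single_closed upd_closed) auto

lemma relations_closed: "multilinear_relations R A S \<subseteq> carrier P"
  unfolding relations_eq using add_rel_closed smult_rel_closed by blast

sublocale J: ideal J P
  unfolding multilinear_ideal_def by (rule P.genideal_ideal[OF relations_closed])

lemma relations_J: "multilinear_relations R A S \<subseteq> J"
  unfolding multilinear_ideal_def by (rule P.genideal_self[OF relations_closed])

lemma ev_add_rel:
  assumes "m \<in> S \<rightarrow>\<^sub>E carrier A" "s \<in> S" "a \<in> carrier A" "b \<in> carrier A"
  shows "ev (add_rel m s a b) = \<zero>\<^bsub>C\<^esub>"
proof -
  let ?r = "\<Otimes>\<^bsub>C\<^esub>t\<in>S - {s}. j t (m t)"
  have [simp]: "?r \<in> carrier C" "j s a \<in> carrier C" "j s b \<in> carrier C" "\<iota> \<one> = \<one>\<^bsub>C\<^esub>"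
    using assms rest_closed j_closed ring_hom_one[OF \<iota>_hom] by auto
  have cl: "single R \<one> (m(s := x)) \<in> carrier P" if "x \<in> carrier A" for x
    using that assms by (intro single_closed upd_closed) auto
  have val: "ev (single R \<one> (m(s := x))) = j s x \<otimes>\<^bsub>C\<^esub> ?r" if "x \<in> carrier A" for x
    using that assms by (simp add: ev_single upd_closed \<psi>_upd rest_closed j_closed)
  show ?thesis unfolding add_rel_def a_minus_def
    using assms cl
    by (simp add: val ring_hom_add[OF j_hom] C.l_distr C.r_neg)
qed

lemma ev_smult_rel:
  assumes "m \<in> S \<rightarrow>\<^sub>E carrier A" "s \<in> S" "a \<in> carrier A" "c \<in> carrier R"
  shows "ev (smult_rel m s a c) = \<zero>\<^bsub>C\<^esub>"
proof -
  let ?r = "\<Otimes>\<^bsub>C\<^esub>t\<in>S - {s}. j t (m t)"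
  have [simp]: "?r \<in> carrier C" "j s a \<in> carrier C" "\<iota> c \<in> carrier C" "\<iota> \<one> = \<one>\<^bsub>C\<^esub>"
    using assms rest_closed j_closed ring_hom_one[OF \<iota>_hom] ring_hom_closed[OF \<iota>_hom] by auto
  have cl: "single R d (m(s := x)) \<in> carrier P" if "x \<in> carrier A" "d \<in> carrier R" for x d
    using that assms by (intro single_closed upd_closed) auto
  have val: "ev (single R d (m(s := x))) = \<iota> d \<otimes>\<^bsub>C\<^esub> (j s x \<otimes>\<^bsub>C\<^esub> ?r)" if "x \<in> carrier A" "d \<in> carrier R" for x d
    using that assms by (simp add: ev_single upd_closed \<psi>_upd rest_closed j_closed)
  have "j s (c \<odot>\<^bsub>A\<^esub> a) = \<iota> c \<otimes>\<^bsub>C\<^esub> j s a"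
    using assms by (subst smult_eq_mult) (simp_all add: ring_hom_mult[OF j_hom] j_unit)
  then show ?thesis unfolding smult_rel_def a_minus_def
    using assms cl by (simp add: val C.m_assoc C.r_neg)
qed

lemma J_ev:
  assumes "f \<in> J" shows "ev f = \<zero>\<^bsub>C\<^esub>"
proof -
  have "J \<subseteq> a_kernel P C ev"
    unfolding multilinear_ideal_def
  proof (rule P.genideal_minimal[OF ev.kernel_is_ideal], rule subsetI)
    fix x assume x: "x \<in> multilinear_relations R A S"
    then consider m s a b where "x = add_rel m s a b" "m \<in> S \<rightarrow>\<^sub>E carrier A" "s \<in> S" "a \<in> carrier A" "b \<in> carrier A"
      | m s a c where "x = smult_rel m s a c" "m \<in> S \<rightarrow>\<^sub>E carrier A" "s \<in> S" "a \<in> carrier A" "c \<in> carrier R"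
      unfolding relations_eq by blast
    then have "ev x = \<zero>\<^bsub>C\<^esub>" by cases (simp_all only: ev_add_rel ev_smult_rel)
    moreover have "x \<in> carrier P" using x relations_closed by blast
    ultimately show "x \<in> a_kernel P C ev" unfolding a_kernel_def' by blast
  qed
  then have "f \<in> a_kernel P C ev" using assms by (rule subsetD)
  then show ?thesis unfolding a_kernel_def' by blast
qed

abbreviation scale :: "'r \<Rightarrow> ((nat \<Rightarrow> 'a) \<Rightarrow> 'r) \<Rightarrow> (nat \<Rightarrow> 'a) \<Rightarrow> 'r" where
  "scale c f \<equiv> (\<lambda>m. c \<otimes> f m)"

lemma scale_eq: "c \<in> carrier R \<Longrightarrow> f \<in> carrier P \<Longrightarrow> scale c f = single R c \<one>\<^bsub>G\<^esub> \<otimes>\<^bsub>P\<^esub> f"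
  unfolding P_eq by (rule MR.P_smult_eq[symmetric])

lemma single_one_closed: "c \<in> carrier R \<Longrightarrow> single R c \<one>\<^bsub>G\<^esub> \<in> carrier P"
  by (intro single_closed) auto

lemma scale_closed: "c \<in> carrier R \<Longrightarrow> f \<in> carrier P \<Longrightarrow> scale c f \<in> carrier P"
  using scale_eq single_one_closed by simp

lemma ev_scale: "c \<in> carrier R \<Longrightarrow> f \<in> carrier P \<Longrightarrow> ev (scale c f) = \<iota> c \<otimes>\<^bsub>C\<^esub> ev f"
proof -
  assume c: "c \<in> carrier R" and f: "f \<in> carrier P"
  have "\<psi> \<one>\<^bsub>G\<^esub> = \<one>\<^bsub>C\<^esub>"
    unfolding \<psi>_def by (intro C.finprod_one_eqI) (simp add: ring_hom_one[OF j_hom])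
  then have "ev (single R c \<one>\<^bsub>G\<^esub>) = \<iota> c"
    using c ring_hom_closed[OF \<iota>_hom c] by (subst ev_single) auto
  then show ?thesis using c f single_one_closed by (simp add: scale_eq)
qed

text \<open>The elements that can be rewritten modulo \<open>J\<close> to have support in families
  of elements of \<open>E\<close>. The set is closed under sums, scalars and congruence modulo
  \<open>J\<close>, so single families suffice to show that it is everything.\<close>

definition "N = {f \<in> carrier P. \<exists>g\<in>carrier P. supp R g \<subseteq> (S \<rightarrow>\<^sub>E E) \<and> f \<ominus>\<^bsub>P\<^esub> g \<in> J}"

lemma N_I: "f \<in> carrier P \<Longrightarrow> g \<in> carrier P \<Longrightarrow> supp R g \<subseteq> (S \<rightarrow>\<^sub>E E) \<Longrightarrow> f \<ominus>\<^bsub>P\<^esub> g \<in> J \<Longrightarrow> f \<in> N"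
  unfolding N_def by blast

lemma N_zero: "\<zero>\<^bsub>P\<^esub> \<in> N"
proof (rule N_I[of _ "\<zero>\<^bsub>P\<^esub>"])
  show "supp R \<zero>\<^bsub>P\<^esub> \<subseteq> (S \<rightarrow>\<^sub>E E)" by (simp add: P_eq MR.P_zero)
  show "\<zero>\<^bsub>P\<^esub> \<ominus>\<^bsub>P\<^esub> \<zero>\<^bsub>P\<^esub> \<in> J" by (simp add: a_minus_def)
qed auto

lemma N_add:
  assumes "f \<in> N" "g \<in> N" shows "f \<oplus>\<^bsub>P\<^esub> g \<in> N"
proof -
  from assms obtain f' g' where [simp]: "f \<in> carrier P" "g \<in> carrier P" "f' \<in> carrier P" "g' \<in> carrier P"
    and s: "supp R f' \<subseteq> (S \<rightarrow>\<^sub>E E)" "supp R g' \<subseteq> (S \<rightarrow>\<^sub>E E)" and J: "f \<ominus>\<^bsub>P\<^esub> f' \<in> J" "g \<ominus>\<^bsub>P\<^esub> g' \<in> J"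
    unfolding N_def by blast
  have "(f \<oplus>\<^bsub>P\<^esub> g) \<ominus>\<^bsub>P\<^esub> (f' \<oplus>\<^bsub>P\<^esub> g') = (f \<ominus>\<^bsub>P\<^esub> f') \<oplus>\<^bsub>P\<^esub> (g \<ominus>\<^bsub>P\<^esub> g')"
    by (simp add: a_minus_def P.minus_add P.a_ac)
  then have "(f \<oplus>\<^bsub>P\<^esub> g) \<ominus>\<^bsub>P\<^esub> (f' \<oplus>\<^bsub>P\<^esub> g') \<in> J" using J by simp
  moreover have "supp R (f' \<oplus>\<^bsub>P\<^esub> g') \<subseteq> supp R f' \<union> supp R g'" by (auto simp: P_eq MR.P_add)
  ultimately show ?thesis using s by (intro N_I[of _ "f' \<oplus>\<^bsub>P\<^esub> g'"]) auto
qed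

lemma N_scale:
  assumes c: "c \<in> carrier R" and "f \<in> N" shows "scale c f \<in> N"
proof -
  from assms obtain f' where f [simp]: "f \<in> carrier P" "f' \<in> carrier P"
    and s: "supp R f' \<subseteq> (S \<rightarrow>\<^sub>E E)" and J: "f \<ominus>\<^bsub>P\<^esub> f' \<in> J"
    unfolding N_def by blast
  have "scale c f \<ominus>\<^bsub>P\<^esub> scale c f' = single R c \<one>\<^bsub>G\<^esub> \<otimes>\<^bsub>P\<^esub> (f \<ominus>\<^bsub>P\<^esub> f')"
    using single_one_closed[OF c] by (simp only: scale_eq[OF c] f a_minus_def) (simp add: P.r_distr P.r_minus)
  then have "scale c f \<ominus>\<^bsub>P\<^esub> scale c f' \<in> J" using J single_one_closed[OF c] by (simp add: J.I_l_closed)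
  moreover have "supp R (scale c f') \<subseteq> supp R f'" using c by auto
  ultimately show ?thesis using s c by (intro N_I[of _ "scale c f'"] scale_closed) auto
qed

lemma N_congruent:
  assumes "f \<ominus>\<^bsub>P\<^esub> g \<in> J" "g \<in> N" and [simp]: "f \<in> carrier P" shows "f \<in> N"
proof -
  from assms obtain g' where [simp]: "g \<in> carrier P" "g' \<in> carrier P"
    and s: "supp R g' \<subseteq> (S \<rightarrow>\<^sub>E E)" and J: "g \<ominus>\<^bsub>P\<^esub> g' \<in> J"
    unfolding N_def by blast
  have "f \<ominus>\<^bsub>P\<^esub> g' = (f \<ominus>\<^bsub>P\<^esub> g) \<oplus>\<^bsub>P\<^esub> (g \<ominus>\<^bsub>P\<^esub> g')"
  proof -
    have "(f \<ominus>\<^bsub>P\<^esub> g) \<oplus>\<^bsub>P\<^esub> (g \<ominus>\<^bsub>P\<^esub> g') = f \<oplus>\<^bsub>P\<^esub> ((\<ominus>\<^bsub>P\<^esub> g \<oplus>\<^bsub>P\<^esub> g) \<ominus>\<^bsub>P\<^esub> g')"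
      by (simp add: a_minus_def P.a_assoc)
    then show ?thesis by (simp add: P.l_neg a_minus_def)
  qed
  then have "f \<ominus>\<^bsub>P\<^esub> g' \<in> J" using J assms(1) by simp
  then show ?thesis using s by (intro N_I[of _ g']) auto
qed

text \<open>Induction on the set \<open>S'\<close> of coordinates whose entries are not yet known to
  lie in \<open>E\<close>. One coordinate is treated by expanding its entry over \<open>E\<close>
  and applying the multilinear relations; the resulting families have one coordinate fewer to
  treat.\<close>

lemma single_one_N:
  assumes "S' \<subseteq> S" "m \<in> S \<rightarrow>\<^sub>E carrier A" "\<And>s. s \<in> S - S' \<Longrightarrow> m s \<in> E"
  shows "single R \<one> m \<in> N"
  using finite_subset[OF assms(1) fin_S] assms
proof (induction S' arbitrary: m rule: finite_induct)
  case empty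
  then have m: "m \<in> S \<rightarrow>\<^sub>E E" by (auto simp: PiE_iff)
  have cl: "single R \<one> m \<in> carrier P" using empty by (intro single_closed) auto
  show ?case
  proof (rule N_I[OF cl cl])
    show "supp R (single R \<one> m) \<subseteq> (S \<rightarrow>\<^sub>E E)" using m by (auto simp: single_def)
    show "single R \<one> m \<ominus>\<^bsub>P\<^esub> single R \<one> m \<in> J" using cl by (simp add: a_minus_def P.r_neg)
  qed
next
  case (insert s S')
  have s: "s \<in> S" and m: "m \<in> S \<rightarrow>\<^sub>E carrier A" using insert by auto
  have cl: "single R c (m(s := a)) \<in> carrier P" if "a \<in> carrier A" "c \<in> carrier R" for a c
    using that s m by (intro single_closed upd_closed) auto
  have base: "single R \<one> (m(s := e)) \<in> N" if "e \<in> E" for e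
    using that insert E_sub by (intro insert.IH) (auto simp: PiE_iff extensional_def)
  have sm: "single R \<one> (m(s := c \<odot>\<^bsub>A\<^esub> a)) \<in> N" if a: "a \<in> carrier A" "single R \<one> (m(s := a)) \<in> N" and c: "c \<in> carrier R" for a c
  proof (rule N_congruent)
    have "smult_rel m s a c \<in> J" using relations_J relations_eq s m a c by blast
    then show "single R \<one> (m(s := c \<odot>\<^bsub>A\<^esub> a)) \<ominus>\<^bsub>P\<^esub> single R c (m(s := a)) \<in> J" unfolding smult_rel_def .
    have "single R c (m(s := a)) = scale c (single R \<one> (m(s := a)))" using c by (auto simp: single_def)
    then show "single R c (m(s := a)) \<in> N" using N_scale[OF c a(2)] by simp
  qed (use a c cl in auto)
  have ad: "single R \<one> (m(s := a \<oplus>\<^bsub>A\<^esub> b)) \<in> N"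
    if a: "a \<in> carrier A" "single R \<one> (m(s := a)) \<in> N" and b: "b \<in> carrier A" "single R \<one> (m(s := b)) \<in> N" for a b
  proof (rule N_congruent[OF _ N_add[OF a(2) b(2)]])
    have "add_rel m s a b \<in> J" using relations_J relations_eq s m a b by blast
    then show "single R \<one> (m(s := a \<oplus>\<^bsub>A\<^esub> b)) \<ominus>\<^bsub>P\<^esub>
        (single R \<one> (m(s := a)) \<oplus>\<^bsub>P\<^esub> single R \<one> (m(s := b))) \<in> J" unfolding add_rel_def .
  qed (use a b cl in auto)
  \<comment> \<open>Membership in the carrier is carried through the induction because the relations
    are available only for entries from the carrier.\<close>
  have "a \<in> carrier A \<and> single R \<one> (m(s := a)) \<in> N"
    if "a \<in> gspan A {c \<odot>\<^bsub>A\<^esub> \<one>\<^bsub>A\<^esub> | c. c \<in> carrier R} E" for a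
    using that
  proof induction
    case zero
    \<comment> \<open>The scalar relation with scalar and entry both zero identifies the family
      having a zero entry with \<open>single R \<zero>\<close>, which is the zero of the monoid
      ring.\<close>
    have "single R \<zero> (m(s := \<zero>\<^bsub>A\<^esub>)) = \<zero>\<^bsub>P\<^esub>" by (auto simp: single_def P_eq MR.P_zero)
    moreover have "smult_rel m s \<zero>\<^bsub>A\<^esub> \<zero> \<in> J" using relations_J relations_eq s m by blast
    ultimately have "single R \<one> (m(s := \<zero>\<^bsub>A\<^esub>)) \<ominus>\<^bsub>P\<^esub> \<zero>\<^bsub>P\<^esub> \<in> J" unfolding smult_rel_def by simp
    moreover have "\<zero>\<^bsub>A\<^esub> \<in> carrier A" by simp
    moreover have "single R \<one> (m(s := \<zero>\<^bsub>A\<^esub>)) \<in> carrier P" by (intro cl) auto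
    ultimately show ?case using N_congruent[OF _ N_zero] by blast
  next
    case (add y c e)
    then obtain d where d: "c = d \<odot>\<^bsub>A\<^esub> \<one>\<^bsub>A\<^esub>" "d \<in> carrier R" by blast
    have e: "e \<in> carrier A" using add.hyps E_sub by blast
    then have ce: "c \<otimes>\<^bsub>A\<^esub> e = d \<odot>\<^bsub>A\<^esub> e" using d smult_eq_mult[of d e] by simp
    have dc: "d \<odot>\<^bsub>A\<^esub> e \<in> carrier A" using e d by simp
    have "single R \<one> (m(s := d \<odot>\<^bsub>A\<^esub> e)) \<in> N" using sm[OF e base d(2)] add.hyps by blast
    then have "single R \<one> (m(s := y \<oplus>\<^bsub>A\<^esub> d \<odot>\<^bsub>A\<^esub> e)) \<in> N"
      by (intro ad dc conjunct1[OF add.IH] conjunct2[OF add.IH])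
    moreover have "y \<oplus>\<^bsub>A\<^esub> d \<odot>\<^bsub>A\<^esub> e \<in> carrier A"
      by (intro M.a_closed dc conjunct1[OF add.IH])
    ultimately show ?case unfolding ce by (rule conjI[rotated])
  qed
  moreover have "m s \<in> carrier A" using m s by auto
  ultimately have "single R \<one> (m(s := m s)) \<in> N" using E_span by blast
  then show ?case by (simp only: fun_upd_triv)
qed

text \<open>Induction on a finite set containing the support: one family is split off with its
  coefficient, and what remains vanishes there.\<close>

lemma N_all:
  assumes "f \<in> carrier P" shows "f \<in> N"
proof -
  have "\<forall>f\<in>carrier P. supp R f \<subseteq> W \<longrightarrow> f \<in> N" if "finite W" "W \<subseteq> S \<rightarrow>\<^sub>E carrier A" for W
    using that
  proof (induction W rule: finite_induct)
    case empty
    have "f = \<zero>\<^bsub>P\<^esub>" if "supp R f \<subseteq> {}" for f using that by (auto simp: P_eq MR.P_zero)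
    then show ?case using N_zero by metis
  next
    case (insert w W)
    show ?case
    proof (intro ballI impI)
      fix f assume f: "f \<in> carrier P" and W: "supp R f \<subseteq> insert w W"
      have fc: "f m \<in> carrier R" for m using f unfolding P_eq by (rule MR.P_closed)
      let ?g = "f(w := \<zero>)"
      have sub: "supp R ?g \<subseteq> supp R f" by auto
      have fP: "f \<in> carrier MR.P" using f by (simp only: P_eq)
      have "?g \<in> carrier MR.P"
        unfolding MR.carrier_P
        using finite_subset[OF sub MR.P_finite[OF fP]] order_trans[OF sub MR.P_supp[OF fP]] fc
        by (intro conjI allI) simp_all
      then have g: "?g \<in> carrier P" by (simp only: P_eq)
      have w: "w \<in> S \<rightarrow>\<^sub>E carrier A" using insert by auto
      have "scale (f w) (single R \<one> w) \<in> N"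
        by (intro N_scale fc single_one_N[OF order_refl w]) simp
      moreover have "?g \<in> N"
      proof -
        have "supp R ?g \<subseteq> W" using W by auto
        then show ?thesis using insert.IH insert.prems g by blast
      qed
      ultimately have "scale (f w) (single R \<one> w) \<oplus>\<^bsub>P\<^esub> ?g \<in> N" by (rule N_add)
      moreover have "scale (f w) (single R \<one> w) \<oplus>\<^bsub>P\<^esub> ?g = f"
      proof (rule ext)
        show "(scale (f w) (single R \<one> w) \<oplus>\<^bsub>P\<^esub> ?g) m = f m" for m
          unfolding P_eq MR.P_add using fc[of m] fc[of w] by (simp add: single_def)
      qed
      ultimately show "f \<in> N" by simp
    qed
  qed
  moreover have "finite (supp R f)" using assms unfolding P_eq by (rule MR.P_finite)
  moreover have "supp R f \<subseteq> S \<rightarrow>\<^sub>E carrier A"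
    using assms MR.P_supp unfolding P_eq carrier_G by blast
  ultimately show "f \<in> N" using assms by blast
qed

text \<open>Modulo \<open>J\<close> the element may be replaced by one supported on families from
  \<open>E\<close>. The replacement is still killed by \<open>ev\<close>, since \<open>J\<close> is,
  and independence then makes all of its coefficients zero.\<close>

lemma ev_zero_imp_J:
  assumes f: "f \<in> carrier P" and ev0: "ev f = \<zero>\<^bsub>C\<^esub>"
  shows "f \<in> J"
proof -
  obtain g where g [simp]: "g \<in> carrier P" and s: "supp R g \<subseteq> (S \<rightarrow>\<^sub>E E)" and J: "f \<ominus>\<^bsub>P\<^esub> g \<in> J"
    using N_all[OF f] unfolding N_def by blast
  have "ev (f \<ominus>\<^bsub>P\<^esub> g) = \<ominus>\<^bsub>C\<^esub> ev g" using f ev0 by (simp add: a_minus_def)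
  then have "ev g = \<zero>\<^bsub>C\<^esub>" using J_ev[OF J] by (metis C.minus_minus C.minus_zero ev.hom_closed g)
  then have "(\<Oplus>\<^bsub>C\<^esub>w\<in>supp R g. \<iota> (g w) \<otimes>\<^bsub>C\<^esub> (\<Otimes>\<^bsub>C\<^esub>s\<in>S. j s (w s))) = \<zero>\<^bsub>C\<^esub>"
    unfolding ev_def monoid_ring_eval_def \<psi>_def .
  moreover have "finite (supp R g)" using g unfolding P_eq by (rule MR.P_finite)
  moreover have "g \<in> supp R g \<rightarrow> carrier R" using MR.P_closed[OF g[unfolded P_eq]] by (rule Pi_I)
  ultimately have "g w = \<zero>" if "w \<in> supp R g" for w
    using s that by (intro E_indep[of "supp R g" g w])
  then have "supp R g = {}" by blast
  then have "g = \<zero>\<^bsub>P\<^esub>" by (auto simp: P_eq MR.P_zero)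
  then show ?thesis using J f by (simp add: a_minus_def)
qed

lemma kernel_eq: "a_kernel P C ev = J"
  unfolding a_kernel_def' using J_ev ev_zero_imp_J J.a_subset by blast

lemma ev_j:
  assumes "s \<in> S" "a \<in> carrier A"
  shows "j s a = ev (single R \<one> (\<one>\<^bsub>G\<^esub>(s := a)))"
proof -
  have G: "\<one>\<^bsub>G\<^esub> \<in> S \<rightarrow>\<^sub>E carrier A" by auto
  have "(\<Otimes>\<^bsub>C\<^esub>t\<in>S - {s}. j t (\<one>\<^bsub>G\<^esub> t)) = \<one>\<^bsub>C\<^esub>"
    by (intro C.finprod_one_eqI) (simp add: ring_hom_one[OF j_hom])
  then show ?thesis
    using assms ring_hom_one[OF \<iota>_hom] G j_closed
    by (simp add: ev_single upd_closed[OF _ G] \<psi>_upd[OF _ G] del: one_product_group)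
qed

lemma ev_surj: "ev ` carrier P = carrier C"
proof
  show "ev ` carrier P \<subseteq> carrier C" by auto
  have "x \<in> ev ` carrier P"
    if "x \<in> generate_ring C (\<iota> ` carrier R \<union> (\<Union>s\<in>S. j s ` carrier A))" for x
    using that
  proof induction
    case one
    show ?case using ev.hom_one P.one_closed by (metis image_eqI)
  next
    case (incl h)
    then consider c where "c \<in> carrier R" "h = \<iota> c" | s a where "s \<in> S" "a \<in> carrier A" "h = j s a" by blast
    then show ?case
    proof cases
      case 1
      have "ev (scale c \<one>\<^bsub>P\<^esub>) = \<iota> c" using 1 ring_hom_closed[OF \<iota>_hom] by (subst ev_scale) auto
      then show ?thesis using 1 scale_closed[OF 1(1) P.one_closed] by (metis image_eqI)
    next
      case 2
      have "single R \<one> (\<one>\<^bsub>G\<^esub>(s := a)) \<in> carrier P"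
        using 2 by (intro single_closed upd_closed) auto
      then show ?thesis unfolding 2(3) ev_j[OF 2(1,2)] by (rule imageI)
    qed
  next
    case (a_inv h)
    then obtain f where f: "f \<in> carrier P" "h = ev f" by blast
    then show ?case using ev.hom_a_inv[OF f(1)] imageI[OF P.a_inv_closed[OF f(1)], of ev] by simp
  next
    case (eng_add h1 h2)
    then obtain f g where f: "f \<in> carrier P" "h1 = ev f" and g: "g \<in> carrier P" "h2 = ev g" by blast
    then show ?case using ev.hom_add[OF f(1) g(1)] imageI[OF P.a_closed[OF f(1) g(1)], of ev] by simp
  next
    case (eng_mult h1 h2)
    then obtain f g where f: "f \<in> carrier P" "h1 = ev f" and g: "g \<in> carrier P" "h2 = ev g" by blast
    then show ?case using ev.hom_mult[OF f(1) g(1)] imageI[OF P.m_closed[OF f(1) g(1)], of ev] by simp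
  qed
  then show "carrier C \<subseteq> ev ` carrier P" using C_gen by blast
qed

text \<open>The map on the quotient induced by \<open>ev\<close>, which is constant on each coset.
  The expression is the one used by the first isomorphism theorem
  \<open>ev.FactRing_iso_set\<close>.\<close>

definition "\<phi> X = the_elem (ev ` X)"

abbreviation "TP \<equiv> tensor_power R A S"

lemma cring_TP: "cring TP"
  unfolding tensor_power_def by (intro cring_with_smult J.quotient_is_cring P.cring_axioms)

lemma \<phi>_iso: "\<phi> \<in> ring_iso TP C"
  unfolding tensor_power_def ring_iso_with_smult \<phi>_def
  using ev.FactRing_iso_set[OF ev_surj] unfolding kernel_eq .

lemma carrier_TP: "X \<in> carrier TP \<longleftrightarrow> (\<exists>f\<in>carrier P. X = J +>\<^bsub>P\<^esub> f)"
  unfolding tensor_power_def by (auto simp: FactRing_def A_RCOSETS_def')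

lemma coset_closed: "f \<in> carrier P \<Longrightarrow> J +>\<^bsub>P\<^esub> f \<in> carrier TP"
  using carrier_TP by blast

lemma coset_self: "f \<in> carrier P \<Longrightarrow> f \<in> J +>\<^bsub>P\<^esub> f"
  using J.a_rcos_self by simp

lemma coset_ev:
  assumes f: "f \<in> carrier P" and g: "g \<in> J +>\<^bsub>P\<^esub> f"
  shows "g \<in> carrier P" "ev g = ev f"
proof -
  obtain h where h: "h \<in> J" "g = h \<oplus>\<^bsub>P\<^esub> f" using g by (auto simp: a_r_coset_def')
  have hP: "h \<in> carrier P" using h(1) J.a_subset by blast
  show "g \<in> carrier P" unfolding h(2) by (rule P.a_closed[OF hP f])
  show "ev g = ev f"
    unfolding h(2) using ev.hom_add[OF hP f] J_ev[OF h(1)] C.l_zero[OF ev.hom_closed[OF f]] by (simp only:)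
qed

lemma \<phi>_coset:
  assumes f: "f \<in> carrier P" shows "\<phi> (J +>\<^bsub>P\<^esub> f) = ev f"
proof -
  have "ev ` (J +>\<^bsub>P\<^esub> f) = {ev f}" using coset_ev(2)[OF f] coset_self[OF f] by blast
  then show ?thesis by (simp add: \<phi>_def)
qed

lemma coset_eq_iff:
  assumes "f \<in> carrier P" "g \<in> carrier P" shows "J +>\<^bsub>P\<^esub> f = J +>\<^bsub>P\<^esub> g \<longleftrightarrow> ev f = ev g"
proof
  show "J +>\<^bsub>P\<^esub> f = J +>\<^bsub>P\<^esub> g \<Longrightarrow> ev f = ev g" using \<phi>_coset assms by metis
  assume "ev f = ev g"
  moreover have "inj_on \<phi> (carrier TP)" using \<phi>_iso by (auto simp: ring_iso_def bij_betw_def)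
  ultimately show "J +>\<^bsub>P\<^esub> f = J +>\<^bsub>P\<^esub> g"
    using \<phi>_coset assms coset_closed by (metis inj_onD)
qed

text \<open>The analogue of \<open>Union_fraction\<close> for cosets. Representatives are compared
  through \<open>ev\<close>, which is equivalent to congruence because the kernel is exactly
  \<open>J\<close>.\<close>

lemma Union_coset:
  assumes f: "f \<in> carrier P" and F: "\<And>g. g \<in> carrier P \<Longrightarrow> ev g = ev f \<Longrightarrow> F g = F f"
  shows "(\<Union>g\<in>J +>\<^bsub>P\<^esub> f. F g) = F f"
proof -
  have "(\<Union>g\<in>J +>\<^bsub>P\<^esub> f. F g) = (\<Union>g\<in>J +>\<^bsub>P\<^esub> f. F f)" using coset_ev[OF f] F by (intro SUP_cong) auto
  then show ?thesis using coset_self[OF f] by (metis UN_constant empty_iff)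
qed

lemma TP_smult: "c \<in> carrier R \<Longrightarrow> f \<in> carrier P \<Longrightarrow> c \<odot>\<^bsub>TP\<^esub> (J +>\<^bsub>P\<^esub> f) = J +>\<^bsub>P\<^esub> scale c f"
  unfolding tensor_power_def with_smult_simps
  by (rule Union_coset) (auto simp: coset_eq_iff scale_closed ev_scale)

lemma TP_unit: 
  assumes "c \<in> carrier R" 
  shows "c \<odot>\<^bsub>TP\<^esub> \<one>\<^bsub>TP\<^esub> \<in> carrier TP" "\<phi> (c \<odot>\<^bsub>TP\<^esub> \<one>\<^bsub>TP\<^esub>) = \<iota> c"
proof -
  have "\<one>\<^bsub>TP\<^esub> = J +>\<^bsub>P\<^esub> \<one>\<^bsub>P\<^esub>" by (simp add: tensor_power_def FactRing_def)
  then show "c \<odot>\<^bsub>TP\<^esub> \<one>\<^bsub>TP\<^esub> \<in> carrier TP" "\<phi> (c \<odot>\<^bsub>TP\<^esub> \<one>\<^bsub>TP\<^esub>) = \<iota> c"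
    using assms ring_hom_closed[OF \<iota>_hom] by (auto simp: TP_smult scale_closed coset_closed \<phi>_coset ev_scale)
qed

end

lemma family_push_closed:
  assumes "m \<in> S \<rightarrow>\<^sub>E carrier A" "\<pi> \<in> fi_hom S T" "\<one>\<^bsub>A\<^esub> \<in> carrier A"
  shows "family_push A S T \<pi> m \<in> T \<rightarrow>\<^sub>E carrier A"
  unfolding family_push_def
proof (rule restrict_PiE_iff[THEN iffD2], intro ballI)
  fix t assume "t \<in> T"
  have "m (inv_into S \<pi> t) \<in> carrier A" if "t \<in> \<pi> ` S"
    using inv_into_into[OF that] assms(1) by (rule PiE_mem[rotated])
  then show "(if t \<in> \<pi> ` S then m (inv_into S \<pi> t) else \<one>\<^bsub>A\<^esub>) \<in> carrier A" using assms(3) by simp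
qed

text \<open>Pushing families forward along \<open>\<pi>\<close> corresponds under evaluation to
  applying \<open>b\<close>. As evaluation detects cosets, this one identity yields both that the
  union in \<open>tensor_map\<close> is a single coset and that \<open>\<phi>\<close> is
  natural.\<close>

lemma tensor_map_natural:
  assumes "tensor_setup R A CS S \<iota>S jS ES" and "tensor_setup R A CT T \<iota>T jT ET"
    and \<pi>: "\<pi> \<in> fi_hom S T" and b: "b \<in> ring_hom CS CT"
    and b\<iota>: "\<And>c. c \<in> carrier R \<Longrightarrow> b (\<iota>S c) = \<iota>T c"
    and bj: "\<And>s a. s \<in> S \<Longrightarrow> a \<in> carrier A \<Longrightarrow> b (jS s a) = jT (\<pi> s) a"
    and X: "X \<in> carrier (tensor_power R A S)"
  shows "tensor_map R A S T \<pi> X \<in> carrier (tensor_power R A T)"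
    and "tensor_setup.\<phi> R CT T \<iota>T jT (tensor_map R A S T \<pi> X) = b (tensor_setup.\<phi> R CS S \<iota>S jS X)"
proof -
  interpret S: tensor_setup R A CS S \<iota>S jS ES by fact
  interpret T: tensor_setup R A CT T \<iota>T jT ET by fact
  interpret b: ring_hom_cring CS CT b
    using b by (simp add: ring_hom_cring_def ring_hom_cring_axioms_def S.C.cring_axioms T.C.cring_axioms)
  define pm where "pm = family_push A S T \<pi>"
  define push where "push g = (\<lambda>m'. \<Oplus>\<^bsub>R\<^esub>m\<in>{m. g m \<noteq> \<zero>\<^bsub>R\<^esub> \<and> pm m = m'}. g m)" for g :: "(nat \<Rightarrow> 'c) \<Rightarrow> 'a"
  have inj: "inj_on \<pi> S" and sub: "\<pi> ` S \<subseteq> T" using \<pi> by (auto simp: fi_hom_def)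
  have oneA: "\<one>\<^bsub>A\<^esub> \<in> carrier A" using S.M_cring by (simp add: cring_def ring.ring_simprules)
  have pm_closed: "pm m \<in> T \<rightarrow>\<^sub>E carrier A" if "m \<in> S \<rightarrow>\<^sub>E carrier A" for m
    unfolding pm_def by (rule family_push_closed[OF that \<pi> oneA])
  have \<psi>_pm: "T.\<psi> (pm m) = b (S.\<psi> m)" if m: "m \<in> S \<rightarrow>\<^sub>E carrier A" for m
  proof -
    have pT: "pm m t \<in> carrier A" if "t \<in> T" for t using PiE_mem[OF pm_closed[OF m] that] .
    have mS: "m s \<in> carrier A" if "s \<in> S" for s using PiE_mem[OF m that] .
    \<comment> \<open>Coordinates outside the image of \<open>\<pi>\<close> carry the entry one and
      drop out of the product.\<close>
    have "T.\<psi> (pm m) = (\<Otimes>\<^bsub>CT\<^esub>t\<in>\<pi> ` S. jT t (pm m t))"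
      unfolding T.\<psi>_def
    proof (rule T.C.finprod_mono_neutral_cong_left[OF T.fin_S sub, symmetric])
      show "(\<lambda>t. jT t (pm m t)) \<in> T \<rightarrow> carrier CT" by (intro Pi_I T.j_closed pT)
      fix t assume t: "t \<in> T - \<pi> ` S"
      then have "pm m t = \<one>\<^bsub>A\<^esub>" by (simp add: pm_def family_push_def)
      then show "jT t (pm m t) = \<one>\<^bsub>CT\<^esub>" using t by (simp add: ring_hom_one[OF T.j_hom])
    qed simp
    also have "\<dots> = (\<Otimes>\<^bsub>CT\<^esub>s\<in>S. jT (\<pi> s) (pm m (\<pi> s)))"
      using sub pT by (intro T.C.finprod_reindex inj) (auto intro!: T.j_closed)
    also have "\<dots> = (\<Otimes>\<^bsub>CT\<^esub>s\<in>S. b (jS s (m s)))"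
    proof (intro T.C.finprod_cong' refl)
      fix s assume s: "s \<in> S"
      then have "\<pi> s \<in> T" "inv_into S \<pi> (\<pi> s) = s" using sub inj by auto
      then show "jT (\<pi> s) (pm m (\<pi> s)) = b (jS s (m s))"
        using s bj[OF s mS[OF s]] by (simp add: pm_def family_push_def)
    qed (auto intro!: b.hom_closed S.j_closed mS)
    also have "\<dots> = b (S.\<psi> m)"
      unfolding S.\<psi>_def by (subst b.hom_finprod) (auto intro!: S.j_closed mS simp: comp_def)
    finally show ?thesis .
  qed
  have push: "push g \<in> carrier T.P" "T.ev (push g) = b (S.ev g)" if g: "g \<in> carrier S.P" for g
  proof -
    have gM: "g \<in> carrier S.MR.P" using g by (simp only: S.P_eq)
    note gc = S.MR.P_closed[OF gM] and gf = S.MR.P_finite[OF gM]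
    have gs: "m \<in> S \<rightarrow>\<^sub>E carrier A" if "g m \<noteq> \<zero>\<^bsub>R\<^esub>" for m
      using S.MR.P_supp_mem[OF gM that] by simp
    have supp: "supp R (push g) \<subseteq> pm ` supp R g"
    proof
      fix m' assume "m' \<in> supp R (push g)"
      then have "{m. g m \<noteq> \<zero>\<^bsub>R\<^esub> \<and> pm m = m'} \<noteq> {}" unfolding push_def by fastforce
      then show "m' \<in> pm ` supp R g" by blast
    qed
    have img: "pm ` supp R g \<subseteq> T \<rightarrow>\<^sub>E carrier A" using pm_closed gs by blast
    have "push g \<in> carrier T.MR.P"
      unfolding T.MR.carrier_P
    proof (intro conjI allI)
      show "push g m' \<in> carrier R" for m' unfolding push_def by (intro S.R.finsum_closed Pi_I gc)
      show "supp R (push g) \<subseteq> carrier T.G" using order_trans[OF supp img] by simp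
      show "finite (supp R (push g))" by (rule finite_subset[OF supp finite_imageI[OF gf]])
    qed
    then show pg: "push g \<in> carrier T.P" by (simp only: T.P_eq)
    have \<iota>c: "\<iota>T c \<in> carrier CT" if "c \<in> carrier R" for c using ring_hom_closed[OF T.\<iota>_hom that] .
    have tc: "\<iota>T (g m) \<otimes>\<^bsub>CT\<^esub> T.\<psi> (pm m) \<in> carrier CT" if "g m \<noteq> \<zero>\<^bsub>R\<^esub>" for m
      by (intro T.C.m_closed \<iota>c gc T.\<psi>_closed pm_closed gs that)
    interpret \<iota>T: ring_hom_cring R CT \<iota>T
      using T.\<iota>_hom by (simp add: ring_hom_cring_def ring_hom_cring_axioms_def S.R.cring_axioms T.C.cring_axioms)
    have "T.ev (push g) = (\<Oplus>\<^bsub>CT\<^esub>m'\<in>pm ` supp R g. \<iota>T (push g m') \<otimes>\<^bsub>CT\<^esub> T.\<psi> m')"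
      unfolding T.ev_def
    proof (rule T.MR.eval_eq[OF T.C.cring_axioms T.\<iota>_hom])
      show "push g \<in> carrier T.MR.P" using pg by (simp only: T.P_eq)
    qed (use gf supp img T.\<psi>_closed in auto)
    \<comment> \<open>A coefficient of \<open>push g\<close> is a sum over a fibre of
      \<open>pm\<close>, since different families may have the same image. Expanding these sums and
      uniting the fibres gives a sum over the support of \<open>g\<close>.\<close>
    also have "\<dots> = (\<Oplus>\<^bsub>CT\<^esub>m'\<in>pm ` supp R g. \<Oplus>\<^bsub>CT\<^esub>m\<in>{m \<in> supp R g. pm m = m'}. \<iota>T (g m) \<otimes>\<^bsub>CT\<^esub> T.\<psi> (pm m))"
    proof (intro T.C.finsum_cong' refl)
      fix m' assume m': "m' \<in> pm ` supp R g"
      have "\<iota>T (push g m') \<otimes>\<^bsub>CT\<^esub> T.\<psi> m' = (\<Oplus>\<^bsub>CT\<^esub>m\<in>{m \<in> supp R g. pm m = m'}. \<iota>T (g m)) \<otimes>\<^bsub>CT\<^esub> T.\<psi> m'"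
        unfolding push_def by (subst \<iota>T.hom_finsum) (auto intro!: gc simp: comp_def)
      also have "\<dots> = (\<Oplus>\<^bsub>CT\<^esub>m\<in>{m \<in> supp R g. pm m = m'}. \<iota>T (g m) \<otimes>\<^bsub>CT\<^esub> T.\<psi> m')"
        using gf img m' by (intro T.C.finsum_ldistr) (auto intro!: T.\<psi>_closed \<iota>c gc)
      also have "\<dots> = (\<Oplus>\<^bsub>CT\<^esub>m\<in>{m \<in> supp R g. pm m = m'}. \<iota>T (g m) \<otimes>\<^bsub>CT\<^esub> T.\<psi> (pm m))"
        using tc by (intro T.C.finsum_cong') auto
      finally show "\<iota>T (push g m') \<otimes>\<^bsub>CT\<^esub> T.\<psi> m' =
        (\<Oplus>\<^bsub>CT\<^esub>m\<in>{m \<in> supp R g. pm m = m'}. \<iota>T (g m) \<otimes>\<^bsub>CT\<^esub> T.\<psi> (pm m))" .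
    qed (auto intro!: T.C.finsum_closed tc)
    also have "\<dots> = (\<Oplus>\<^bsub>CT\<^esub>m\<in>(\<Union>m'\<in>pm ` supp R g. {m \<in> supp R g. pm m = m'}). \<iota>T (g m) \<otimes>\<^bsub>CT\<^esub> T.\<psi> (pm m))"
      using gf tc by (intro T.C.add.finprod_UN_disjoint[symmetric]) (auto simp: pairwise_def disjnt_def)
    also have "(\<Union>m'\<in>pm ` supp R g. {m \<in> supp R g. pm m = m'}) = supp R g" by blast
    also have "(\<Oplus>\<^bsub>CT\<^esub>m\<in>supp R g. \<iota>T (g m) \<otimes>\<^bsub>CT\<^esub> T.\<psi> (pm m)) =
        (\<Oplus>\<^bsub>CT\<^esub>m\<in>supp R g. b (\<iota>S (g m) \<otimes>\<^bsub>CS\<^esub> S.\<psi> m))"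
    proof (intro T.C.finsum_cong' refl)
      fix m assume "m \<in> supp R g"
      then have m: "m \<in> S \<rightarrow>\<^sub>E carrier A" using gs by blast
      show "\<iota>T (g m) \<otimes>\<^bsub>CT\<^esub> T.\<psi> (pm m) = b (\<iota>S (g m) \<otimes>\<^bsub>CS\<^esub> S.\<psi> m)"
        using b.hom_mult[OF ring_hom_closed[OF S.\<iota>_hom gc] S.\<psi>_closed[OF m]] \<psi>_pm[OF m] b\<iota>[OF gc] by simp
    qed (auto intro!: b.hom_closed S.C.m_closed ring_hom_closed[OF S.\<iota>_hom] gc S.\<psi>_closed gs)
    also have "\<dots> = b (S.ev g)"
      unfolding S.ev_def monoid_ring_eval_def
      by (subst b.hom_finsum) (auto intro!: S.C.m_closed ring_hom_closed[OF S.\<iota>_hom] gc S.\<psi>_closed gs simp: comp_def)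
    finally show "T.ev (push g) = b (S.ev g)" .
  qed
  obtain f where f: "f \<in> carrier S.P" "X = S.J +>\<^bsub>S.P\<^esub> f" using X S.carrier_TP by blast
  have "tensor_map R A S T \<pi> X = (\<Union>g\<in>X. T.J +>\<^bsub>T.P\<^esub> push g)"
    unfolding tensor_map_def push_def pm_def ..
  also have "\<dots> = T.J +>\<^bsub>T.P\<^esub> push f"
    unfolding f(2) by (rule S.Union_coset[OF f(1)]) (simp add: T.coset_eq_iff push f(1))
  finally have eq: "tensor_map R A S T \<pi> X = T.J +>\<^bsub>T.P\<^esub> push f" .
  show "tensor_map R A S T \<pi> X \<in> carrier (tensor_power R A T)"
    unfolding eq by (intro T.coset_closed push f(1))
  show "T.\<phi> (tensor_map R A S T \<pi> X) = b (S.\<phi> X)"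
    unfolding eq unfolding f(2) by (simp only: T.\<phi>_coset[OF push(1)[OF f(1)]] S.\<phi>_coset[OF f(1)] push(2)[OF f(1)])
qed

text \<open>The set [1]. The name protects \<open>{1..1}\<close> from being simplified to a
  singleton, so that it keeps the form used in the statement about X'([1]).\<close>

definition one_pt :: "nat set" where "one_pt = {1..1}"

lemma finite_one_pt [simp]: "finite one_pt"
  by (simp add: one_pt_def)

abbreviation pt :: "nat \<Rightarrow> nat \<Rightarrow> nat" where
  "pt s \<equiv> (\<lambda>i\<in>one_pt. s)"

lemma pt_hom: "s \<in> S \<Longrightarrow> pt s \<in> fi_hom one_pt S"
  by (auto simp: fi_hom_def inj_on_def one_pt_def)

lemma pt_compose: "s \<in> S \<Longrightarrow> compose one_pt \<pi> (pt s) = pt (\<pi> s)"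
  by (rule ext) (auto simp: compose_def)

section \<open>FI-algebras whose values are tensor powers\<close>

context fi_algebra
begin

abbreviation "A1 \<equiv> fobj B one_pt"
abbreviation "unit S c \<equiv> c \<odot>\<^bsub>fobj B S\<^esub> \<one>\<^bsub>fobj B S\<^esub>"
text \<open>The map of coefficient rings dual to the projection to the coordinate \<open>s\<close>;
  for a tensor power it is the inclusion of the factor with index \<open>s\<close>.\<close>

definition "jmap S s = fmap B one_pt S (pt s)"
definition "incl S T = fmap B S T (\<lambda>i\<in>S. i)"

lemma unit_hom: "finite S \<Longrightarrow> unit S \<in> ring_hom K (fobj B S)"
  using algebra.unit_hom[OF obj_algebra] .

lemma jmap_hom: "finite S \<Longrightarrow> s \<in> S \<Longrightarrow> jmap S s \<in> ring_hom A1 (fobj B S)"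
  unfolding jmap_def by (intro map_ring_hom pt_hom) auto

lemma incl_hom: "finite S \<Longrightarrow> finite T \<Longrightarrow> S \<subseteq> T \<Longrightarrow> incl S T \<in> ring_hom (fobj B S) (fobj B T)"
  unfolding incl_def by (intro map_ring_hom fi_hom_subset)

lemma jmap_map:
  assumes "finite S" "finite T" "\<pi> \<in> fi_hom S T" "s \<in> S" "a \<in> carrier A1"
  shows "fmap B S T \<pi> (jmap S s a) = jmap T (\<pi> s) a"
  using map_comp[of "one_pt" S T "pt s" \<pi> a] assms pt_hom[OF assms(4)] pt_compose[OF assms(4), of \<pi>]
  by (simp add: jmap_def)

lemma jmap_incl:
  assumes "finite S" "finite T" "S \<subseteq> T" "s \<in> S" "a \<in> carrier A1"
  shows "incl S T (jmap S s a) = jmap T s a"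
  unfolding incl_def using jmap_map[OF assms(1,2) fi_hom_subset assms(4,5)] assms(3,4) by simp

lemma incl_unit:
  assumes "finite S" "finite T" "S \<subseteq> T" "c \<in> carrier K"
  shows "incl S T (unit S c) = unit T c"
  unfolding incl_def using assms by (intro map_unit fi_hom_subset)

text \<open>Induction on \<open>S\<close>. For a new point \<open>s\<close> the families are grouped
  by their value \<open>v\<close> at \<open>s\<close>; the group has a common factor
  \<open>jmap v\<close> and its cofactor lies in B(S). This is why \<open>ind1\<close> has
  coefficients in B(S) and not only in \<open>K\<close>: it makes every cofactor vanish, and the
  induction hypothesis applies to each of them. For empty \<open>S\<close> there is one family, with
  product one, and \<open>zero\<close> applies.\<close>

lemma families_indep:
  assumes zero: "\<And>c. c \<in> carrier K \<Longrightarrow> unit {} c = \<zero>\<^bsub>fobj B {}\<^esub> \<Longrightarrow> c = \<zero>\<^bsub>K\<^esub>"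
    and E: "E \<subseteq> carrier A1"
    and ind1: "\<And>S s V g. finite S \<Longrightarrow> s \<notin> S \<Longrightarrow> finite V \<Longrightarrow> V \<subseteq> E \<Longrightarrow> g \<in> V \<rightarrow> carrier (fobj B S) \<Longrightarrow>
      (\<Oplus>\<^bsub>fobj B (insert s S)\<^esub>v\<in>V. incl S (insert s S) (g v) \<otimes>\<^bsub>fobj B (insert s S)\<^esub> jmap (insert s S) s v)
        = \<zero>\<^bsub>fobj B (insert s S)\<^esub> \<Longrightarrow> \<forall>v\<in>V. g v = \<zero>\<^bsub>fobj B S\<^esub>"
    and S: "finite S" and V: "finite V" "V \<subseteq> E" and c: "c \<in> (S \<rightarrow>\<^sub>E V) \<rightarrow> carrier K"
    and sum0: "(\<Oplus>\<^bsub>fobj B S\<^esub>w\<in>S \<rightarrow>\<^sub>E V. unit S (c w) \<otimes>\<^bsub>fobj B S\<^esub> (\<Otimes>\<^bsub>fobj B S\<^esub>s\<in>S. jmap S s (w s))) = \<zero>\<^bsub>fobj B S\<^esub>"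
    and w: "w \<in> S \<rightarrow>\<^sub>E V"
  shows "c w = \<zero>\<^bsub>K\<^esub>"
  using S c sum0 w
proof (induction S arbitrary: c w rule: finite_induct)
  case empty
  interpret C: cring "fobj B {}" by (rule cring_obj) simp
  have w: "w = (\<lambda>x. undefined)" and cw: "c w \<in> carrier K" using empty by auto
  have u: "unit {} (c w) \<in> carrier (fobj B {})" using ring_hom_closed[OF unit_hom[OF finite.emptyI] cw] .
  have "unit {} (c w) = \<zero>\<^bsub>fobj B {}\<^esub>"
    using empty(2) u unfolding w by (simp add: C.finsum_insert)
  then show ?case by (intro zero cw)
next
  case (insert s S c w)
  let ?T = "insert s S"
  interpret CS: cring "fobj B S" by (intro cring_obj insert.hyps)
  interpret CT: cring "fobj B ?T" using insert.hyps by (intro cring_obj) auto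
  have fT: "finite ?T" using insert.hyps by simp
  have ST: "S \<subseteq> ?T" by blast
  interpret i: ring_hom_cring "fobj B S" "fobj B ?T" "incl S ?T"
    using incl_hom[OF insert.hyps(1) fT ST]
    by (simp add: ring_hom_cring_def ring_hom_cring_axioms_def CS.cring_axioms CT.cring_axioms)
  let ?t = "\<lambda>w. unit ?T (c w) \<otimes>\<^bsub>fobj B ?T\<^esub> (\<Otimes>\<^bsub>fobj B ?T\<^esub>s\<in>?T. jmap ?T s (w s))"
  let ?u = "\<lambda>v w. unit S (c (w(s := v))) \<otimes>\<^bsub>fobj B S\<^esub> (\<Otimes>\<^bsub>fobj B S\<^esub>s\<in>S. jmap S s (w s))"
  \<comment> \<open>The coefficient of \<open>jmap v\<close> at the new point, a sum over the
    families on the old points.\<close>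
  define g where "g v = (\<Oplus>\<^bsub>fobj B S\<^esub>w\<in>S \<rightarrow>\<^sub>E V. ?u v w)" for v
  have VA: "v \<in> carrier A1" if "v \<in> V" for v using that V(2) E by blast
  have jS: "jmap S r a \<in> carrier (fobj B S)" if "r \<in> S" "a \<in> carrier A1" for r a
    using ring_hom_closed[OF jmap_hom[OF insert.hyps(1)]] that by blast
  have jT: "jmap ?T r a \<in> carrier (fobj B ?T)" if "r \<in> ?T" "a \<in> carrier A1" for r a
    using ring_hom_closed[OF jmap_hom[OF fT]] that by blast
  have cK: "c (w(s := v)) \<in> carrier K" if "v \<in> V" "w \<in> S \<rightarrow>\<^sub>E V" for v w
  proof -
    have "w(s := v) \<in> insert s S \<rightarrow>\<^sub>E V" using that by (auto simp: PiE_iff extensional_def)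
    then show ?thesis using insert.prems(1) by blast
  qed
  have prodS: "(\<Otimes>\<^bsub>fobj B S\<^esub>s\<in>S. jmap S s (w s)) \<in> carrier (fobj B S)" if "w \<in> S \<rightarrow>\<^sub>E V" for w
    using that by (intro CS.finprod_closed Pi_I jS VA) auto
  have uS: "?u v w \<in> carrier (fobj B S)" if "v \<in> V" "w \<in> S \<rightarrow>\<^sub>E V" for v w
    using that by (intro CS.m_closed prodS ring_hom_closed[OF unit_hom[OF insert.hyps(1)]] cK)
  have gS: "g v \<in> carrier (fobj B S)" if "v \<in> V" for v
    unfolding g_def using that uS by (intro CS.finsum_closed) auto
  have finS: "finite (S \<rightarrow>\<^sub>E V)" using insert.hyps V by (intro finite_PiE) auto
  have t_eq: "?t (w(s := v)) = incl S ?T (?u v w) \<otimes>\<^bsub>fobj B ?T\<^esub> jmap ?T s v" if v: "v \<in> V" and w: "w \<in> S \<rightarrow>\<^sub>E V" for v w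
  proof -
    have wA: "w r \<in> carrier A1" if "r \<in> S" for r using w that by (intro VA) auto
    have "(\<Otimes>\<^bsub>fobj B ?T\<^esub>r\<in>?T. jmap ?T r ((w(s := v)) r)) =
        jmap ?T s v \<otimes>\<^bsub>fobj B ?T\<^esub> (\<Otimes>\<^bsub>fobj B ?T\<^esub>r\<in>S. jmap ?T r ((w(s := v)) r))"
      using insert.hyps by (subst CT.finprod_insert) (auto intro!: jT VA[OF v] wA)
    also have "(\<Otimes>\<^bsub>fobj B ?T\<^esub>r\<in>S. jmap ?T r ((w(s := v)) r)) = (\<Otimes>\<^bsub>fobj B ?T\<^esub>r\<in>S. incl S ?T (jmap S r (w r)))"
    proof (intro CT.finprod_cong' refl)
      fix r assume r: "r \<in> S"
      show "jmap ?T r ((w(s := v)) r) = incl S ?T (jmap S r (w r))"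
        using r insert.hyps jmap_incl[OF insert.hyps(1) fT ST r wA[OF r]] by auto
    qed (auto intro!: i.hom_closed jS wA)
    also have "\<dots> = incl S ?T (\<Otimes>\<^bsub>fobj B S\<^esub>r\<in>S. jmap S r (w r))"
      by (subst i.hom_finprod) (auto intro!: jS wA simp: comp_def)
    finally have 1: "(\<Otimes>\<^bsub>fobj B ?T\<^esub>r\<in>?T. jmap ?T r ((w(s := v)) r)) =
      jmap ?T s v \<otimes>\<^bsub>fobj B ?T\<^esub> incl S ?T (\<Otimes>\<^bsub>fobj B S\<^esub>r\<in>S. jmap S r (w r))" .
    have 2: "unit ?T (c (w(s := v))) = incl S ?T (unit S (c (w(s := v))))"
      by (rule incl_unit[OF insert.hyps(1) fT ST cK[OF v w], symmetric])
    have 3: "unit S (c (w(s := v))) \<in> carrier (fobj B S)"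
      by (intro ring_hom_closed[OF unit_hom[OF insert.hyps(1)]] cK v w)
    have 4: "jmap ?T s v \<in> carrier (fobj B ?T)" by (intro jT VA v) simp
    show ?thesis unfolding 1 2 i.hom_mult[OF 3 prodS[OF w]]
      using i.hom_closed[OF 3] i.hom_closed[OF prodS[OF w]] 4 by (simp only: CT.m_ac)
  qed
  have tc: "incl S ?T (?u v w) \<otimes>\<^bsub>fobj B ?T\<^esub> jmap ?T s v \<in> carrier (fobj B ?T)" if "v \<in> V" "w \<in> S \<rightarrow>\<^sub>E V" for v w
    using that by (intro CT.m_closed i.hom_closed uS jT VA) auto
  have inj: "inj_on (\<lambda>(v, w). w(s := v)) (V \<times> (S \<rightarrow>\<^sub>E V))"
    using inj_combinator[OF insert.hyps(2), of "\<lambda>_. V"] by simp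
  have "(\<Oplus>\<^bsub>fobj B ?T\<^esub>v\<in>V. incl S ?T (g v) \<otimes>\<^bsub>fobj B ?T\<^esub> jmap ?T s v) =
      (\<Oplus>\<^bsub>fobj B ?T\<^esub>v\<in>V. \<Oplus>\<^bsub>fobj B ?T\<^esub>w\<in>S \<rightarrow>\<^sub>E V. ?t (w(s := v)))"
  proof (intro CT.finsum_cong' refl)
    fix v assume v: "v \<in> V"
    have "incl S ?T (g v) = (\<Oplus>\<^bsub>fobj B ?T\<^esub>w\<in>S \<rightarrow>\<^sub>E V. incl S ?T (?u v w))"
      unfolding g_def using uS[OF v] by (subst i.hom_finsum) (auto simp: comp_def)
    then have "incl S ?T (g v) \<otimes>\<^bsub>fobj B ?T\<^esub> jmap ?T s v =
        (\<Oplus>\<^bsub>fobj B ?T\<^esub>w\<in>S \<rightarrow>\<^sub>E V. incl S ?T (?u v w) \<otimes>\<^bsub>fobj B ?T\<^esub> jmap ?T s v)"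
      using finS uS[OF v] jT[of s v] VA[OF v] by (simp add: CT.finsum_ldistr Pi_iff)
    also have "\<dots> = (\<Oplus>\<^bsub>fobj B ?T\<^esub>w\<in>S \<rightarrow>\<^sub>E V. ?t (w(s := v)))"
      by (intro CT.finsum_cong' refl Pi_I) (simp_all only: t_eq[OF v] tc[OF v])
    finally show "incl S ?T (g v) \<otimes>\<^bsub>fobj B ?T\<^esub> jmap ?T s v = (\<Oplus>\<^bsub>fobj B ?T\<^esub>w\<in>S \<rightarrow>\<^sub>E V. ?t (w(s := v)))" .
  qed (intro Pi_I CT.finsum_closed; simp only: t_eq tc)
  also have "\<dots> = (\<Oplus>\<^bsub>fobj B ?T\<^esub>p\<in>V \<times> (S \<rightarrow>\<^sub>E V). ?t ((\<lambda>(v, w). w(s := v)) p))"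
    by (subst CT.finsum_Times) (simp_all only: V finS prod.case t_eq tc)
  also have "\<dots> = (\<Oplus>\<^bsub>fobj B ?T\<^esub>w\<in>(\<lambda>(v, w). w(s := v)) ` (V \<times> (S \<rightarrow>\<^sub>E V)). ?t w)"
  proof (rule CT.finsum_reindex[OF _ inj, symmetric], rule Pi_I)
    fix w assume "w \<in> (\<lambda>(v, w). w(s := v)) ` (V \<times> (S \<rightarrow>\<^sub>E V))"
    then obtain v w' where "v \<in> V" "w' \<in> S \<rightarrow>\<^sub>E V" "w = w'(s := v)" by auto
    then show "?t w \<in> carrier (fobj B ?T)" by (simp only: t_eq tc)
  qed
  also have "(\<lambda>(v, w). w(s := v)) ` (V \<times> (S \<rightarrow>\<^sub>E V)) = (?T \<rightarrow>\<^sub>E V)"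
    unfolding PiE_insert_eq ..
  also have "(\<Oplus>\<^bsub>fobj B ?T\<^esub>w\<in>?T \<rightarrow>\<^sub>E V. ?t w) = \<zero>\<^bsub>fobj B ?T\<^esub>" by (rule insert.prems(2))
  finally have g0: "\<forall>v\<in>V. g v = \<zero>\<^bsub>fobj B S\<^esub>"
    using gS by (intro ind1[OF insert.hyps(1,2) V]) auto
  have "w \<in> (\<lambda>(v, w). w(s := v)) ` (V \<times> (S \<rightarrow>\<^sub>E V))" using insert.prems(3) unfolding PiE_insert_eq .
  then obtain v w' where vw: "v \<in> V" "w' \<in> S \<rightarrow>\<^sub>E V" "w = w'(s := v)" by auto
  have "(\<lambda>w. c (w(s := v))) w' = \<zero>\<^bsub>K\<^esub>"
  proof (rule insert.IH[OF _ _ vw(2)])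
    show "(\<lambda>w. c (w(s := v))) \<in> (S \<rightarrow>\<^sub>E V) \<rightarrow> carrier K" using cK[OF vw(1)] by blast
    show "(\<Oplus>\<^bsub>fobj B S\<^esub>w\<in>S \<rightarrow>\<^sub>E V. ?u v w) = \<zero>\<^bsub>fobj B S\<^esub>" using g0 vw(1) unfolding g_def by blast
  qed
  then show ?case unfolding vw(3) .
qed

text \<open>The hypotheses on one new point propagate to all finite \<open>S\<close> by
  \<open>families_indep\<close>, which supplies \<open>E_indep\<close> of
  \<open>tensor_setup\<close>. The isomorphisms obtained for the individual \<open>S\<close> are
  natural because \<open>fmap\<close> permutes the maps \<open>jmap\<close> according to
  \<open>\<pi>\<close>.\<close>

theorem fi_op_isomorphic_fibre_powers:
  assumes zero: "\<And>c. c \<in> carrier K \<Longrightarrow> unit {} c = \<zero>\<^bsub>fobj B {}\<^esub> \<Longrightarrow> c = \<zero>\<^bsub>K\<^esub>"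
    and E: "E \<subseteq> carrier A1"
    and span: "carrier A1 \<subseteq> gspan A1 {unit one_pt c | c. c \<in> carrier K} E"
    and ind1: "\<And>S s V g. finite S \<Longrightarrow> s \<notin> S \<Longrightarrow> finite V \<Longrightarrow> V \<subseteq> E \<Longrightarrow> g \<in> V \<rightarrow> carrier (fobj B S) \<Longrightarrow>
      (\<Oplus>\<^bsub>fobj B (insert s S)\<^esub>v\<in>V. incl S (insert s S) (g v) \<otimes>\<^bsub>fobj B (insert s S)\<^esub> jmap (insert s S) s v)
        = \<zero>\<^bsub>fobj B (insert s S)\<^esub> \<Longrightarrow> \<forall>v\<in>V. g v = \<zero>\<^bsub>fobj B S\<^esub>"
    and gen: "\<And>S. finite S \<Longrightarrow> carrier (fobj B S) \<subseteq>
      generate_ring (fobj B S) (unit S ` carrier K \<union> (\<Union>s\<in>S. jmap S s ` carrier A1))"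
  shows "fi_op_isomorphic (spec K) (fi_spec K B) (fibre_powers K A1)"
proof -
  have ts: "tensor_setup K A1 (fobj B S) S (unit S) (jmap S) E" if S: "finite S" for S
  proof -
    interpret C: cring "fobj B S" using S by (rule cring_obj)
    show ?thesis
    proof (intro tensor_setup.intro tensor_setup_axioms.intro)
      show "algebra K A1" by (rule obj_algebra) simp
      show "cring (fobj B S)" using S by (rule cring_obj)
      show "jmap S s (unit one_pt c) = unit S c" if "s \<in> S" "c \<in> carrier K" for s c
        unfolding jmap_def using that S by (intro map_unit pt_hom) auto
      fix W k w
      assume W: "finite W" "W \<subseteq> S \<rightarrow>\<^sub>E E" and k: "k \<in> W \<rightarrow> carrier K" and w: "w \<in> W"
        and sum: "(\<Oplus>\<^bsub>fobj B S\<^esub>w\<in>W. unit S (k w) \<otimes>\<^bsub>fobj B S\<^esub> (\<Otimes>\<^bsub>fobj B S\<^esub>s\<in>S. jmap S s (w s))) = \<zero>\<^bsub>fobj B S\<^esub>"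
      \<comment> \<open>\<open>families_indep\<close> concerns all families with values in one
        finite set. \<open>V\<close> collects the values that occur in \<open>W\<close>, and the
        coefficients are extended by zero to the other families over \<open>V\<close>.\<close>
      define V where "V = (\<Union>w\<in>W. w ` S)"
      define c where "c w = (if w \<in> W then k w else \<zero>\<^bsub>K\<^esub>)" for w
      have V: "finite V" "V \<subseteq> E" using W S unfolding V_def by auto
      have WV: "W \<subseteq> S \<rightarrow>\<^sub>E V"
      proof
        fix w assume w: "w \<in> W"
        then have "w \<in> extensional S" using W(2) by (auto simp: PiE_iff)
        then show "w \<in> S \<rightarrow>\<^sub>E V" using w unfolding PiE_iff V_def by blast
      qed
      interpret K: cring K by (rule cring_base)
      have cK: "c w \<in> carrier K" for w using k by (auto simp: c_def)
      have j: "jmap S s (w s) \<in> carrier (fobj B S)" if "w \<in> S \<rightarrow>\<^sub>E V" "s \<in> S" for w s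
        using that V(2) E by (intro ring_hom_closed[OF jmap_hom[OF S]]) auto
      have pr: "(\<Otimes>\<^bsub>fobj B S\<^esub>s\<in>S. jmap S s (w s)) \<in> carrier (fobj B S)" if "w \<in> S \<rightarrow>\<^sub>E V" for w
        using j[OF that] by (intro C.finprod_closed) auto
      have uc: "unit S x \<in> carrier (fobj B S)" if "x \<in> carrier K" for x using ring_hom_closed[OF unit_hom[OF S] that] .
      interpret u: ring_hom_cring K "fobj B S" "unit S"
        using unit_hom[OF S] by (simp add: ring_hom_cring_def ring_hom_cring_axioms_def C.cring_axioms K.cring_axioms)
      have "(\<Oplus>\<^bsub>fobj B S\<^esub>w\<in>S \<rightarrow>\<^sub>E V. unit S (c w) \<otimes>\<^bsub>fobj B S\<^esub> (\<Otimes>\<^bsub>fobj B S\<^esub>s\<in>S. jmap S s (w s))) =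
          (\<Oplus>\<^bsub>fobj B S\<^esub>w\<in>W. unit S (c w) \<otimes>\<^bsub>fobj B S\<^esub> (\<Otimes>\<^bsub>fobj B S\<^esub>s\<in>S. jmap S s (w s)))"
      proof (rule C.finsum_neutral_superset[symmetric, OF _ WV])
        show "finite (S \<rightarrow>\<^sub>E V)" using S V by (intro finite_PiE) auto
        show "unit S (c w) \<otimes>\<^bsub>fobj B S\<^esub> (\<Otimes>\<^bsub>fobj B S\<^esub>s\<in>S. jmap S s (w s)) = \<zero>\<^bsub>fobj B S\<^esub>" if "w \<in> (S \<rightarrow>\<^sub>E V) - W" for w
          using that pr[of w] u.hom_zero by (simp add: c_def)
        show "unit S (c w) \<otimes>\<^bsub>fobj B S\<^esub> (\<Otimes>\<^bsub>fobj B S\<^esub>s\<in>S. jmap S s (w s)) \<in> carrier (fobj B S)" if "w \<in> W" for w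
          using that WV by (intro C.m_closed uc cK pr) auto
      qed
      also have "\<dots> = (\<Oplus>\<^bsub>fobj B S\<^esub>w\<in>W. unit S (k w) \<otimes>\<^bsub>fobj B S\<^esub> (\<Otimes>\<^bsub>fobj B S\<^esub>s\<in>S. jmap S s (w s)))"
        using WV k by (intro C.finsum_cong' refl) (auto simp: c_def intro!: C.m_closed uc pr)
      finally have "c w = \<zero>\<^bsub>K\<^esub>"
        using sum WV w cK by (intro families_indep[OF zero E ind1 S V, where c = c and w = w]) auto
      then show "k w = \<zero>\<^bsub>K\<^esub>" using w by (simp add: c_def)
    qed (use S E span gen unit_hom jmap_hom in auto)
  qed
  define \<phi> where "\<phi> S = tensor_setup.\<phi> K (fobj B S) S (unit S) (jmap S)" for S
  have fo: "fobj (fi_tensor_powers K A1) S = tensor_power K A1 S"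
    and fm: "fmap (fi_tensor_powers K A1) S T \<pi> = tensor_map K A1 S T \<pi>" for S T \<pi>
    by (simp_all add: fi_tensor_powers_def)
  have nat: "tensor_map K A1 S T \<pi> X \<in> carrier (tensor_power K A1 T)"
    "\<phi> T (tensor_map K A1 S T \<pi> X) = fmap B S T \<pi> (\<phi> S X)"
    if "finite S" "finite T" "\<pi> \<in> fi_hom S T" "X \<in> carrier (tensor_power K A1 S)" for S T \<pi> X
    unfolding \<phi>_def
    by (rule tensor_map_natural[OF ts[OF that(1)] ts[OF that(2)] that(3) map_ring_hom[OF that(1-3)]
        map_unit[OF that(1-3)] jmap_map[OF that(1-3)] that(4)]; assumption)+
  show ?thesis
    unfolding fibre_powers_def
  proof (rule fi_op_isomorphic_fi_specI[where \<phi> = \<phi>], unfold fo fm)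
    fix S :: "nat set" assume S: "finite S"
    interpret T: tensor_setup K A1 "fobj B S" S "unit S" "jmap S" E by (rule ts[OF S])
    show "cring (tensor_power K A1 S)" by (rule T.cring_TP)
    show "\<phi> S \<in> ring_iso (tensor_power K A1 S) (fobj B S)" unfolding \<phi>_def by (rule T.\<phi>_iso)
    fix c assume c: "c \<in> carrier K"
    show "c \<odot>\<^bsub>tensor_power K A1 S\<^esub> \<one>\<^bsub>tensor_power K A1 S\<^esub> \<in> carrier (tensor_power K A1 S)"
      using T.TP_unit(1)[OF c] .
    show "\<phi> S (c \<odot>\<^bsub>tensor_power K A1 S\<^esub> \<one>\<^bsub>tensor_power K A1 S\<^esub>) = unit S c"
      unfolding \<phi>_def using T.TP_unit(2)[OF c] .
  qed (fact cring_base cring_obj unit_hom map_ring_hom nat)+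
qed

end

text \<open>A generator of width 0 comes from B({}) and is absorbed into the scalars. A generator of
  width 1 comes from B([1]) along a point of its set, and all its images under injections are then
  images of that one element at points of \<open>S\<close>.\<close>

lemma (in fi_algebra) fin_gen_width_le_1_generators:
  assumes "fi_fin_gen_width_le_1 K B"
  obtains bs where "set bs \<subseteq> carrier A1"
    "\<forall>S. finite S \<longrightarrow> carrier (fobj B S) \<subseteq>
      generate_ring (fobj B S) (incl {} S ` carrier (fobj B {}) \<union> (\<Union>s\<in>S. jmap S s ` set bs))"
proof -
  obtain G where G1: "finite G"
    and G2: "\<forall>(T, b)\<in>G. finite T \<and> b \<in> carrier (fobj B T) \<and> fi_width B T b \<le> 1"
    and G3: "\<forall>S. finite S \<longrightarrow> carrier (fobj B S) =
        generate_ring (fobj B S)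
          ({c \<odot>\<^bsub>fobj B S\<^esub> \<one>\<^bsub>fobj B S\<^esub> | c. c \<in> carrier K} \<union>
           {fmap B T S \<pi> b | T b \<pi>. (T, b) \<in> G \<and> \<pi> \<in> fi_hom T S})"
    using assms unfolding fi_fin_gen_width_le_1_def by (elim exE conjE) (rule that)
  have G: "finite T" "b \<in> carrier (fobj B T)" "fi_width B T b \<le> 1" if "(T, b) \<in> G" for T b
  proof -
    have "finite T \<and> b \<in> carrier (fobj B T) \<and> fi_width B T b \<le> 1"
      using bspec[OF G2 that] by (unfold prod.case)
    then show "finite T" "b \<in> carrier (fobj B T)" "fi_width B T b \<le> 1" by (rule conjunct1 conjunct2[THEN conjunct1] conjunct2[THEN conjunct2])+
  qed
  have width: "(\<exists>b'\<in>carrier (fobj B {}). b = incl {} T b') \<or> (\<exists>t\<in>T. \<exists>b'\<in>carrier A1. b = jmap T t b')"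
    if Tb: "(T, b) \<in> G" for T b
  proof -
    let ?Q = "\<lambda>n. \<exists>\<pi>\<in>fi_hom {1..n} T. b \<in> fmap B {1..n} T \<pi> ` carrier (fobj B {1..n})"
    have T: "finite T" and b: "b \<in> carrier (fobj B T)" and w: "fi_width B T b \<le> 1" by (rule G[OF Tb])+
    \<comment> \<open>The width is a \<open>LEAST\<close>, so some number with the required property
      has to be exhibited: \<open>card T\<close> has it, by an enumeration of
      \<open>T\<close>.\<close>
    obtain f where f: "bij_betw f {1..card T} T" by (rule exE[OF ex_bij_betw_nat_finite_1[OF T]])
    define \<sigma> where "\<sigma> = (\<lambda>i\<in>{1..card T}. f i)"
    define \<tau> where "\<tau> = (\<lambda>t\<in>T. inv_into {1..card T} f t)"
    have sg: "\<sigma> \<in> fi_hom {1..card T} T"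
    proof (rule fi_homI)
      show "\<sigma> \<in> {1..card T} \<rightarrow>\<^sub>E T"
        unfolding \<sigma>_def restrict_PiE_iff by (rule bij_betwE[OF f])
      show "inj_on \<sigma> {1..card T}"
        unfolding \<sigma>_def inj_on_restrict_eq by (rule bij_betw_imp_inj_on[OF f])
    qed
    have ta: "\<tau> \<in> fi_hom T {1..card T}"
    proof (rule fi_homI)
      show "\<tau> \<in> T \<rightarrow>\<^sub>E {1..card T}"
        unfolding \<tau>_def restrict_PiE_iff 
        by (intro ballI inv_into_into) (unfold bij_betw_imp_surj_on[OF f])
      show "inj_on \<tau> T"
        unfolding \<tau>_def inj_on_restrict_eq by (rule inj_on_inv_into) (unfold bij_betw_imp_surj_on[OF f], rule order_refl)
    qed
    have "compose T \<sigma> \<tau> = (\<lambda>i\<in>T. i)"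
    proof (rule ext)
      fix x show "compose T \<sigma> \<tau> x = (\<lambda>i\<in>T. i) x"
      proof (cases "x \<in> T")
        case True
        then have "x \<in> f ` {1..card T}" using f by (simp add: bij_betw_def)
        then have "inv_into {1..card T} f x \<in> {1..card T}" "f (inv_into {1..card T} f x) = x"
          by (rule inv_into_into, rule f_inv_into_f)
        then show ?thesis using True by (simp add: compose_def \<sigma>_def \<tau>_def)
      qed (simp add: compose_def)
    qed
    then have "b = fmap B {1..card T} T \<sigma> (fmap B T {1..card T} \<tau> b)"
      using map_comp[OF T _ T ta sg b] map_id[OF T b] by simp
    moreover have "fmap B T {1..card T} \<tau> b \<in> carrier (fobj B {1..card T})"
      using ring_hom_closed[OF map_ring_hom[OF T _ ta] b] by simp
    ultimately have "?Q (card T)" by (rule bexI[OF image_eqI sg])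
    then have "?Q (fi_width B T b)" unfolding fi_width_def by (rule LeastI)
    then obtain \<pi> b' where pi: "\<pi> \<in> fi_hom {1..fi_width B T b} T" "b' \<in> carrier (fobj B {1..fi_width B T b})"
      "b = fmap B {1..fi_width B T b} T \<pi> b'" by (elim bexE imageE) (rule that)
    consider "fi_width B T b = 0" | "fi_width B T b = 1" using w by linarith
    then show ?thesis
    proof cases
      case 1
      then have "{1..fi_width B T b} = {}" by simp
      then have "\<pi> = (\<lambda>i\<in>{}. i)" "b' \<in> carrier (fobj B {})" "b = fmap B {} T \<pi> b'" using pi by (auto simp: fi_hom_def)
      then show ?thesis unfolding incl_def by blast
    next
      case 2
      then have o: "{1..fi_width B T b} = one_pt" by (simp add: one_pt_def)
      have "\<pi> 1 \<in> T" using fi_hom_mem[OF pi(1)] unfolding o by (simp add: one_pt_def)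
      moreover have "\<pi> = pt (\<pi> 1)"
      proof (rule ext)
        fix x
        have "\<pi> \<in> one_pt \<rightarrow>\<^sub>E T" using pi(1) unfolding o fi_hom_def mem_Collect_eq by (rule conjunct1)
        then have "x \<notin> one_pt \<Longrightarrow> \<pi> x = undefined" by (rule PiE_arb)
        then show "\<pi> x = pt (\<pi> 1) x" by (cases "x = 1") (simp_all add: one_pt_def)
      qed
      then have "fmap B one_pt T \<pi> b' = jmap T (\<pi> 1) b'"
        unfolding jmap_def by (rule arg_cong[where f = "\<lambda>p. fmap B one_pt T p b'"])
      then have "b = jmap T (\<pi> 1) b'" using pi(3) unfolding o by (rule trans[rotated])
      ultimately show ?thesis using pi(2) unfolding o by (intro disjI2 bexI)
    qed
  qed
  \<comment> \<open>A preimage in B([1]) for each generator that has one. The remaining generators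
    come from B({}) by \<open>width\<close>.\<close>
  define pick where "pick p = (SOME b'. b' \<in> carrier A1 \<and> (\<exists>t\<in>fst p. snd p = jmap (fst p) t b'))" for p
  let ?G1 = "{p \<in> G. \<exists>b'. b' \<in> carrier A1 \<and> (\<exists>t\<in>fst p. snd p = jmap (fst p) t b')}"
  have pick: "pick p \<in> carrier A1 \<and> (\<exists>t\<in>fst p. snd p = jmap (fst p) t (pick p))" if "p \<in> ?G1" for p
  proof -
    have "\<exists>b'. b' \<in> carrier A1 \<and> (\<exists>t\<in>fst p. snd p = jmap (fst p) t b')"
      using that unfolding mem_Collect_eq by (rule conjunct2)
    then show ?thesis unfolding pick_def by (rule someI_ex)
  qed
  have fin: "finite (pick ` ?G1)" using G1 by simp
  obtain bs where bs: "set bs = pick ` ?G1" by (rule exE[OF finite_list[OF fin]])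
  have "carrier (fobj B S) \<subseteq>
      generate_ring (fobj B S) (incl {} S ` carrier (fobj B {}) \<union> (\<Union>s\<in>S. jmap S s ` set bs))"
    if S: "finite S" for S
  proof -
    let ?H = "incl {} S ` carrier (fobj B {}) \<union> (\<Union>s\<in>S. jmap S s ` set bs)"
    have 1: "c \<odot>\<^bsub>fobj B S\<^esub> \<one>\<^bsub>fobj B S\<^esub> \<in> ?H" if c: "c \<in> carrier K" for c
    proof (rule UnI1, rule image_eqI)
      show "unit S c = incl {} S (unit {} c)" by (rule incl_unit[OF finite.emptyI S empty_subsetI c, symmetric])
      show "unit {} c \<in> carrier (fobj B {})" by (rule ring_hom_closed[OF unit_hom[OF finite.emptyI] c])
    qed
    have 2: "fmap B T S \<pi> b \<in> ?H" if Tb: "(T, b) \<in> G" and pi: "\<pi> \<in> fi_hom T S" for T b \<pi>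
    proof (cases "(T, b) \<in> ?G1")
      case True
      note p = pick[OF True, unfolded fst_conv snd_conv]
      obtain t where t: "t \<in> T" "b = jmap T t (pick (T, b))" using conjunct2[OF p] by (rule bexE)
      have "fmap B T S \<pi> b = jmap S (\<pi> t) (pick (T, b))"
        using jmap_map[OF _ S pi t(1) conjunct1[OF p]] t(2) G(1)[OF Tb] by simp
      moreover have "\<pi> t \<in> S" by (rule fi_hom_mem[OF pi t(1)])
      moreover have "pick (T, b) \<in> set bs" unfolding bs using True by (rule imageI)
      ultimately show ?thesis by blast
    next
      case False
      then obtain b' where b': "b' \<in> carrier (fobj B {})" "b = incl {} T b'" using width[OF Tb] Tb by auto
      have e: "(\<lambda>i\<in>{}. i) \<in> fi_hom {} T" by (rule fi_hom_subset) simp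
      have "compose {} \<pi> (\<lambda>i\<in>{}. i) = (\<lambda>i\<in>{}. i)" by (rule ext) (simp add: compose_def)
      then have "fmap B T S \<pi> b = incl {} S b'"
        using map_comp[OF finite.emptyI _ S e pi b'(1)] G(1)[OF Tb] unfolding b'(2) incl_def by simp
      then show ?thesis using b'(1) by blast
    qed
    have "x \<in> generate_ring (fobj B S) ?H"
      if "x \<in> generate_ring (fobj B S) ({c \<odot>\<^bsub>fobj B S\<^esub> \<one>\<^bsub>fobj B S\<^esub> | c. c \<in> carrier K} \<union>
           {fmap B T S \<pi> b | T b \<pi>. (T, b) \<in> G \<and> \<pi> \<in> fi_hom T S})" for x
      using that
    proof induction
      case (incl x)
      then have "x \<in> ?H"
      proof (elim UnE CollectE exE conjE)
        fix c assume x: "x = unit S c" and c: "c \<in> carrier K"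
        show "x \<in> ?H" unfolding x by (rule 1[OF c])
      next
        fix T b \<pi> assume x: "x = fmap B T S \<pi> b" and b: "(T, b) \<in> G" "\<pi> \<in> fi_hom T S"
        show "x \<in> ?H" unfolding x by (rule 2[OF b])
      qed
      then show ?case by (rule generate_ring.incl)
    qed (rule generate_ring.one | erule generate_ring.a_inv | erule (1) generate_ring.eng_add | erule (1) generate_ring.eng_mult)+
    then show ?thesis unfolding G3[rule_format, OF S] by (rule subsetI)
  qed
  moreover have "set bs \<subseteq> carrier A1" unfolding bs by (rule image_subsetI) (rule conjunct1[OF pick])
  ultimately show ?thesis using that by blast
qed

section \<open>Dickson's lemma\<close>

text \<open>\<open>h m\<close> is an index beyond \<open>m\<close> at which \<open>f\<close> is
  minimal among all indices beyond \<open>m\<close>. Iterating \<open>h\<close> gives the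
  subsequence: each term minimises over a tail that contains the next one. It starts with
  \<open>h 0\<close>, so that every term is such a minimiser.\<close>

lemma nat_seq_mono_subseq:
  fixes f :: "nat \<Rightarrow> nat"
  shows "\<exists>r :: nat \<Rightarrow> nat. strict_mono r \<and> mono (\<lambda>i. f (r i))"
proof -
  have "\<forall>m. \<exists>k>m. \<forall>l>m. f k \<le> f l"
  proof
    fix m
    show "\<exists>k>m. \<forall>l>m. f k \<le> f l"
      using ex_has_least_nat[of "\<lambda>k. k > m" "Suc m" f] by auto
  qed
  then obtain h where h: "\<And>m. h m > m" "\<And>m l. l > m \<Longrightarrow> f (h m) \<le> f l" by metis
  define r where "r i = (h ^^ Suc i) 0" for i
  have "r i < r (Suc i)" for i unfolding r_def using h(1) by simp
  moreover have "f (r i) \<le> f (r (Suc i))" for i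
  proof -
    have "(h ^^ i) 0 < r i" using h(1) by (simp add: r_def)
    also have "r i < r (Suc i)" by fact
    finally have "f (h ((h ^^ i) 0)) \<le> f (r (Suc i))" by (rule h(2))
    then show ?thesis by (simp add: r_def)
  qed
  ultimately show ?thesis by (auto simp: strict_mono_Suc_iff mono_iff_le_Suc)
qed

text \<open>Induction on the length: a subsequence with weakly increasing heads is chosen, and then
  a further subsequence with weakly increasing tails. The first property survives the second
  choice.\<close>

lemma dickson_subseq:
  fixes f :: "nat \<Rightarrow> nat list"
  assumes "\<And>i. length (f i) = n"
  shows "\<exists>r :: nat \<Rightarrow> nat. strict_mono r \<and> (\<forall>i j. i \<le> j \<longrightarrow> list_all2 (\<le>) (f (r i)) (f (r j)))"
  using assms
proof (induction n arbitrary: f)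
  case 0
  then have "f i = []" for i by simp
  then show ?case by (intro exI[of _ id]) (simp add: strict_mono_def)
next
  case (Suc n)
  obtain r :: "nat \<Rightarrow> nat" where r: "strict_mono r" "mono (\<lambda>i. hd (f (r i)))"
    using nat_seq_mono_subseq[of "\<lambda>i. hd (f i)"] by blast
  obtain q :: "nat \<Rightarrow> nat" where q: "strict_mono q" "\<And>i j. i \<le> j \<Longrightarrow> list_all2 (\<le>) (tl (f (r (q i)))) (tl (f (r (q j))))"
    using Suc.IH[of "\<lambda>i. tl (f (r i))"] Suc.prems by auto
  have cons: "f i = hd (f i) # tl (f i)" for i using Suc.prems[of i] by (cases "f i") auto
  have "list_all2 (\<le>) (f (r (q i))) (f (r (q j)))" if "i \<le> j" for i j
  proof -
    have "q i \<le> q j" using q(1) that by (simp add: strict_mono_less_eq)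
    then have "hd (f (r (q i))) \<le> hd (f (r (q j)))" using r(2) by (simp add: mono_def)
    then have "list_all2 (\<le>) (hd (f (r (q i))) # tl (f (r (q i)))) (hd (f (r (q j))) # tl (f (r (q j))))"
      using q(2)[OF that] by simp
    then show ?thesis by (simp only: cons[symmetric])
  qed
  moreover have "strict_mono (\<lambda>i. r (q i))" using r(1) q(1) by (simp add: strict_mono_def)
  ultimately show ?case by blast
qed

definition upset :: "nat \<Rightarrow> nat list set \<Rightarrow> bool" where
  "upset n X \<longleftrightarrow> (\<forall>u\<in>X. length u = n) \<and> (\<forall>u\<in>X. \<forall>v. list_all2 (\<le>) u v \<longrightarrow> v \<in> X)"

text \<open>The ascending chain condition for upward closed sets, with inclusion reversed so that
  minimal elements are maximal sets. In an infinite strictly ascending chain each stage contributes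
  a new element, and two of these are comparable.\<close>

lemma wf_upset: "wf {(Y, X). upset n X \<and> upset n Y \<and> X \<subset> Y}"
  unfolding wf_iff_no_infinite_down_chain
proof
  assume "\<exists>F. \<forall>i. (F (Suc i), F i) \<in> {(Y, X). upset n X \<and> upset n Y \<and> X \<subset> Y}"
  then obtain F where "\<forall>i. upset n (F i) \<and> upset n (F (Suc i)) \<and> F i \<subset> F (Suc i)" by auto
  then have F: "\<And>i. upset n (F i)" "\<And>i. F i \<subset> F (Suc i)" by blast+
  then have "\<forall>i. \<exists>u. u \<in> F (Suc i) \<and> u \<notin> F i" by blast
  then obtain u where u: "\<And>i. u i \<in> F (Suc i)" "\<And>i. u i \<notin> F i" by metis
  have "length (u i) = n" for i using u(1) F(1) unfolding upset_def by blast
  then obtain r :: "nat \<Rightarrow> nat" where r: "strict_mono r" "\<And>i j. i \<le> j \<Longrightarrow> list_all2 (\<le>) (u (r i)) (u (r j))"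
    using dickson_subseq[of u n] by blast
  have "r 0 < r 1" using r(1) by (simp add: strict_mono_def)
  then have "Suc (r 0) \<le> r 1" by simp
  \<comment> \<open>\<open>u i\<close> lies in stage \<open>Suc i\<close> but not in stage
    \<open>i\<close>. The strict inequality of the indices therefore puts \<open>u (r 0)\<close>
    into \<open>F (r 1)\<close>, and upward closure puts in \<open>u (r 1)\<close>, which that stage
    excludes.\<close>
  then have "F (Suc (r 0)) \<subseteq> F (r 1)"
    by (rule lift_Suc_mono_le[of F, OF psubset_imp_subset[OF F(2)]])
  then have "u (r 0) \<in> F (r 1)" using u(1)[of "r 0"] by (rule subsetD)
  moreover have "list_all2 (\<le>) (u (r 0)) (u (r 1))" by (rule r(2)) simp
  ultimately have "u (r 1) \<in> F (r 1)" using F(1)[of "r 1"] unfolding upset_def by blast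
  then show False using u(2) by blast
qed

text \<open>The order compares lengths before entries and is a well-order; at equal lengths it is
  lexicographic. Compatibility with addition is the defining property of a monomial order.\<close>

lemma list_add_less:
  fixes u v w :: "nat list"
  assumes "u < v" "length u = n" "length v = n" "length w = n"
  shows "map2 (+) u w < map2 (+) v w"
  using assms
proof (induction n arbitrary: u v w)
  case 0
  then show ?case by simp
next
  case (Suc n)
  then obtain a u' b v' c w' where "u = a # u'" "v = b # v'" "w = c # w'"
    "length u' = n" "length v' = n" "length w' = n" by (auto simp: length_Suc_conv)
  then show ?case using Suc.prems(1) Suc.IH[of u' v' w'] by (auto simp: Cons_less_Cons)
qed

lemma list_all2_le_add:
  fixes u v :: "nat list"
  assumes "list_all2 (\<le>) u v"
  shows "\<exists>w. length w = length u \<and> v = map2 (+) u w"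
  using assms
proof induction
  case Nil
  then show ?case by simp
next
  case (Cons a u b v)
  then obtain w where "length w = length u" "v = map2 (+) u w" by blast
  then show ?case using Cons by (intro exI[of _ "(b - a) # w"]) auto
qed

section \<open>Spans and monomials\<close>

context cring
begin

lemma gspan_closed:
  assumes "P \<subseteq> carrier R" "X \<subseteq> carrier R" "y \<in> gspan R P X"
  shows "y \<in> carrier R"
  using assms(3)
proof induction
  case (add y c x)
  then have "c \<in> carrier R" "x \<in> carrier R" using assms by blast+
  then show ?case using add.IH by simp
qed simp

lemma gspan_add:
  assumes "P \<subseteq> carrier R" "X \<subseteq> carrier R" "y \<in> gspan R P X" "z \<in> gspan R P X"
  shows "y \<oplus> z \<in> gspan R P X"
  using assms(4)
proof induction
  case zero
  then show ?case using assms gspan_closed by simp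
next
  case (add z c x)
  have "y \<in> carrier R" "z \<in> carrier R" "c \<in> carrier R" "x \<in> carrier R"
    using assms add gspan_closed by blast+
  then have "y \<oplus> (z \<oplus> c \<otimes> x) = (y \<oplus> z) \<oplus> c \<otimes> x" by (simp add: a_assoc)
  then show ?case using gspan.add[OF add.IH add.hyps(2,3)] by simp
qed

lemma gspan_incl:
  assumes "P \<subseteq> carrier R" "X \<subseteq> carrier R" "c \<in> P" "x \<in> X"
  shows "c \<otimes> x \<in> gspan R P X"
proof -
  have "\<zero> \<oplus> c \<otimes> x \<in> gspan R P X" using assms by (intro gspan.intros)
  moreover have "c \<otimes> x \<in> carrier R" using assms by blast
  ultimately show ?thesis by simp
qed

lemma gspan_scale:
  assumes P: "P \<subseteq> carrier R" "X \<subseteq> carrier R" and d: "d \<in> carrier R" "\<And>c. c \<in> P \<Longrightarrow> d \<otimes> c \<in> P"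
    and "y \<in> gspan R P X"
  shows "d \<otimes> y \<in> gspan R P X"
  using assms(5)
proof induction
  case zero
  then show ?case using d gspan.zero by simp
next
  case (add y c x)
  have "y \<in> carrier R" "c \<in> carrier R" "x \<in> carrier R"
    using P add gspan_closed[OF P] by blast+
  then have "d \<otimes> (y \<oplus> c \<otimes> x) = d \<otimes> y \<oplus> (d \<otimes> c) \<otimes> x" using d by (simp add: r_distr m_assoc)
  then show ?case using gspan.add[OF add.IH d(2)[OF add.hyps(2)] add.hyps(3)] by simp
qed

lemma gspan_shift:
  assumes P: "P \<subseteq> carrier R" "X \<subseteq> carrier R" and z: "z \<in> carrier R" "\<And>x. x \<in> X \<Longrightarrow> x \<otimes> z \<in> X'"
    and "y \<in> gspan R P X"
  shows "y \<otimes> z \<in> gspan R P X'"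
  using assms(5)
proof induction
  case zero
  then show ?case using z gspan.zero by simp
next
  case (add y c x)
  have "y \<in> carrier R" "c \<in> carrier R" "x \<in> carrier R"
    using P add gspan_closed[OF P] by blast+
  then have "(y \<oplus> c \<otimes> x) \<otimes> z = y \<otimes> z \<oplus> c \<otimes> (x \<otimes> z)" using z by (simp add: l_distr m_assoc)
  then show ?case using gspan.add[OF add.IH add.hyps(2) z(2)[OF add.hyps(3)]] by simp
qed

text \<open>The substitution step of a reduction: generators are replaced by their own expressions
  in other generators.\<close>

lemma gspan_trans:
  assumes P: "P \<subseteq> carrier R" "X' \<subseteq> carrier R" and mult: "\<And>c d. c \<in> P \<Longrightarrow> d \<in> P \<Longrightarrow> c \<otimes> d \<in> P"
    and X: "\<And>x. x \<in> X \<Longrightarrow> x \<in> gspan R P X'" and "y \<in> gspan R P X"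
  shows "y \<in> gspan R P X'"
  using assms(5)
proof induction
  case zero
  then show ?case by (rule gspan.zero)
next
  case (add y c x)
  have "c \<in> carrier R" using P add.hyps(2) by blast
  then have "c \<otimes> x \<in> gspan R P X'" using mult[OF add.hyps(2)] X[OF add.hyps(3)] by (intro gspan_scale[OF P])
  with add.IH show ?case by (rule gspan_add[OF P])
qed

text \<open>For \<open>X\<close> a set of monomials the span is closed under products, so it
  contains the ring generated by coefficients and monomials once it contains these.\<close>

lemma gspan_mult:
  assumes P: "P \<subseteq> carrier R" "X \<subseteq> carrier R" and mult: "\<And>c d. c \<in> P \<Longrightarrow> d \<in> P \<Longrightarrow> c \<otimes> d \<in> P"
    and X: "\<And>x y. x \<in> X \<Longrightarrow> y \<in> X \<Longrightarrow> x \<otimes> y \<in> X" and "y \<in> gspan R P X" "z \<in> gspan R P X"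
  shows "y \<otimes> z \<in> gspan R P X"
  using assms(6)
proof induction
  case zero
  then show ?case using gspan_closed[OF P assms(5)] gspan.zero by simp
next
  case (add z c x)
  have cl: "y \<in> carrier R" "z \<in> carrier R" "c \<in> carrier R" "x \<in> carrier R"
    using P add assms(5) gspan_closed[OF P] by blast+
  then have "y \<otimes> (z \<oplus> c \<otimes> x) = y \<otimes> z \<oplus> c \<otimes> (y \<otimes> x)" by (simp add: r_distr m_ac)
  moreover have "c \<otimes> (y \<otimes> x) \<in> gspan R P X"
    using add.hyps cl by (intro gspan_scale[OF P] gspan_shift[OF P _ _ assms(5)] mult X) auto
  ultimately show ?case using gspan_add[OF P add.IH] by simp
qed

lemma gspan_finsum:
  assumes P: "P \<subseteq> carrier R" "X \<subseteq> carrier R"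
    and "finite V" "\<And>v. v \<in> V \<Longrightarrow> c v \<in> P" "\<And>v. v \<in> V \<Longrightarrow> x v \<in> X"
  shows "(\<Oplus>v\<in>V. c v \<otimes> x v) \<in> gspan R P X"
  using assms(3-5)
proof (induction V rule: finite_induct)
  case empty
  then show ?case by (simp add: gspan.zero)
next
  case (insert v V)
  have "c w \<otimes> x w \<in> carrier R" if "w \<in> insert v V" for w using P insert.prems that by blast
  then have "(\<Oplus>v\<in>insert v V. c v \<otimes> x v) = c v \<otimes> x v \<oplus> (\<Oplus>v\<in>V. c v \<otimes> x v)"
    using insert.hyps by (intro finsum_insert) auto
  then show ?case using insert.prems insert.IH by (auto intro!: gspan_add[OF P] gspan_incl[OF P])
qed

end

lemma gspan_mono: "y \<in> gspan C P X \<Longrightarrow> P \<subseteq> P' \<Longrightarrow> X \<subseteq> X' \<Longrightarrow> y \<in> gspan C P' X'"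
  by (induction rule: gspan.induct) (auto intro: gspan.intros)

text \<open>Relations are pushed forward along ring homomorphisms. Both the passage to the
  localization and the passage from one model of a new point to another are instances.\<close>

lemma gspan_hom:
  assumes "cring C" "cring D" and f: "f \<in> ring_hom C D" and P: "P \<subseteq> carrier C" "X \<subseteq> carrier C"
    and "y \<in> gspan C P X"
  shows "f y \<in> gspan D (f ` P) (f ` X)"
proof -
  interpret C: cring C by fact
  interpret D: cring D by fact
  interpret f: ring_hom_cring C D f
    using f by (simp add: ring_hom_cring_def ring_hom_cring_axioms_def C.cring_axioms D.cring_axioms)
  show ?thesis using assms(6)
  proof induction
    case zero
    then show ?case by (simp add: gspan.zero)
  next
    case (add y c x)
    have "y \<in> carrier C" "c \<in> carrier C" "x \<in> carrier C"
      using P add C.gspan_closed[OF P] by blast+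
    then have "f (y \<oplus>\<^bsub>C\<^esub> c \<otimes>\<^bsub>C\<^esub> x) = f y \<oplus>\<^bsub>D\<^esub> f c \<otimes>\<^bsub>D\<^esub> f x" by simp
    then show ?case using gspan.add[OF add.IH imageI[OF add.hyps(2)] imageI[OF add.hyps(3)]] by simp
  qed
qed

text \<open>The monomial with exponent list \<open>u\<close>. Missing exponents count as zero and
  surplus ones are ignored, so that closure holds without a condition on lengths.\<close>

fun power_prod :: "('b, 'm) ring_scheme \<Rightarrow> 'b list \<Rightarrow> nat list \<Rightarrow> 'b" where
  "power_prod C (b # bs) (k # u) = b [^]\<^bsub>C\<^esub> k \<otimes>\<^bsub>C\<^esub> power_prod C bs u"
| "power_prod C _ _ = \<one>\<^bsub>C\<^esub>"

context cring
begin

lemma power_prod_closed: "set bs \<subseteq> carrier R \<Longrightarrow> power_prod R bs u \<in> carrier R"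
proof (induction bs arbitrary: u)
  case (Cons b bs)
  then show ?case by (cases u) auto
qed simp

lemma power_prod_add:
  "set bs \<subseteq> carrier R \<Longrightarrow> length u = length bs \<Longrightarrow> length v = length bs \<Longrightarrow>
    power_prod R bs u \<otimes> power_prod R bs v = power_prod R bs (map2 (+) u v)"
proof (induction bs arbitrary: u v)
  case Nil
  then show ?case by simp
next
  case (Cons b bs)
  then obtain k u' l v' where [simp]: "u = k # u'" "v = l # v'" "length u' = length bs" "length v' = length bs"
    by (auto simp: length_Suc_conv)
  have [simp]: "b \<in> carrier R" "power_prod R bs w \<in> carrier R" for w using Cons.prems power_prod_closed by auto
  have "power_prod R (b # bs) u \<otimes> power_prod R (b # bs) v = (b [^] k \<otimes> b [^] l) \<otimes> (power_prod R bs u' \<otimes> power_prod R bs v')"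
    by (simp add: m_ac)
  then show ?case using Cons by (simp add: nat_pow_mult)
qed

lemma power_prod_zero: "set bs \<subseteq> carrier R \<Longrightarrow> power_prod R bs (replicate (length bs) 0) = \<one>"
  by (induction bs) auto

lemma power_prod_generator:
  "set bs \<subseteq> carrier R \<Longrightarrow> b \<in> set bs \<Longrightarrow> \<exists>u. length u = length bs \<and> power_prod R bs u = b"
proof (induction bs)
  case Nil
  then show ?case by simp
next
  case (Cons a bs)
  have [simp]: "a \<in> carrier R" "set bs \<subseteq> carrier R" using Cons.prems by auto
  show ?case
  proof (cases "b = a")
    case True
    then show ?thesis by (intro exI[of _ "Suc 0 # replicate (length bs) 0"]) (simp add: power_prod_zero)
  next
    case False
    then obtain u where u: "length u = length bs" "power_prod R bs u = b" using Cons by auto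
    then show ?thesis using power_prod_closed[of bs u] by (intro exI[of _ "0 # u"]) auto
  qed
qed

end

section \<open>Leading monomials\<close>

text \<open>The generators form a list because monomials are encoded by exponent lists, whose order
  depends on the order of the generators.\<close>

locale fi_gen = fi_algebra K B for K :: "('k, 'm) ring_scheme" and B :: "('k, 'b) fi_alg" +
  fixes bs :: "'b list"
  assumes bs_closed: "set bs \<subseteq> carrier A1"
    and gen: "finite S \<Longrightarrow> carrier (fobj B S) \<subseteq>
      generate_ring (fobj B S) (incl {} S ` carrier (fobj B {}) \<union> (\<Union>s\<in>S. jmap S s ` set bs))"
begin

abbreviation "n \<equiv> length bs"
definition "X U t u = jmap U t (power_prod A1 bs u)"

lemma power_prod_A1: "power_prod A1 bs u \<in> carrier A1"
  by (rule cring.power_prod_closed[OF cring_obj bs_closed]) simp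

lemma X_closed: "finite U \<Longrightarrow> t \<in> U \<Longrightarrow> X U t u \<in> carrier (fobj B U)"
  unfolding X_def by (rule ring_hom_closed[OF jmap_hom power_prod_A1])

lemma X_add:
  assumes "finite U" "t \<in> U" "length u = n" "length v = n"
  shows "X U t u \<otimes>\<^bsub>fobj B U\<^esub> X U t v = X U t (map2 (+) u v)"
  unfolding X_def ring_hom_mult[OF jmap_hom[OF assms(1,2)] power_prod_A1 power_prod_A1, symmetric]
  using cring.power_prod_add[OF cring_obj bs_closed assms(3,4)] by simp

lemma X_zero: "finite U \<Longrightarrow> t \<in> U \<Longrightarrow> X U t (replicate n 0) = \<one>\<^bsub>fobj B U\<^esub>"
  unfolding X_def using cring.power_prod_zero[OF cring_obj bs_closed] ring_hom_one[OF jmap_hom] by simp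

lemma X_map:
  "finite U \<Longrightarrow> finite V \<Longrightarrow> \<pi> \<in> fi_hom U V \<Longrightarrow> t \<in> U \<Longrightarrow> fmap B U V \<pi> (X U t u) = X V (\<pi> t) u"
  unfolding X_def by (rule jmap_map[OF _ _ _ _ power_prod_A1])

definition lower :: "nat set \<Rightarrow> nat \<Rightarrow> nat list \<Rightarrow> 'b set" where
  "lower U t u = {X U t v | v. length v = n \<and> v < u}"

lemma lower_closed: "finite U \<Longrightarrow> t \<in> U \<Longrightarrow> lower U t u \<subseteq> carrier (fobj B U)"
  unfolding lower_def using X_closed by blast

lemma lower_map:
  "finite U \<Longrightarrow> finite V \<Longrightarrow> \<pi> \<in> fi_hom U V \<Longrightarrow> t \<in> U \<Longrightarrow> fmap B U V \<pi> ` lower U t u = lower V (\<pi> t) u"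
  unfolding lower_def using X_map by (auto simp: image_def)

text \<open>Exponent lists of the fixed length \<open>n\<close> are compared lexicographically, a monomial order. By
  functoriality the relation over \<open>U = T \<squnion> {t}\<close> implies those over all other \<open>U\<close>; quantifying over
  all of them in \<open>leads\<close> avoids choosing a model of the disjoint union.\<close>

definition lead_rel :: "nat set \<Rightarrow> 'b \<Rightarrow> nat list \<Rightarrow> nat \<Rightarrow> nat set \<Rightarrow> (nat \<Rightarrow> nat) \<Rightarrow> nat \<Rightarrow> bool" where
  "lead_rel T h u k U \<pi> t \<longleftrightarrow> fmap B T U \<pi> (h [^]\<^bsub>fobj B T\<^esub> k) \<otimes>\<^bsub>fobj B U\<^esub> X U t u \<in>
     gspan (fobj B U) (fmap B T U \<pi> ` carrier (fobj B T)) (lower U t u)"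

definition leads :: "nat set \<Rightarrow> 'b \<Rightarrow> nat list set" where
  "leads T h = {u. length u = n \<and> (\<exists>k. \<forall>U \<pi> t. finite U \<longrightarrow> \<pi> \<in> fi_hom T U \<longrightarrow> t \<in> U - \<pi> ` T \<longrightarrow>
     lead_rel T h u k U \<pi> t)}"

lemma image_carrier_closed:
  "finite T \<Longrightarrow> finite U \<Longrightarrow> \<pi> \<in> fi_hom T U \<Longrightarrow> fmap B T U \<pi> ` carrier (fobj B T) \<subseteq> carrier (fobj B U)"
  using ring_hom_closed[OF map_ring_hom] by blast

text \<open>If \<open>v\<close> exceeds \<open>u\<close> by \<open>w\<close>, multiply a relation
  for \<open>u\<close> by the monomial with exponent \<open>w\<close>. Lower monomials stay lower
  because the order is additive, and the leading coefficient is unchanged.\<close>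

lemma upset_leads:
  assumes T: "finite T" and h: "h \<in> carrier (fobj B T)"
  shows "upset n (leads T h)"
  unfolding upset_def
proof (intro conjI ballI allI impI)
  fix u assume u: "u \<in> leads T h"
  then show len: "length u = n" by (simp add: leads_def)
  fix v assume "list_all2 (\<le>) u v"
  then obtain w where w: "length w = n" "v = map2 (+) u w" using list_all2_le_add len by metis
  obtain k where k: "\<And>U \<pi> t. finite U \<Longrightarrow> \<pi> \<in> fi_hom T U \<Longrightarrow> t \<in> U - \<pi> ` T \<Longrightarrow> lead_rel T h u k U \<pi> t"
    using u unfolding leads_def by blast
  have "lead_rel T h v k U \<pi> t" if a: "finite U" "\<pi> \<in> fi_hom T U" "t \<in> U - \<pi> ` T" for U \<pi> t
  proof -
    interpret T: cring "fobj B T" using T by (rule cring_obj)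
    interpret U: cring "fobj B U" using a(1) by (rule cring_obj)
    have t: "t \<in> U" using a by blast
    have hk: "fmap B T U \<pi> (h [^]\<^bsub>fobj B T\<^esub> k) \<in> carrier (fobj B U)"
      using ring_hom_closed[OF map_ring_hom[OF T a(1,2)]] h by simp
    have "(fmap B T U \<pi> (h [^]\<^bsub>fobj B T\<^esub> k) \<otimes>\<^bsub>fobj B U\<^esub> X U t u) \<otimes>\<^bsub>fobj B U\<^esub> X U t w
      \<in> gspan (fobj B U) (fmap B T U \<pi> ` carrier (fobj B T)) (lower U t v)"
    proof (rule U.gspan_shift[OF image_carrier_closed[OF T a(1,2)] lower_closed[OF a(1) t] X_closed[OF a(1) t]])
      show "fmap B T U \<pi> (h [^]\<^bsub>fobj B T\<^esub> k) \<otimes>\<^bsub>fobj B U\<^esub> X U t u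
        \<in> gspan (fobj B U) (fmap B T U \<pi> ` carrier (fobj B T)) (lower U t u)"
        using k[OF a] unfolding lead_rel_def .
      fix x assume "x \<in> lower U t u"
      then obtain u' where u': "x = X U t u'" "length u' = n" "u' < u" unfolding lower_def by blast
      have "map2 (+) u' w < v" unfolding w(2) using u'(3) by (rule list_add_less) (use u' w len in auto)
      then show "x \<otimes>\<^bsub>fobj B U\<^esub> X U t w \<in> lower U t v"
        unfolding lower_def u'(1) X_add[OF a(1) t u'(2) w(1)] using u'(2) w(1) by auto
    qed
    then show ?thesis
      unfolding lead_rel_def w(2) X_add[OF a(1) t len w(1), symmetric]
      using U.m_assoc[OF hk X_closed[OF a(1) t] X_closed[OF a(1) t]] by simp
  qed
  moreover have "length v = n" using w len by simp
  ultimately show "v \<in> leads T h" unfolding leads_def by blast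
qed

text \<open>The maximum is taken over all pairs at once, with the finite set varying along with the
  element, so that a later enlargement of the finite set is still covered by maximality.\<close>

lemma exists_maximal_leads:
  assumes "\<one>\<^bsub>fobj B {}\<^esub> \<noteq> \<zero>\<^bsub>fobj B {}\<^esub>"
  obtains S\<^sub>0 h where "finite S\<^sub>0" "h \<in> carrier (fobj B S\<^sub>0)" "h \<noteq> \<zero>\<^bsub>fobj B S\<^sub>0\<^esub>"
    "\<And>T h'. finite T \<Longrightarrow> h' \<in> carrier (fobj B T) \<Longrightarrow> h' \<noteq> \<zero>\<^bsub>fobj B T\<^esub> \<Longrightarrow>
      leads S\<^sub>0 h \<subseteq> leads T h' \<Longrightarrow> leads T h' \<subseteq> leads S\<^sub>0 h"
proof -
  let ?Q = "{leads T h | T h. finite T \<and> h \<in> carrier (fobj B T) \<and> h \<noteq> \<zero>\<^bsub>fobj B T\<^esub>}"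
  interpret C: cring "fobj B {}" by (rule cring_obj) simp
  \<comment> \<open>There is at least one admissible pair, the element one over the empty set; it is
    nonzero by assumption.\<close>
  have "leads {} \<one>\<^bsub>fobj B {}\<^esub> \<in> ?Q" using assms by blast
  then obtain Z where Z: "Z \<in> ?Q" and min: "\<forall>Y. (Y, Z) \<in> {(Y, X). upset n X \<and> upset n Y \<and> X \<subset> Y} \<longrightarrow> Y \<notin> ?Q"
    using wf_upset[of n] unfolding wf_eq_minimal by meson
  obtain S\<^sub>0 h where S: "finite S\<^sub>0" "h \<in> carrier (fobj B S\<^sub>0)" "h \<noteq> \<zero>\<^bsub>fobj B S\<^sub>0\<^esub>" "Z = leads S\<^sub>0 h" using Z by blast
  have "leads T h' \<subseteq> leads S\<^sub>0 h"
    if a: "finite T" "h' \<in> carrier (fobj B T)" "h' \<noteq> \<zero>\<^bsub>fobj B T\<^esub>" "leads S\<^sub>0 h \<subseteq> leads T h'" for T h'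
  proof (rule ccontr)
    assume "\<not> leads T h' \<subseteq> leads S\<^sub>0 h"
    then have "(leads T h', Z) \<in> {(Y, X). upset n X \<and> upset n Y \<and> X \<subset> Y}"
      using a upset_leads[OF a(1,2)] upset_leads[OF S(1,2)] S(4) by auto
    then have "leads T h' \<notin> ?Q" using min by blast
    then show False using a(1-3) by blast
  qed
  then show ?thesis using S that by metis
qed

end

section \<open>The shift localized at a maximal pair\<close>

locale fi_max = fi_gen K B bs for K :: "('k, 'm) ring_scheme" and B :: "('k, 'b) fi_alg" and bs +
  fixes S\<^sub>0 :: "nat set" and h :: 'b
  assumes fin_S0: "finite S\<^sub>0" and h_closed: "h \<in> carrier (fobj B S\<^sub>0)"
    and max: "finite T \<Longrightarrow> h' \<in> carrier (fobj B T) \<Longrightarrow> h' \<noteq> \<zero>\<^bsub>fobj B T\<^esub> \<Longrightarrow>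
      leads S\<^sub>0 h \<subseteq> leads T h' \<Longrightarrow> leads T h' \<subseteq> leads S\<^sub>0 h"
begin

abbreviation "Sh \<equiv> fi_shift S\<^sub>0 B"
abbreviation "B' \<equiv> fi_localize h Sh"
abbreviation "R \<equiv> localization_away (fobj B S\<^sub>0) h"

sublocale Sh: fi_localization "fobj B S\<^sub>0" Sh h
  by (intro fi_localization.intro fi_localization_axioms.intro fi_algebra_shift[OF fi_algebra_axioms fin_S0] h_closed)

sublocale B': fi_algebra R B'
  by (rule Sh.fi_algebra_localize)

abbreviation "SS S \<equiv> fi_sum S\<^sub>0 S"
abbreviation "CS S \<equiv> fobj B (SS S)"
definition "inl S = fmap B S\<^sub>0 (SS S) (fi_inl S\<^sub>0)"
abbreviation "hS S \<equiv> inl S h"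
abbreviation "den S \<equiv> powers (CS S) (hS S)"
text \<open>The localization map from B(S_0 + S) to B'(S). An element of its kernel is killed by a
  power of \<open>hS S\<close>, and this is how relations in B' are brought back to
  \<open>B\<close>.\<close>

definition "\<gamma> S a = fraction (CS S) (den S) a \<one>\<^bsub>CS S\<^esub>"

lemma fin_sum: "finite S \<Longrightarrow> finite (SS S)"
  using fin_S0 by simp

lemma cring_CS: "finite S \<Longrightarrow> cring (CS S)"
  by (intro cring_obj fin_sum)

lemma inl_hom: "finite S \<Longrightarrow> inl S \<in> ring_hom (fobj B S\<^sub>0) (CS S)"
  unfolding inl_def by (intro map_ring_hom fin_S0 fin_sum fi_inl_hom)

lemma hS_closed: "finite S \<Longrightarrow> hS S \<in> carrier (CS S)"
  by (rule ring_hom_closed[OF inl_hom h_closed])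

lemma Sh_unit:
  assumes S: "finite S" and c: "c \<in> carrier (fobj B S\<^sub>0)"
  shows "c \<odot>\<^bsub>fobj Sh S\<^esub> \<one>\<^bsub>fobj Sh S\<^esub> = inl S c"
proof -
  interpret C: cring "CS S" by (rule cring_CS[OF S])
  show ?thesis using ring_hom_closed[OF inl_hom[OF S] c] by (simp add: fobj_fi_shift inl_def[symmetric])
qed

text \<open>\<open>h\<close> enters the localization as a scalar multiple of one; in terms of
  \<open>B\<close> this is its image along the inclusion of the left summand.\<close>

lemma dens_eq: "finite S \<Longrightarrow> Sh.D S = den S"
  using Sh_unit[OF _ h_closed] by (simp add: loc_dens_def fobj_fi_shift)

lemma ms: "finite S \<Longrightarrow> mult_set (CS S) (den S)"
  by (intro mult_set_powers cring_CS hS_closed)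

lemma obj_B':
  assumes "finite S"
  shows "carrier (fobj B' S) = carrier (localization (CS S) (den S))"
    "monoid.mult (fobj B' S) = monoid.mult (localization (CS S) (den S))"
    "\<one>\<^bsub>fobj B' S\<^esub> = \<one>\<^bsub>localization (CS S) (den S)\<^esub>"
    "\<zero>\<^bsub>fobj B' S\<^esub> = \<zero>\<^bsub>localization (CS S) (den S)\<^esub>"
    "ring.add (fobj B' S) = ring.add (localization (CS S) (den S))"
  using dens_eq[OF assms] by (simp_all add: fobj_fi_localize fobj_fi_shift)

lemma \<gamma>_hom:
  assumes "finite S" shows "\<gamma> S \<in> ring_hom (CS S) (fobj B' S)"
proof -
  have "\<gamma> S \<in> ring_hom (CS S) (localization (CS S) (den S))"
    using mult_set.fraction_hom[OF ms[OF assms]] unfolding \<gamma>_def[abs_def] .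
  then show ?thesis unfolding ring_hom_def by (simp add: obj_B'[OF assms])
qed

lemma \<gamma>_zeroD:
  assumes "finite S" "a \<in> carrier (CS S)" "\<gamma> S a = \<zero>\<^bsub>fobj B' S\<^esub>"
  shows "\<exists>N. hS S [^]\<^bsub>CS S\<^esub> (N::nat) \<otimes>\<^bsub>CS S\<^esub> a = \<zero>\<^bsub>CS S\<^esub>"
proof -
  interpret mult_set "CS S" "den S" by (rule ms[OF assms(1)])
  show ?thesis
    using assms fraction_eq_zero_iff[OF assms(2) one_in_M] unfolding \<gamma>_def obj_B'[OF assms(1)]
    by (auto simp: powers_def)
qed

lemma unit_fraction:
  assumes S: "finite S" and c: "c \<in> carrier (fobj B S\<^sub>0)" and s: "s \<in> powers (fobj B S\<^sub>0) h"
  shows "B'.unit S (fraction (fobj B S\<^sub>0) (powers (fobj B S\<^sub>0) h) c s) = fraction (CS S) (den S) (inl S c) (inl S s)"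
proof -
  interpret K0: mult_set "fobj B S\<^sub>0" "powers (fobj B S\<^sub>0) h" by (rule Sh.mult_set_base)
  interpret C: mult_set "CS S" "den S" by (rule ms[OF S])
  have s': "s \<in> carrier (fobj B S\<^sub>0)" using s by simp
  have den: "inl S s \<in> den S"
    using powers_hom_image[OF cring_obj[OF fin_S0] cring_CS[OF S] inl_hom[OF S] h_closed] s by blast
  have cr: "K0.quo c s \<in> carrier R" using c s by (rule K0.fraction_in_L)
  have one: "\<one>\<^bsub>fobj B' S\<^esub> \<in> carrier (localization (fobj Sh S) (Sh.D S))"
    using C.cring_L by (simp add: dens_eq[OF S] fobj_fi_shift obj_B'[OF S] cring_def ring.ring_simprules)
  have "B'.unit S (K0.quo c s) = Sh.unit' S (K0.quo c s) \<otimes>\<^bsub>C.L\<^esub> \<one>\<^bsub>C.L\<^esub>"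
    using Sh.smult_localize[OF S cr one] by (simp add: dens_eq[OF S] fobj_fi_shift obj_B'[OF S])
  also have "Sh.unit' S (K0.quo c s) = C.quo (inl S c) (inl S s)"
    using Sh.unit'_fraction[OF S c s] by (simp only: Sh_unit[OF S c] Sh_unit[OF S s'] dens_eq[OF S]) (simp add: fobj_fi_shift)
  also have "C.quo (inl S c) (inl S s) \<otimes>\<^bsub>C.L\<^esub> \<one>\<^bsub>C.L\<^esub> = C.quo (inl S c) (inl S s)"
    using den ring_hom_closed[OF inl_hom[OF S] c] C.cring_L C.fraction_in_L
    by (simp add: cring_def ring.is_monoid monoid.r_one)
  finally show ?thesis .
qed

lemma R_cases:
  assumes "r \<in> carrier R"
  obtains c k where "c \<in> carrier (fobj B S\<^sub>0)"
    "r = fraction (fobj B S\<^sub>0) (powers (fobj B S\<^sub>0) h) c (h [^]\<^bsub>fobj B S\<^sub>0\<^esub> (k::nat))"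
proof -
  interpret K0: mult_set "fobj B S\<^sub>0" "powers (fobj B S\<^sub>0) h" by (rule Sh.mult_set_base)
  from assms obtain c s where "c \<in> carrier (fobj B S\<^sub>0)" "s \<in> powers (fobj B S\<^sub>0) h" "r = K0.quo c s"
    by (rule K0.L_cases)
  then show ?thesis using that unfolding powers_def by blast
qed

lemma inl_pow: "finite S \<Longrightarrow> inl S (h [^]\<^bsub>fobj B S\<^sub>0\<^esub> (k::nat)) = hS S [^]\<^bsub>CS S\<^esub> k"
proof -
  assume S: "finite S"
  interpret ring_hom_cring "fobj B S\<^sub>0" "CS S" "inl S"
    using inl_hom[OF S] cring_CS[OF S] cring_obj[OF fin_S0] by (simp add: ring_hom_cring_def ring_hom_cring_axioms_def)
  show ?thesis by (rule hom_pow[OF h_closed])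
qed

text \<open>The image of \<open>R\<close> in B'(S) under the structure map, and not the group of
  invertible elements.\<close>

definition "units S = {B'.unit S r | r. r \<in> carrier R}"

lemma units_eq: "units S = B'.unit S ` carrier R"
  unfolding units_def by blast

lemma units_closed: "finite S \<Longrightarrow> units S \<subseteq> carrier (fobj B' S)"
  unfolding units_eq using ring_hom_closed[OF B'.unit_hom] by blast

lemma units_mult: "finite S \<Longrightarrow> x \<in> units S \<Longrightarrow> y \<in> units S \<Longrightarrow> x \<otimes>\<^bsub>fobj B' S\<^esub> y \<in> units S"
proof -
  assume S: "finite S" and "x \<in> units S" "y \<in> units S"
  then obtain r q where r: "r \<in> carrier R" "x = B'.unit S r" and q: "q \<in> carrier R" "y = B'.unit S q"
    unfolding units_eq by blast
  interpret R: cring R by (rule B'.cring_base)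
  have "r \<otimes>\<^bsub>R\<^esub> q \<in> carrier R" using r q by simp
  then show ?thesis unfolding r(2) q(2) ring_hom_mult[OF B'.unit_hom[OF S] r(1) q(1), symmetric] units_eq by blast
qed

lemma \<gamma>_inl_units: "finite S \<Longrightarrow> c \<in> carrier (fobj B S\<^sub>0) \<Longrightarrow> \<gamma> S (inl S c) \<in> units S"
proof -
  assume S: "finite S" and c: "c \<in> carrier (fobj B S\<^sub>0)"
  interpret K0: mult_set "fobj B S\<^sub>0" "powers (fobj B S\<^sub>0) h" by (rule Sh.mult_set_base)
  have "\<gamma> S (inl S c) = B'.unit S (K0.quo c \<one>\<^bsub>fobj B S\<^sub>0\<^esub>)"
    unfolding unit_fraction[OF S c K0.one_in_M] \<gamma>_def ring_hom_one[OF inl_hom[OF S]] ..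
  then show ?thesis unfolding units_eq using K0.fraction_in_L[OF c K0.one_in_M] by blast
qed

text \<open>The inverse is the fraction with numerator one and denominator \<open>h^k\<close>, taken
  already in \<open>R\<close>. It is therefore a scalar, and spans over the image of
  \<open>R\<close> are stable under dividing by \<open>h\<close>.\<close>

lemma units_inverse:
  assumes S: "finite S"
  shows "\<exists>r\<in>units S. r \<otimes>\<^bsub>fobj B' S\<^esub> \<gamma> S (hS S [^]\<^bsub>CS S\<^esub> (k::nat)) = \<one>\<^bsub>fobj B' S\<^esub>"
proof -
  interpret K0: mult_set "fobj B S\<^sub>0" "powers (fobj B S\<^sub>0) h" by (rule Sh.mult_set_base)
  interpret C: mult_set "CS S" "den S" by (rule ms[OF S])
  have hk: "h [^]\<^bsub>fobj B S\<^sub>0\<^esub> k \<in> powers (fobj B S\<^sub>0) h" unfolding powers_def by blast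
  have dk: "hS S [^]\<^bsub>CS S\<^esub> k \<in> den S" unfolding powers_def by blast
  let ?r = "B'.unit S (K0.quo \<one>\<^bsub>fobj B S\<^sub>0\<^esub> (h [^]\<^bsub>fobj B S\<^sub>0\<^esub> k))"
  have r: "?r = C.quo \<one>\<^bsub>CS S\<^esub> (hS S [^]\<^bsub>CS S\<^esub> k)"
    unfolding unit_fraction[OF S K0.one_closed hk] ring_hom_one[OF inl_hom[OF S]] inl_pow[OF S] ..
  have "?r \<otimes>\<^bsub>C.L\<^esub> C.quo (hS S [^]\<^bsub>CS S\<^esub> k) \<one>\<^bsub>CS S\<^esub> = \<one>\<^bsub>C.L\<^esub>"
    unfolding r using dk C.fraction_self[OF dk] by (simp add: C.L_mult)
  then have "?r \<otimes>\<^bsub>fobj B' S\<^esub> \<gamma> S (hS S [^]\<^bsub>CS S\<^esub> k) = \<one>\<^bsub>fobj B' S\<^esub>"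
    unfolding \<gamma>_def obj_B'[OF S] .
  moreover have "?r \<in> units S" unfolding units_eq using K0.fraction_in_L[OF K0.one_closed hk] by blast
  ultimately show ?thesis by blast
qed

lemma B'_cases:
  assumes S: "finite S" and y: "y \<in> carrier (fobj B' S)"
  obtains a k where "a \<in> carrier (CS S)" "y = fraction (CS S) (den S) a (hS S [^]\<^bsub>CS S\<^esub> (k::nat))"
    "y \<otimes>\<^bsub>fobj B' S\<^esub> \<gamma> S (hS S [^]\<^bsub>CS S\<^esub> k) = \<gamma> S a"
proof -
  interpret C: mult_set "CS S" "den S" by (rule ms[OF S])
  obtain a s where a: "a \<in> carrier (CS S)" "s \<in> den S" "y = C.quo a s"
    using y unfolding obj_B'[OF S] by (elim C.L_cases)
  then obtain k where k: "s = hS S [^]\<^bsub>CS S\<^esub> (k::nat)" unfolding powers_def by blast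
  have "C.quo a s \<otimes>\<^bsub>C.L\<^esub> C.quo s \<one>\<^bsub>CS S\<^esub> = C.quo a \<one>\<^bsub>CS S\<^esub>"
    using a by (simp add: C.L_mult) (rule C.fraction_eqI1; simp)
  then show ?thesis using that[OF a(1), of k] a(3) unfolding k \<gamma>_def obj_B'[OF S] by blast
qed

text \<open>Every denominator is a scalar from \<open>R\<close>. Generation and spanning of B'(S)
  over \<open>R\<close> thus follow from the corresponding facts about B(S_0 + S).\<close>

lemma B'_decompose:
  assumes S: "finite S" and y: "y \<in> carrier (fobj B' S)"
  obtains a r where "a \<in> carrier (CS S)" "r \<in> units S" "y = r \<otimes>\<^bsub>fobj B' S\<^esub> \<gamma> S a"
proof -
  interpret B: cring "fobj B' S" by (rule B'.cring_obj[OF S])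
  interpret C: cring "CS S" by (rule cring_CS[OF S])
  obtain a k where a: "a \<in> carrier (CS S)" "y \<otimes>\<^bsub>fobj B' S\<^esub> \<gamma> S (hS S [^]\<^bsub>CS S\<^esub> (k::nat)) = \<gamma> S a"
    using S y by (rule B'_cases)
  obtain r where r: "r \<in> units S" "r \<otimes>\<^bsub>fobj B' S\<^esub> \<gamma> S (hS S [^]\<^bsub>CS S\<^esub> k) = \<one>\<^bsub>fobj B' S\<^esub>"
    using units_inverse[OF S] by blast
  have rc: "r \<in> carrier (fobj B' S)" using r units_closed[OF S] by blast
  have gc: "\<gamma> S (hS S [^]\<^bsub>CS S\<^esub> k) \<in> carrier (fobj B' S)"
    using hS_closed[OF S] by (intro ring_hom_closed[OF \<gamma>_hom[OF S]]) simp
  have "r \<otimes>\<^bsub>fobj B' S\<^esub> \<gamma> S a = (r \<otimes>\<^bsub>fobj B' S\<^esub> \<gamma> S (hS S [^]\<^bsub>CS S\<^esub> k)) \<otimes>\<^bsub>fobj B' S\<^esub> y"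
    unfolding a(2)[symmetric] using rc gc y by (simp add: B.m_ac)
  then have "y = r \<otimes>\<^bsub>fobj B' S\<^esub> \<gamma> S a" using r(2) y by simp
  then show ?thesis using that a(1) r(1) by blast
qed

lemma map_quo:
  assumes S: "finite S" and T: "finite T" and pi: "\<pi> \<in> fi_hom S T" and a: "a \<in> carrier (CS S)"
  shows "fmap B' S T \<pi> (fraction (CS S) (den S) a (hS S [^]\<^bsub>CS S\<^esub> (k::nat))) =
    fraction (CS T) (den T) (fmap B (SS S) (SS T) (fi_sum_map S\<^sub>0 S \<pi>) a) (hS T [^]\<^bsub>CS T\<^esub> k)"
proof -
  have hom: "fmap B (SS S) (SS T) (fi_sum_map S\<^sub>0 S \<pi>) \<in> ring_hom (CS S) (CS T)"
    by (intro map_ring_hom fin_sum S T fi_sum_map_hom pi)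
  have h: "fmap B (SS S) (SS T) (fi_sum_map S\<^sub>0 S \<pi>) (hS S) = hS T"
    using map_comp[OF fin_S0 fin_sum[OF S] fin_sum[OF T] fi_inl_hom fi_sum_map_hom[OF pi] h_closed]
    unfolding inl_def fi_sum_map_inl by simp
  interpret f: ring_hom_cring "CS S" "CS T" "fmap B (SS S) (SS T) (fi_sum_map S\<^sub>0 S \<pi>)"
    using hom cring_CS[OF S] cring_CS[OF T] by (simp add: ring_hom_cring_def ring_hom_cring_axioms_def)
  have pow: "fmap B (SS S) (SS T) (fi_sum_map S\<^sub>0 S \<pi>) (hS S [^]\<^bsub>CS S\<^esub> k) = hS T [^]\<^bsub>CS T\<^esub> k"
    using f.hom_pow[OF hS_closed[OF S]] h by simp
  have "hS S [^]\<^bsub>CS S\<^esub> k \<in> Sh.D S" unfolding dens_eq[OF S] powers_def by blast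
  then show ?thesis
    using Sh.map_fraction[OF S T pi, of a "hS S [^]\<^bsub>CS S\<^esub> k"] a pow
    by (simp add: dens_eq[OF S] dens_eq[OF T] fobj_fi_shift fmap_fi_shift)
qed

lemma map_\<gamma>:
  assumes S: "finite S" and T: "finite T" and pi: "\<pi> \<in> fi_hom S T" and a: "a \<in> carrier (CS S)"
  shows "fmap B' S T \<pi> (\<gamma> S a) = \<gamma> T (fmap B (SS S) (SS T) (fi_sum_map S\<^sub>0 S \<pi>) a)"
  using map_quo[OF assms, of 0] unfolding \<gamma>_def by simp

end

context fi_max
begin

text \<open>If a scalar \<open>c / h^k\<close> vanishes in B'({}), some power of \<open>h\<close>
  kills the image of \<open>c\<close> in B(S_0 + {}). Niceness makes the map from
  \<open>fobj B S\<^sub>0\<close> injective, so the same power of \<open>h\<close> kills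
  \<open>c\<close> itself, and the fraction is already zero in \<open>R\<close>.\<close>

lemma zero_B':
  assumes nice: "fi_nice B" and r: "r \<in> carrier R" and r0: "B'.unit {} r = \<zero>\<^bsub>fobj B' {}\<^esub>"
  shows "r = \<zero>\<^bsub>R\<^esub>"
proof -
  interpret K0: mult_set "fobj B S\<^sub>0" "powers (fobj B S\<^sub>0) h" by (rule Sh.mult_set_base)
  interpret C: mult_set "CS {}" "den {}" by (rule ms) simp
  interpret inl: ring_hom_cring "fobj B S\<^sub>0" "CS {}" "inl {}"
    using inl_hom[of "{}"] cring_CS[of "{}"] cring_obj[OF fin_S0] by (simp add: ring_hom_cring_def ring_hom_cring_axioms_def)
  obtain c k where c: "c \<in> carrier (fobj B S\<^sub>0)" "r = K0.quo c (h [^]\<^bsub>fobj B S\<^sub>0\<^esub> (k::nat))"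
    using r by (rule R_cases)
  have hk: "h [^]\<^bsub>fobj B S\<^sub>0\<^esub> m \<in> powers (fobj B S\<^sub>0) h" for m :: nat unfolding powers_def by blast
  have dk: "hS {} [^]\<^bsub>CS {}\<^esub> m \<in> den {}" for m :: nat unfolding powers_def by blast
  have "B'.unit {} r = C.quo (inl {} c) (inl {} (h [^]\<^bsub>fobj B S\<^sub>0\<^esub> k))"
    unfolding c(2) by (rule unit_fraction[OF finite.emptyI c(1) hk])
  then have "C.quo (inl {} c) (hS {} [^]\<^bsub>CS {}\<^esub> k) = \<zero>\<^bsub>C.L\<^esub>"
    using r0 obj_B'(4)[OF finite.emptyI] inl_pow[OF finite.emptyI] by simp
  then obtain u where "u \<in> den {}" and u: "u \<otimes>\<^bsub>CS {}\<^esub> inl {} c = \<zero>\<^bsub>CS {}\<^esub>"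
    using C.fraction_eq_zero_iff[OF inl.hom_closed[OF c(1)] dk] by blast
  then obtain m where m: "u = inl {} (h [^]\<^bsub>fobj B S\<^sub>0\<^esub> (m::nat))"
    unfolding powers_def inl_pow[OF finite.emptyI] by blast
  have hm: "h [^]\<^bsub>fobj B S\<^sub>0\<^esub> m \<in> carrier (fobj B S\<^sub>0)" using h_closed by simp
  have eq: "inl {} (h [^]\<^bsub>fobj B S\<^sub>0\<^esub> m \<otimes>\<^bsub>fobj B S\<^sub>0\<^esub> c) = inl {} \<zero>\<^bsub>fobj B S\<^sub>0\<^esub>"
    using u unfolding m inl.hom_mult[OF hm c(1)] inl.hom_zero .
  have inj: "inj_on (inl {}) (carrier (fobj B S\<^sub>0))"
    using nice fin_S0 fin_sum[of "{}"] fi_inl_hom[of S\<^sub>0 "{}"] unfolding fi_nice_def inl_def by blast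
  have "h [^]\<^bsub>fobj B S\<^sub>0\<^esub> m \<otimes>\<^bsub>fobj B S\<^sub>0\<^esub> c = \<zero>\<^bsub>fobj B S\<^sub>0\<^esub>"
    by (rule inj_onD[OF inj eq]) (intro K0.m_closed hm c(1) K0.zero_closed)+
  then show ?thesis using K0.fraction_eq_zero_iff[OF c(1) hk] hk unfolding c(2) by blast
qed

section \<open>The added point and the generators of B'(S)\<close>

abbreviation "t\<^sub>1 \<equiv> enr (1::nat)"

lemma t1_mem: "t\<^sub>1 \<in> SS one_pt"
  by (auto simp: fi_sum_eq one_pt_def)

lemma enr_mem: "s \<in> S \<Longrightarrow> enr s \<in> SS S"
  by (auto simp: fi_sum_eq)

definition "e u = \<gamma> one_pt (X (SS one_pt) t\<^sub>1 u)"

lemma e_closed: "e u \<in> carrier (fobj B' one_pt)"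
  unfolding e_def by (intro ring_hom_closed[OF \<gamma>_hom] X_closed fin_sum t1_mem) auto

lemma jmap_\<gamma>:
  assumes S: "finite S" "s \<in> S" and x: "x \<in> carrier A1"
  shows "B'.jmap S s (\<gamma> one_pt (jmap (SS one_pt) t\<^sub>1 x)) = \<gamma> S (jmap (SS S) (enr s) x)"
proof -
  have x': "jmap (SS one_pt) t\<^sub>1 x \<in> carrier (CS one_pt)"
    using ring_hom_closed[OF jmap_hom[OF fin_sum[OF finite_one_pt] t1_mem] x] .
  have "fi_sum_map S\<^sub>0 one_pt (pt s) t\<^sub>1 = enr s"
    by (subst fi_sum_map_simps) (simp_all add: one_pt_def)
  then show ?thesis
    unfolding B'.jmap_def
    using map_\<gamma>[OF finite_one_pt S(1) pt_hom[OF S(2)] x']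
      jmap_map[OF fin_sum[OF finite_one_pt] fin_sum[OF S(1)] fi_sum_map_hom[OF pt_hom[OF S(2)]] t1_mem x]
    by simp
qed

lemma jmap_e: "finite S \<Longrightarrow> s \<in> S \<Longrightarrow> B'.jmap S s (e u) = \<gamma> S (X (SS S) (enr s) u)"
  unfolding e_def X_def by (rule jmap_\<gamma>[OF _ _ power_prod_A1])

text \<open>\<open>SS S\<close> consists of the image of \<open>S\<^sub>0\<close>, whose coordinates are scalars, and of the points of \<open>S\<close>.\<close>

lemma gen_CS:
  assumes S: "finite S"
  shows "carrier (CS S) \<subseteq> generate_ring (CS S)
    (inl S ` carrier (fobj B S\<^sub>0) \<union> (\<Union>s\<in>S. jmap (SS S) (enr s) ` set bs))"
proof -
  interpret C: cring "CS S" by (rule cring_CS[OF S])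
  have sub: "incl {} (SS S) ` carrier (fobj B {}) \<union> (\<Union>s\<in>SS S. jmap (SS S) s ` set bs) \<subseteq>
      inl S ` carrier (fobj B S\<^sub>0) \<union> (\<Union>s\<in>S. jmap (SS S) (enr s) ` set bs)"
  proof (intro Un_least subsetI)
    fix x assume "x \<in> incl {} (SS S) ` carrier (fobj B {})"
    then obtain c where c: "c \<in> carrier (fobj B {})" "x = incl {} (SS S) c" by blast
    have 1: "(\<lambda>i\<in>{}. i) \<in> fi_hom {} S\<^sub>0" by (rule fi_hom_subset) simp
    have "compose {} (fi_inl S\<^sub>0) (\<lambda>i\<in>{}. i) = (\<lambda>i\<in>{}. i)" by (rule ext) (simp add: compose_def)
    then have "x = inl S (incl {} S\<^sub>0 c)"
      using map_comp[OF finite.emptyI fin_S0 fin_sum[OF S] 1 fi_inl_hom c(1)] unfolding c(2) incl_def inl_def by simp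
    moreover have "incl {} S\<^sub>0 c \<in> carrier (fobj B S\<^sub>0)"
      using ring_hom_closed[OF incl_hom[OF finite.emptyI fin_S0 empty_subsetI] c(1)] .
    ultimately show "x \<in> inl S ` carrier (fobj B S\<^sub>0) \<union> (\<Union>s\<in>S. jmap (SS S) (enr s) ` set bs)" by blast
  next
    fix x assume "x \<in> (\<Union>s\<in>SS S. jmap (SS S) s ` set bs)"
    then obtain t b where t: "t \<in> SS S" "b \<in> set bs" "x = jmap (SS S) t b" by blast
    then consider s where "s \<in> S\<^sub>0" "t = enl s" | s where "s \<in> S" "t = enr s" unfolding fi_sum_eq by blast
    then show "x \<in> inl S ` carrier (fobj B S\<^sub>0) \<union> (\<Union>s\<in>S. jmap (SS S) (enr s) ` set bs)"
    proof cases
      case 1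
      have b: "b \<in> carrier A1" using t(2) bs_closed by blast
      have "fi_inl S\<^sub>0 s = t" using 1 by (simp add: fi_inl_def)
      then have "x = inl S (jmap S\<^sub>0 s b)"
        using jmap_map[OF fin_S0 fin_sum[OF S] fi_inl_hom 1(1) b] unfolding t(3) inl_def by simp
      then show ?thesis using ring_hom_closed[OF jmap_hom[OF fin_S0 1(1)] b] by blast
    next
      case 2
      then show ?thesis using t by blast
    qed
  qed
  have mono: "generate_ring (CS S) H \<subseteq> generate_ring (CS S) H'" if "H \<subseteq> H'" for H H'
  proof
    fix x assume "x \<in> generate_ring (CS S) H"
    then show "x \<in> generate_ring (CS S) H'"
      by induction (use that in \<open>auto intro: generate_ring.intros\<close>)
  qed
  show ?thesis using gen[OF fin_sum[OF S]] mono[OF sub] by blast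
qed

text \<open>After splitting off a scalar denominator only the image of B(S_0 + S) is left. Its
  generators go to scalars or, at a point \<open>s\<close>, to images of elements of B'([1]) under
  \<open>B'.jmap S s\<close>.\<close>

lemma gen_B':
  assumes S: "finite S"
  shows "carrier (fobj B' S) \<subseteq>
    generate_ring (fobj B' S) (B'.unit S ` carrier R \<union> (\<Union>s\<in>S. B'.jmap S s ` carrier (fobj B' one_pt)))"
    (is "_ \<subseteq> generate_ring _ ?H")
proof
  interpret C: cring "CS S" by (rule cring_CS[OF S])
  interpret B: cring "fobj B' S" by (rule B'.cring_obj[OF S])
  interpret g: ring_hom_cring "CS S" "fobj B' S" "\<gamma> S"
    using \<gamma>_hom[OF S] by (simp add: ring_hom_cring_def ring_hom_cring_axioms_def C.cring_axioms B.cring_axioms)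
  have Hc: "inl S ` carrier (fobj B S\<^sub>0) \<union> (\<Union>s\<in>S. jmap (SS S) (enr s) ` set bs) \<subseteq> carrier (CS S)"
    using ring_hom_closed[OF inl_hom[OF S]] ring_hom_closed[OF jmap_hom[OF fin_sum[OF S] enr_mem]] bs_closed by blast
  have g: "\<gamma> S a \<in> generate_ring (fobj B' S) ?H"
    if "a \<in> generate_ring (CS S) (inl S ` carrier (fobj B S\<^sub>0) \<union> (\<Union>s\<in>S. jmap (SS S) (enr s) ` set bs))" for a
    using that
  proof induction
    case one
    show ?case using g.hom_one generate_ring.one by metis
  next
    case (incl a)
    then consider c where "c \<in> carrier (fobj B S\<^sub>0)" "a = inl S c" | s b where "s \<in> S" "b \<in> set bs" "a = jmap (SS S) (enr s) b"
      by blast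
    then show ?case
    proof cases
      case 1
      then have "\<gamma> S a \<in> ?H" using \<gamma>_inl_units[OF S] unfolding units_eq by blast
      then show ?thesis by (rule generate_ring.incl)
    next
      case 2
      have b: "b \<in> carrier A1" using 2 bs_closed by blast
      have "\<gamma> one_pt (jmap (SS one_pt) t\<^sub>1 b) \<in> carrier (fobj B' one_pt)"
        by (rule ring_hom_closed[OF \<gamma>_hom[OF finite_one_pt] ring_hom_closed[OF jmap_hom[OF fin_sum[OF finite_one_pt] t1_mem] b]])
      then have "\<gamma> S a \<in> ?H" unfolding 2(3) jmap_\<gamma>[OF S 2(1) b, symmetric] using 2(1) by blast
      then show ?thesis by (rule generate_ring.incl)
    qed
  next
    case (a_inv a)
    have "a \<in> carrier (CS S)" by (rule C.generate_ring_in_carrier[OF Hc a_inv.hyps])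
    then have "\<gamma> S (\<ominus>\<^bsub>CS S\<^esub> a) = \<ominus>\<^bsub>fobj B' S\<^esub> \<gamma> S a" by (rule g.hom_a_inv)
    then show ?case using generate_ring.a_inv[OF a_inv.IH] by simp
  next
    case (eng_add a b)
    have "a \<in> carrier (CS S)" "b \<in> carrier (CS S)" using C.generate_ring_in_carrier[OF Hc] eng_add.hyps by blast+
    then have "\<gamma> S (a \<oplus>\<^bsub>CS S\<^esub> b) = \<gamma> S a \<oplus>\<^bsub>fobj B' S\<^esub> \<gamma> S b" by (rule g.hom_add)
    then show ?case using generate_ring.eng_add[OF eng_add.IH] by simp
  next
    case (eng_mult a b)
    have "a \<in> carrier (CS S)" "b \<in> carrier (CS S)" using C.generate_ring_in_carrier[OF Hc] eng_mult.hyps by blast+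
    then have "\<gamma> S (a \<otimes>\<^bsub>CS S\<^esub> b) = \<gamma> S a \<otimes>\<^bsub>fobj B' S\<^esub> \<gamma> S b" by (rule g.hom_mult)
    then show ?case using generate_ring.eng_mult[OF eng_mult.IH] by simp
  qed
  fix y assume "y \<in> carrier (fobj B' S)"
  then obtain a r where ar: "a \<in> carrier (CS S)" "r \<in> units S" "y = r \<otimes>\<^bsub>fobj B' S\<^esub> \<gamma> S a"
    using B'_decompose[OF S] by metis
  have "r \<in> ?H" using ar(2) unfolding units_eq by blast
  then have "r \<in> generate_ring (fobj B' S) ?H" by (rule generate_ring.incl)
  moreover have "\<gamma> S a \<in> generate_ring (fobj B' S) ?H" using ar(1) gen_CS[OF S] g by blast
  ultimately show "y \<in> generate_ring (fobj B' S) ?H" unfolding ar(3) by (rule generate_ring.eng_mult)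
qed

text \<open>The standard monomials, in the language of Groebner bases: those that are not leading
  monomials of a relation over the coefficients at hand.\<close>

definition "E = e ` {u. length u = n \<and> u \<notin> leads S\<^sub>0 h}"

lemma E_closed: "E \<subseteq> carrier (fobj B' one_pt)"
  unfolding E_def by (rule image_subsetI) (rule e_closed)

lemma units_one:
  assumes S: "finite S" shows "\<one>\<^bsub>fobj B' S\<^esub> \<in> units S"
proof -
  interpret R: cring R by (rule B'.cring_base)
  have 1: "B'.unit S \<one>\<^bsub>R\<^esub> = \<one>\<^bsub>fobj B' S\<^esub>" by (rule ring_hom_one[OF B'.unit_hom[OF S]])
  show ?thesis unfolding units_eq using imageI[OF R.one_closed, of "B'.unit S"] unfolding 1 .
qed

text \<open>Division with remainder, as induction along the well-order of exponents. If
  \<open>u\<close> is a leading exponent, \<open>h^k\<close> times its monomial is a combination of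
  lower ones with coefficients from \<open>fobj B S\<^sub>0\<close>; in B' the factor
  \<open>h^k\<close> is inverted by a scalar.\<close>

lemma e_span:
  assumes "length u = n"
  shows "e u \<in> gspan (fobj B' one_pt) (units one_pt) E"
  using assms
proof (induction u rule: less_induct)
  case (less u)
  let ?B = "fobj B' one_pt" and ?U = "SS one_pt"
  interpret B: cring ?B by (rule B'.cring_obj) simp
  interpret C: cring "CS one_pt" by (rule cring_CS) simp
  have un: "units one_pt \<subseteq> carrier ?B" by (rule units_closed) simp
  note P = un E_closed
  show ?case
  proof (cases "u \<in> leads S\<^sub>0 h")
    case False
    then have "e u \<in> E" unfolding E_def using less.prems by blast
    then have "\<one>\<^bsub>?B\<^esub> \<otimes>\<^bsub>?B\<^esub> e u \<in> gspan ?B (units one_pt) E" using units_one by (intro B.gspan_incl[OF P]) auto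
    then show ?thesis using e_closed by simp
  next
    case True
    then obtain k where "\<And>U \<pi> t. finite U \<Longrightarrow> \<pi> \<in> fi_hom S\<^sub>0 U \<Longrightarrow> t \<in> U - \<pi> ` S\<^sub>0 \<Longrightarrow> lead_rel S\<^sub>0 h u k U \<pi> t"
      unfolding leads_def by blast
    \<comment> \<open>The relation is specialised to the shift: the injection is the inclusion of
      the left summand and the new point is the right one.\<close>
    moreover have "t\<^sub>1 \<in> ?U - fi_inl S\<^sub>0 ` S\<^sub>0" using t1_mem by (auto simp: fi_inl_def)
    ultimately have "lead_rel S\<^sub>0 h u k ?U (fi_inl S\<^sub>0) t\<^sub>1"
      using fin_sum[OF finite_one_pt] fi_inl_hom by blast
    then have *: "inl one_pt (h [^]\<^bsub>fobj B S\<^sub>0\<^esub> k) \<otimes>\<^bsub>CS one_pt\<^esub> X ?U t\<^sub>1 u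
        \<in> gspan (CS one_pt) (inl one_pt ` carrier (fobj B S\<^sub>0)) (lower ?U t\<^sub>1 u)"
      unfolding lead_rel_def inl_def .
    have Xc: "X ?U t\<^sub>1 u \<in> carrier (CS one_pt)" by (intro X_closed fin_sum t1_mem) simp
    have hc: "hS one_pt [^]\<^bsub>CS one_pt\<^esub> k \<in> carrier (CS one_pt)" using hS_closed[OF finite_one_pt] by simp
    have "\<gamma> one_pt (hS one_pt [^]\<^bsub>CS one_pt\<^esub> k \<otimes>\<^bsub>CS one_pt\<^esub> X ?U t\<^sub>1 u)
        \<in> gspan ?B (\<gamma> one_pt ` inl one_pt ` carrier (fobj B S\<^sub>0)) (\<gamma> one_pt ` lower ?U t\<^sub>1 u)"
      using * ring_hom_closed[OF inl_hom[OF finite_one_pt]] lower_closed[OF fin_sum[OF finite_one_pt] t1_mem]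
      unfolding inl_pow[OF finite_one_pt]
      by (intro gspan_hom[OF C.cring_axioms B.cring_axioms \<gamma>_hom[OF finite_one_pt]]) auto
    then have "\<gamma> one_pt (hS one_pt [^]\<^bsub>CS one_pt\<^esub> k) \<otimes>\<^bsub>?B\<^esub> e u
        \<in> gspan ?B (units one_pt) (\<gamma> one_pt ` lower ?U t\<^sub>1 u)"
      unfolding ring_hom_mult[OF \<gamma>_hom[OF finite_one_pt] hc Xc] e_def[symmetric]
      by (rule gspan_mono) (auto intro: \<gamma>_inl_units)
    then have 1: "\<gamma> one_pt (hS one_pt [^]\<^bsub>CS one_pt\<^esub> k) \<otimes>\<^bsub>?B\<^esub> e u \<in> gspan ?B (units one_pt) E"
    proof (rule B.gspan_trans[OF P units_mult[OF finite_one_pt], rotated -1])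
      fix x assume "x \<in> \<gamma> one_pt ` lower ?U t\<^sub>1 u"
      then obtain v where "length v = n" "v < u" "x = e v" unfolding lower_def e_def by blast
      then show "x \<in> gspan ?B (units one_pt) E" using less.IH by simp
    qed
    obtain r where r: "r \<in> units one_pt" "r \<otimes>\<^bsub>?B\<^esub> \<gamma> one_pt (hS one_pt [^]\<^bsub>CS one_pt\<^esub> k) = \<one>\<^bsub>?B\<^esub>"
      using units_inverse[OF finite_one_pt] by blast
    have rc: "r \<in> carrier ?B" using r un by blast
    have "r \<otimes>\<^bsub>?B\<^esub> (\<gamma> one_pt (hS one_pt [^]\<^bsub>CS one_pt\<^esub> k) \<otimes>\<^bsub>?B\<^esub> e u) \<in> gspan ?B (units one_pt) E"
      by (rule B.gspan_scale[OF P rc units_mult[OF finite_one_pt r(1)] 1])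
    moreover have "r \<otimes>\<^bsub>?B\<^esub> (\<gamma> one_pt (hS one_pt [^]\<^bsub>CS one_pt\<^esub> k) \<otimes>\<^bsub>?B\<^esub> e u) = e u"
      using B.m_assoc[OF rc ring_hom_closed[OF \<gamma>_hom[OF finite_one_pt] hc] e_closed] r(2) e_closed by simp
    ultimately show ?thesis by simp
  qed
qed

text \<open>Monomials contain one and are closed under products, so their span over the image of
  \<open>fobj B S\<^sub>0\<close> is a subring, and it contains all generators from
  \<open>gen_CS\<close>.\<close>

lemma CS_span: "carrier (CS one_pt) \<subseteq>
  gspan (CS one_pt) (inl one_pt ` carrier (fobj B S\<^sub>0)) {X (SS one_pt) t\<^sub>1 u | u. length u = n}"
  (is "_ \<subseteq> gspan ?C ?P ?X")
proof
  let ?U = "SS one_pt"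
  interpret C: cring ?C by (rule cring_CS) simp
  interpret B0: cring "fobj B S\<^sub>0" by (rule cring_obj[OF fin_S0])
  interpret i: ring_hom_cring "fobj B S\<^sub>0" ?C "inl one_pt"
    using inl_hom[OF finite_one_pt] by (simp add: ring_hom_cring_def ring_hom_cring_axioms_def C.cring_axioms B0.cring_axioms)
  have fU: "finite ?U" by (rule fin_sum) simp
  have "?P \<subseteq> carrier ?C" by (rule image_subsetI) (rule i.hom_closed)
  moreover have "?X \<subseteq> carrier ?C" using X_closed[OF fU t1_mem] by blast
  ultimately have P: "?P \<subseteq> carrier ?C" "?X \<subseteq> carrier ?C" .
  have Pm: "c \<otimes>\<^bsub>?C\<^esub> d \<in> ?P" if cd: "c \<in> ?P" "d \<in> ?P" for c d
  proof -
    obtain c' where c: "c = inl one_pt c'" "c' \<in> carrier (fobj B S\<^sub>0)" using cd(1) by (rule imageE)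
    obtain d' where d: "d = inl one_pt d'" "d' \<in> carrier (fobj B S\<^sub>0)" using cd(2) by (rule imageE)
    show ?thesis unfolding c(1) d(1) i.hom_mult[OF c(2) d(2), symmetric] by (intro imageI B0.m_closed c d)
  qed
  have Xm: "x \<otimes>\<^bsub>?C\<^esub> y \<in> ?X" if xy: "x \<in> ?X" "y \<in> ?X" for x y
  proof -
    obtain u v where uv: "length u = n" "x = X ?U t\<^sub>1 u" "length v = n" "y = X ?U t\<^sub>1 v" using xy by blast
    have "length (map2 (+) u v) = n" using uv by simp
    then show ?thesis unfolding uv(2,4) X_add[OF fU t1_mem uv(1,3)] by blast
  qed
  have one: "inl one_pt \<one>\<^bsub>fobj B S\<^sub>0\<^esub> \<in> ?P" "inl one_pt (\<ominus>\<^bsub>fobj B S\<^sub>0\<^esub> \<one>\<^bsub>fobj B S\<^sub>0\<^esub>) \<in> ?P"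
    by (intro imageI; simp)+
  have X1: "\<one>\<^bsub>?C\<^esub> \<in> ?X" using X_zero[OF fU t1_mem] by (metis (mono_tags, lifting) length_replicate mem_Collect_eq)
  have PX: "c \<in> gspan ?C ?P ?X" if c: "c \<in> ?P" for c
    using C.gspan_incl[OF P c X1] P(1) c by (simp add: subset_iff)
  have XX: "x \<in> gspan ?C ?P ?X" if x: "x \<in> ?X" for x
    using C.gspan_incl[OF P one(1) x] P(2) x by (simp add: subset_iff)
  fix a assume "a \<in> carrier ?C"
  then have "a \<in> generate_ring ?C (?P \<union> (\<Union>s\<in>one_pt. jmap ?U (enr s) ` set bs))"
    by (rule subsetD[OF gen_CS[OF finite_one_pt]])
  then show "a \<in> gspan ?C ?P ?X"
  proof induction
    case one
    show ?case by (rule XX[OF X1])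
  next
    case (incl a)
    then consider "a \<in> ?P" | b where "b \<in> set bs" "a = jmap ?U t\<^sub>1 b" by (auto simp: one_pt_def)
    then show ?case
    proof cases
      case 1
      then show ?thesis by (rule PX)
    next
      case 2
      obtain u where "length u = n" "power_prod A1 bs u = b"
        using cring.power_prod_generator[OF cring_obj[OF finite_one_pt] bs_closed 2(1)] by blast
      then have "a \<in> ?X" unfolding 2(2) X_def by blast
      then show ?thesis by (rule XX)
    qed
  next
    case (a_inv a)
    have ac: "a \<in> carrier ?C" by (rule C.gspan_closed[OF P a_inv.IH])
    \<comment> \<open>\<open>gspan\<close> has no rule for negation; the sign is moved into the
      coefficients, where the image of minus one is available.\<close>
    have "\<ominus>\<^bsub>?C\<^esub> a = inl one_pt (\<ominus>\<^bsub>fobj B S\<^sub>0\<^esub> \<one>\<^bsub>fobj B S\<^sub>0\<^esub>) \<otimes>\<^bsub>?C\<^esub> a"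
      using ac by (simp add: C.l_minus)
    also have "\<dots> \<in> gspan ?C ?P ?X"
      by (rule C.gspan_scale[OF P _ Pm[OF one(2)] a_inv.IH]) (use one P in blast)
    finally show ?case .
  next
    case (eng_add a b)
    then show ?case by (intro C.gspan_add[OF P])
  next
    case (eng_mult a b)
    then show ?case by (intro C.gspan_mult[OF P Pm Xm])
  qed
qed

text \<open>Three facts combined: an element is a scalar times the image of one from B(S_0 + [1]),
  the latter is a combination of monomials, and each monomial reduces to standard ones.\<close>

lemma E_span: "carrier (fobj B' one_pt) \<subseteq> gspan (fobj B' one_pt) (units one_pt) E"
proof
  let ?B = "fobj B' one_pt" and ?U = "SS one_pt"
  interpret B: cring ?B by (rule B'.cring_obj) simp
  interpret C: cring "CS one_pt" by (rule cring_CS) simp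
  have un: "units one_pt \<subseteq> carrier ?B" by (rule units_closed) simp
  note P = un E_closed
  fix y assume "y \<in> carrier ?B"
  then obtain a r where ar: "a \<in> carrier (CS one_pt)" "r \<in> units one_pt" "y = r \<otimes>\<^bsub>?B\<^esub> \<gamma> one_pt a"
    using B'_decompose[OF finite_one_pt] by metis
  have "\<gamma> one_pt a \<in> gspan ?B (\<gamma> one_pt ` inl one_pt ` carrier (fobj B S\<^sub>0)) (\<gamma> one_pt ` {X ?U t\<^sub>1 u | u. length u = n})"
    using ar(1) CS_span ring_hom_closed[OF inl_hom[OF finite_one_pt]] X_closed[OF fin_sum[OF finite_one_pt] t1_mem]
    by (intro gspan_hom[OF C.cring_axioms B.cring_axioms \<gamma>_hom[OF finite_one_pt]]) auto
  then have "\<gamma> one_pt a \<in> gspan ?B (units one_pt) (\<gamma> one_pt ` {X ?U t\<^sub>1 u | u. length u = n})"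
    by (rule gspan_mono) (auto intro: \<gamma>_inl_units)
  then have 1: "\<gamma> one_pt a \<in> gspan ?B (units one_pt) E"
  proof (rule B.gspan_trans[OF P units_mult[OF finite_one_pt], rotated -1])
    fix x assume "x \<in> \<gamma> one_pt ` {X ?U t\<^sub>1 u | u. length u = n}"
    then show "x \<in> gspan ?B (units one_pt) E" using e_span unfolding e_def by blast
  qed
  show "y \<in> gspan ?B (units one_pt) E"
    unfolding ar(3) by (rule B.gspan_scale[OF P _ units_mult[OF finite_one_pt ar(2)] 1]) (use ar(2) un in blast)
qed

end

section \<open>Independence of the standard monomials at a new point\<close>

context fi_max
begin

text \<open>The counterpart of \<open>B'.incl S T\<close> before localization, related to it through
  \<open>\<gamma>\<close>.\<close>

definition "inc S T = fmap B (SS S) (SS T) (fi_sum_map S\<^sub>0 S (\<lambda>i\<in>S. i))"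

lemma inc_hom:
  assumes "finite S" "finite T" "S \<subseteq> T"
  shows "inc S T \<in> ring_hom (CS S) (CS T)"
  unfolding inc_def using assms by (intro map_ring_hom fin_sum fi_sum_map_hom fi_hom_subset)

lemma incl_\<gamma>:
  assumes "finite S" "finite T" "S \<subseteq> T" "a \<in> carrier (CS S)"
  shows "B'.incl S T (\<gamma> S a) = \<gamma> T (inc S T a)"
  unfolding inc_def B'.incl_def using assms by (intro map_\<gamma> fi_hom_subset)

lemma inc_hS:
  assumes "finite S" "finite T" "S \<subseteq> T"
  shows "inc S T (hS S) = hS T"
  using map_comp[OF fin_S0 fin_sum[OF assms(1)] fin_sum[OF assms(2)] fi_inl_hom
      fi_sum_map_hom[OF fi_hom_subset[OF assms(3)]] h_closed]
  unfolding inl_def inc_def fi_sum_map_inl by simp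

text \<open>A combination has finitely many coefficients, and their denominators are powers of
  \<open>h\<close>; the induction multiplies them up. The result is an equation between images under
  \<open>\<gamma>\<close>, and lifting it costs a further power of \<open>h\<close>.\<close>

lemma clear_denominators:
  assumes S: "finite S" and T: "finite T" and ST: "S \<subseteq> T" and Xs: "Xs \<subseteq> carrier (CS T)"
    and y: "y \<in> gspan (fobj B' T) (B'.incl S T ` carrier (fobj B' S)) (\<gamma> T ` Xs)"
  shows "\<exists>N z. z \<in> gspan (CS T) (inc S T ` carrier (CS S)) Xs \<and>
    y \<otimes>\<^bsub>fobj B' T\<^esub> \<gamma> T (hS T [^]\<^bsub>CS T\<^esub> (N::nat)) = \<gamma> T z"
proof -
  interpret C: cring "CS T" by (rule cring_CS[OF T])
  interpret D: cring "CS S" by (rule cring_CS[OF S])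
  interpret B: cring "fobj B' T" by (rule B'.cring_obj[OF T])
  interpret g: ring_hom_cring "CS T" "fobj B' T" "\<gamma> T"
    using \<gamma>_hom[OF T] by (simp add: ring_hom_cring_def ring_hom_cring_axioms_def C.cring_axioms B.cring_axioms)
  interpret i: ring_hom_cring "CS S" "CS T" "inc S T"
    using inc_hom[OF S T ST] by (simp add: ring_hom_cring_def ring_hom_cring_axioms_def C.cring_axioms D.cring_axioms)
  have incl: "B'.incl S T \<in> ring_hom (fobj B' S) (fobj B' T)" by (rule B'.incl_hom[OF S T ST])
  have hp: "hS T [^]\<^bsub>CS T\<^esub> (k::nat) \<in> carrier (CS T)" for k using hS_closed[OF T] by simp
  have hpS: "hS S [^]\<^bsub>CS S\<^esub> (k::nat) \<in> carrier (CS S)" for k using hS_closed[OF S] by simp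
  have pow: "inc S T (hS S [^]\<^bsub>CS S\<^esub> (k::nat)) = hS T [^]\<^bsub>CS T\<^esub> k" for k
    using i.hom_pow[OF hS_closed[OF S]] inc_hS[OF S T ST] by simp
  have P1: "inc S T ` carrier (CS S) \<subseteq> carrier (CS T)" by (rule image_subsetI) (rule i.hom_closed)
  note P = P1 Xs
  have scale: "hS T [^]\<^bsub>CS T\<^esub> (k::nat) \<otimes>\<^bsub>CS T\<^esub> inc S T a = inc S T (hS S [^]\<^bsub>CS S\<^esub> k \<otimes>\<^bsub>CS S\<^esub> a)"
    if "a \<in> carrier (CS S)" for k a
    unfolding i.hom_mult[OF hpS that] pow ..
  show ?thesis using y
  proof induction
    case zero
    have "\<zero>\<^bsub>fobj B' T\<^esub> \<otimes>\<^bsub>fobj B' T\<^esub> \<gamma> T (hS T [^]\<^bsub>CS T\<^esub> (0::nat)) = \<gamma> T \<zero>\<^bsub>CS T\<^esub>"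
      using g.hom_zero g.hom_closed[OF hp] by (simp del: nat_pow_0)
    then show ?case using gspan.zero by blast
  next
    case (add y c x)
    obtain N z where z: "z \<in> gspan (CS T) (inc S T ` carrier (CS S)) Xs"
      and yz: "y \<otimes>\<^bsub>fobj B' T\<^esub> \<gamma> T (hS T [^]\<^bsub>CS T\<^esub> (N::nat)) = \<gamma> T z" using add.IH by blast
    obtain c' where c': "c = B'.incl S T c'" "c' \<in> carrier (fobj B' S)" using add.hyps(2) by (rule imageE)
    obtain x' where x': "x = \<gamma> T x'" "x' \<in> Xs" using add.hyps(3) by (rule imageE)
    obtain a k where a: "a \<in> carrier (CS S)" "c' \<otimes>\<^bsub>fobj B' S\<^esub> \<gamma> S (hS S [^]\<^bsub>CS S\<^esub> (k::nat)) = \<gamma> S a"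
      using S c'(2) by (rule B'_cases)
    let ?hN = "\<gamma> T (hS T [^]\<^bsub>CS T\<^esub> N)" and ?hk = "\<gamma> T (hS T [^]\<^bsub>CS T\<^esub> k)"
    have ca: "c \<otimes>\<^bsub>fobj B' T\<^esub> ?hk = \<gamma> T (inc S T a)"
      using ring_hom_mult[OF incl c'(2) ring_hom_closed[OF \<gamma>_hom[OF S] hpS, of k]]
      unfolding a(2) incl_\<gamma>[OF S T ST a(1)] incl_\<gamma>[OF S T ST hpS] pow c'(1) by simp
    have cc: "c \<in> carrier (fobj B' T)" unfolding c'(1) by (rule ring_hom_closed[OF incl c'(2)])
    have x'c: "x' \<in> carrier (CS T)" using x'(2) Xs by blast
    have xc: "x \<in> carrier (fobj B' T)" unfolding x'(1) by (rule g.hom_closed[OF x'c])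
    have P': "B'.incl S T ` carrier (fobj B' S) \<subseteq> carrier (fobj B' T)"
      by (rule image_subsetI) (rule ring_hom_closed[OF incl])
    have "\<gamma> T ` Xs \<subseteq> carrier (fobj B' T)" using Xs g.hom_closed by blast
    then have yc: "y \<in> carrier (fobj B' T)" by (rule B.gspan_closed[OF P' _ add.hyps(1)])
    have zc: "z \<in> carrier (CS T)" by (rule C.gspan_closed[OF P z])
    have ic: "inc S T a \<in> carrier (CS T)" by (rule i.hom_closed[OF a(1)])
    have hc: "?hN \<in> carrier (fobj B' T)" "?hk \<in> carrier (fobj B' T)" by (rule g.hom_closed[OF hp])+
    \<comment> \<open>Over the common denominator \<open>h^(N + k)\<close> the old numerator gains
      the factor \<open>h^k\<close> and the new term gains \<open>h^N\<close>.\<close>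
    let ?z = "hS T [^]\<^bsub>CS T\<^esub> k \<otimes>\<^bsub>CS T\<^esub> z \<oplus>\<^bsub>CS T\<^esub> (hS T [^]\<^bsub>CS T\<^esub> N \<otimes>\<^bsub>CS T\<^esub> inc S T a) \<otimes>\<^bsub>CS T\<^esub> x'"
    have "?z \<in> gspan (CS T) (inc S T ` carrier (CS S)) Xs"
    proof (rule gspan.add[OF C.gspan_scale[OF P hp _ z] _ x'(2)])
      show "hS T [^]\<^bsub>CS T\<^esub> k \<otimes>\<^bsub>CS T\<^esub> c \<in> inc S T ` carrier (CS S)" if cP: "c \<in> inc S T ` carrier (CS S)" for c
      proof -
        obtain d where d: "c = inc S T d" "d \<in> carrier (CS S)" using cP by (rule imageE)
        show ?thesis unfolding d(1) scale[OF d(2)] by (intro imageI D.m_closed hpS d)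
      qed
      show "hS T [^]\<^bsub>CS T\<^esub> N \<otimes>\<^bsub>CS T\<^esub> inc S T a \<in> inc S T ` carrier (CS S)"
        unfolding scale[OF a(1)] by (intro imageI D.m_closed hpS a)
    qed
    moreover have "(y \<oplus>\<^bsub>fobj B' T\<^esub> c \<otimes>\<^bsub>fobj B' T\<^esub> x) \<otimes>\<^bsub>fobj B' T\<^esub> \<gamma> T (hS T [^]\<^bsub>CS T\<^esub> (N + k)) = \<gamma> T ?z"
    proof -
      have "\<gamma> T (hS T [^]\<^bsub>CS T\<^esub> (N + k)) = ?hN \<otimes>\<^bsub>fobj B' T\<^esub> ?hk"
        unfolding C.nat_pow_mult[OF hS_closed[OF T], symmetric] by (rule g.hom_mult[OF hp hp])
      moreover have "(y \<oplus>\<^bsub>fobj B' T\<^esub> c \<otimes>\<^bsub>fobj B' T\<^esub> x) \<otimes>\<^bsub>fobj B' T\<^esub> (?hN \<otimes>\<^bsub>fobj B' T\<^esub> ?hk) =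
          ?hk \<otimes>\<^bsub>fobj B' T\<^esub> (y \<otimes>\<^bsub>fobj B' T\<^esub> ?hN) \<oplus>\<^bsub>fobj B' T\<^esub> (?hN \<otimes>\<^bsub>fobj B' T\<^esub> (c \<otimes>\<^bsub>fobj B' T\<^esub> ?hk)) \<otimes>\<^bsub>fobj B' T\<^esub> x"
        using yc cc xc hc by (simp add: B.l_distr B.r_distr B.m_ac)
      moreover have "\<gamma> T ?z = ?hk \<otimes>\<^bsub>fobj B' T\<^esub> \<gamma> T z \<oplus>\<^bsub>fobj B' T\<^esub> (?hN \<otimes>\<^bsub>fobj B' T\<^esub> \<gamma> T (inc S T a)) \<otimes>\<^bsub>fobj B' T\<^esub> x"
        unfolding x'(1) using hp zc ic x'c by simp
      ultimately show ?thesis unfolding yz ca by simp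
    qed
    ultimately show ?case by blast
  qed
qed

text \<open>A coefficient violating the conclusion could be used to enlarge \<open>leads S\<^sub>0 h\<close>, against maximality.\<close>

lemma leading_coeff_zero:
  assumes S: "finite S" and s: "s \<notin> S" and u: "length u = n" "u \<notin> leads S\<^sub>0 h"
    and g: "g \<in> carrier (fobj B' S)"
    and rel: "B'.incl S (insert s S) g \<otimes>\<^bsub>fobj B' (insert s S)\<^esub> \<gamma> (insert s S) (X (SS (insert s S)) (enr s) u)
      \<in> gspan (fobj B' (insert s S)) (B'.incl S (insert s S) ` carrier (fobj B' S))
          (\<gamma> (insert s S) ` lower (SS (insert s S)) (enr s) u)"
  shows "g = \<zero>\<^bsub>fobj B' S\<^esub>"
proof (rule ccontr)
  assume g0: "g \<noteq> \<zero>\<^bsub>fobj B' S\<^esub>"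
  let ?T = "insert s S" and ?U = "SS (insert s S)" and ?t = "enr s"
  let ?P = "inc S ?T ` carrier (CS S)"
  have T: "finite ?T" and ST: "S \<subseteq> ?T" using S by auto
  interpret C: cring "CS ?T" by (rule cring_CS[OF T])
  interpret D: cring "CS S" by (rule cring_CS[OF S])
  interpret B: cring "fobj B' ?T" by (rule B'.cring_obj[OF T])
  interpret BS: cring "fobj B' S" by (rule B'.cring_obj[OF S])
  interpret gS: ring_hom_cring "CS S" "fobj B' S" "\<gamma> S"
    using \<gamma>_hom[OF S] by (simp add: ring_hom_cring_def ring_hom_cring_axioms_def D.cring_axioms BS.cring_axioms)
  interpret g: ring_hom_cring "CS ?T" "fobj B' ?T" "\<gamma> ?T"
    using \<gamma>_hom[OF T] by (simp add: ring_hom_cring_def ring_hom_cring_axioms_def C.cring_axioms B.cring_axioms)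
  interpret i: ring_hom_cring "CS S" "CS ?T" "inc S ?T"
    using inc_hom[OF S T ST] by (simp add: ring_hom_cring_def ring_hom_cring_axioms_def C.cring_axioms D.cring_axioms)
  have fU: "finite ?U" by (rule fin_sum[OF T])
  have tU: "?t \<in> ?U" by (rule enr_mem) simp
  have Xc: "X ?U ?t v \<in> carrier (CS ?T)" for v by (rule X_closed[OF fU tU])
  have low: "lower ?U ?t u \<subseteq> carrier (CS ?T)" by (rule lower_closed[OF fU tU])
  have P1: "?P \<subseteq> carrier (CS ?T)" by (rule image_subsetI) (rule i.hom_closed)
  note P = P1 low
  have Pm: "c \<otimes>\<^bsub>CS ?T\<^esub> d \<in> ?P" if cd: "c \<in> ?P" "d \<in> ?P" for c d
  proof -
    obtain c' where c: "c = inc S ?T c'" "c' \<in> carrier (CS S)" using cd(1) by (rule imageE)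
    obtain d' where d: "d = inc S ?T d'" "d' \<in> carrier (CS S)" using cd(2) by (rule imageE)
    show ?thesis unfolding c(1) d(1) i.hom_mult[OF c(2) d(2), symmetric] by (intro imageI D.m_closed c d)
  qed
  have hSc: "hS S \<in> carrier (CS S)" and hTc: "hS ?T \<in> carrier (CS ?T)" by (rule hS_closed, fact)+
  have hp: "hS ?T [^]\<^bsub>CS ?T\<^esub> (k::nat) \<in> carrier (CS ?T)" for k using hTc by simp
  have pow: "inc S ?T (hS S [^]\<^bsub>CS S\<^esub> (k::nat)) = hS ?T [^]\<^bsub>CS ?T\<^esub> k" for k
    using i.hom_pow[OF hSc] inc_hS[OF S T ST] by simp
  have hpP: "hS ?T [^]\<^bsub>CS ?T\<^esub> (k::nat) \<in> ?P" for k
    unfolding pow[symmetric] using hSc by (intro imageI) simp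
  \<comment> \<open>\<open>leads\<close> speaks about elements of \<open>B\<close>, so
    \<open>g\<close> is replaced by its numerator \<open>a\<close>. The two differ by an invertible
    factor in B'(S), hence the image of \<open>a\<close> is nonzero as well.\<close>
  obtain a k where a: "a \<in> carrier (CS S)" and ga: "g \<otimes>\<^bsub>fobj B' S\<^esub> \<gamma> S (hS S [^]\<^bsub>CS S\<^esub> (k::nat)) = \<gamma> S a"
    using S g by (rule B'_cases)
  have \<gamma>a: "\<gamma> S a \<noteq> \<zero>\<^bsub>fobj B' S\<^esub>"
  proof
    assume 0: "\<gamma> S a = \<zero>\<^bsub>fobj B' S\<^esub>"
    obtain r where r: "r \<in> units S" "r \<otimes>\<^bsub>fobj B' S\<^esub> \<gamma> S (hS S [^]\<^bsub>CS S\<^esub> k) = \<one>\<^bsub>fobj B' S\<^esub>"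
      using units_inverse[OF S] by blast
    have rc: "r \<in> carrier (fobj B' S)" using r(1) units_closed[OF S] by blast
    have hc: "\<gamma> S (hS S [^]\<^bsub>CS S\<^esub> k) \<in> carrier (fobj B' S)" using hSc by (intro gS.hom_closed) simp
    have "g = g \<otimes>\<^bsub>fobj B' S\<^esub> (r \<otimes>\<^bsub>fobj B' S\<^esub> \<gamma> S (hS S [^]\<^bsub>CS S\<^esub> k))" using r(2) g by simp
    also have "\<dots> = r \<otimes>\<^bsub>fobj B' S\<^esub> (g \<otimes>\<^bsub>fobj B' S\<^esub> \<gamma> S (hS S [^]\<^bsub>CS S\<^esub> k))" using g rc hc by (simp add: BS.m_ac)
    also have "\<dots> = \<zero>\<^bsub>fobj B' S\<^esub>" unfolding ga 0 using rc by simp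
    finally show False using g0 by blast
  qed
  obtain N z where z: "z \<in> gspan (CS ?T) ?P (lower ?U ?t u)"
    and yz: "(B'.incl S ?T g \<otimes>\<^bsub>fobj B' ?T\<^esub> \<gamma> ?T (X ?U ?t u)) \<otimes>\<^bsub>fobj B' ?T\<^esub> \<gamma> ?T (hS ?T [^]\<^bsub>CS ?T\<^esub> (N::nat)) = \<gamma> ?T z"
    using clear_denominators[OF S T ST low rel] by blast
  have zc: "z \<in> carrier (CS ?T)" by (rule C.gspan_closed[OF P z])
  define b where "b = inc S ?T a"
  have bc: "b \<in> carrier (CS ?T)" unfolding b_def by (rule i.hom_closed[OF a])
  have bP: "b \<in> ?P" unfolding b_def using a by (rule imageI)
  have incl: "B'.incl S ?T \<in> ring_hom (fobj B' S) (fobj B' ?T)" by (rule B'.incl_hom[OF S T ST])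
  have gc: "B'.incl S ?T g \<in> carrier (fobj B' ?T)" by (rule ring_hom_closed[OF incl g])
  have gb: "B'.incl S ?T g \<otimes>\<^bsub>fobj B' ?T\<^esub> \<gamma> ?T (hS ?T [^]\<^bsub>CS ?T\<^esub> k) = \<gamma> ?T b"
  proof -
    have hc: "hS S [^]\<^bsub>CS S\<^esub> k \<in> carrier (CS S)" using hSc by simp
    show ?thesis
      using ring_hom_mult[OF incl g gS.hom_closed[OF hc]]
      unfolding ga incl_\<gamma>[OF S T ST a] incl_\<gamma>[OF S T ST hc] pow b_def by simp
  qed
  have "\<gamma> ?T ((hS ?T [^]\<^bsub>CS ?T\<^esub> N \<otimes>\<^bsub>CS ?T\<^esub> b) \<otimes>\<^bsub>CS ?T\<^esub> X ?U ?t u) = \<gamma> ?T (hS ?T [^]\<^bsub>CS ?T\<^esub> k \<otimes>\<^bsub>CS ?T\<^esub> z)"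
  proof -
    have "\<gamma> ?T ((hS ?T [^]\<^bsub>CS ?T\<^esub> N \<otimes>\<^bsub>CS ?T\<^esub> b) \<otimes>\<^bsub>CS ?T\<^esub> X ?U ?t u) =
        (\<gamma> ?T (hS ?T [^]\<^bsub>CS ?T\<^esub> N) \<otimes>\<^bsub>fobj B' ?T\<^esub> \<gamma> ?T b) \<otimes>\<^bsub>fobj B' ?T\<^esub> \<gamma> ?T (X ?U ?t u)"
      using hp bc Xc by simp
    also have "\<dots> = \<gamma> ?T (hS ?T [^]\<^bsub>CS ?T\<^esub> k) \<otimes>\<^bsub>fobj B' ?T\<^esub>
        ((B'.incl S ?T g \<otimes>\<^bsub>fobj B' ?T\<^esub> \<gamma> ?T (X ?U ?t u)) \<otimes>\<^bsub>fobj B' ?T\<^esub> \<gamma> ?T (hS ?T [^]\<^bsub>CS ?T\<^esub> N))"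
      unfolding gb[symmetric] using gc g.hom_closed[OF hp] g.hom_closed[OF Xc] by (simp add: B.m_ac)
    finally show ?thesis unfolding yz using hp zc by simp
  qed
  moreover define l where "l = (hS ?T [^]\<^bsub>CS ?T\<^esub> N \<otimes>\<^bsub>CS ?T\<^esub> b) \<otimes>\<^bsub>CS ?T\<^esub> X ?U ?t u"
  moreover define l' where "l' = hS ?T [^]\<^bsub>CS ?T\<^esub> k \<otimes>\<^bsub>CS ?T\<^esub> z"
  ultimately have \<gamma>l: "\<gamma> ?T l = \<gamma> ?T l'" by simp
  have lc: "l \<in> carrier (CS ?T)" unfolding l_def by (intro C.m_closed hp bc Xc)
  have lc': "l' \<in> carrier (CS ?T)" unfolding l'_def by (intro C.m_closed hp zc)
  have "\<gamma> ?T (l \<ominus>\<^bsub>CS ?T\<^esub> l') = \<zero>\<^bsub>fobj B' ?T\<^esub>"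
    unfolding g.hom_sub[OF lc lc'] B.r_right_minus_eq[OF g.hom_closed[OF lc] g.hom_closed[OF lc']] by (rule \<gamma>l)
  \<comment> \<open>Equality after localization becomes equality in B(S_0 + T) once both sides are
    multiplied by a further power of \<open>h\<close>.\<close>
  then obtain N' where N': "hS ?T [^]\<^bsub>CS ?T\<^esub> (N'::nat) \<otimes>\<^bsub>CS ?T\<^esub> (l \<ominus>\<^bsub>CS ?T\<^esub> l') = \<zero>\<^bsub>CS ?T\<^esub>"
    using \<gamma>_zeroD[OF T C.minus_closed[OF lc lc']] by blast
  \<comment> \<open>\<open>N\<close> comes from clearing denominators and \<open>N'\<close> from the
    kernel of \<open>\<gamma>\<close>.\<close>
  define M where "M = N' + N"
  have rel0: "(hS ?T [^]\<^bsub>CS ?T\<^esub> M \<otimes>\<^bsub>CS ?T\<^esub> b) \<otimes>\<^bsub>CS ?T\<^esub> X ?U ?t u \<in> gspan (CS ?T) ?P (lower ?U ?t u)"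
  proof -
    have "hS ?T [^]\<^bsub>CS ?T\<^esub> N' \<otimes>\<^bsub>CS ?T\<^esub> (l \<ominus>\<^bsub>CS ?T\<^esub> l') =
        hS ?T [^]\<^bsub>CS ?T\<^esub> N' \<otimes>\<^bsub>CS ?T\<^esub> l \<ominus>\<^bsub>CS ?T\<^esub> hS ?T [^]\<^bsub>CS ?T\<^esub> N' \<otimes>\<^bsub>CS ?T\<^esub> l'"
      using hp[of N'] lc lc' by (simp add: a_minus_def C.r_distr C.r_minus)
    then have "hS ?T [^]\<^bsub>CS ?T\<^esub> N' \<otimes>\<^bsub>CS ?T\<^esub> l = hS ?T [^]\<^bsub>CS ?T\<^esub> N' \<otimes>\<^bsub>CS ?T\<^esub> l'"
      using N' iffD1[OF C.r_right_minus_eq[OF C.m_closed[OF hp[of N'] lc] C.m_closed[OF hp[of N'] lc']]] by (simp only:)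
    moreover have "(hS ?T [^]\<^bsub>CS ?T\<^esub> M \<otimes>\<^bsub>CS ?T\<^esub> b) \<otimes>\<^bsub>CS ?T\<^esub> X ?U ?t u =
        hS ?T [^]\<^bsub>CS ?T\<^esub> N' \<otimes>\<^bsub>CS ?T\<^esub> l"
      unfolding l_def M_def C.nat_pow_mult[OF hTc, symmetric] using hp bc Xc by (simp add: C.m_assoc)
    ultimately show ?thesis
      using C.gspan_scale[OF P hp Pm[OF hpP] C.gspan_scale[OF P hp Pm[OF hpP] z]] unfolding l'_def by simp
  qed
  let ?h1 = "hS S \<otimes>\<^bsub>CS S\<^esub> a"
  have h1c: "?h1 \<in> carrier (CS S)" using hSc a by simp
  have h1: "?h1 \<noteq> \<zero>\<^bsub>CS S\<^esub>"
  proof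
    assume "?h1 = \<zero>\<^bsub>CS S\<^esub>"
    then have ha: "\<gamma> S (hS S) \<otimes>\<^bsub>fobj B' S\<^esub> \<gamma> S a = \<zero>\<^bsub>fobj B' S\<^esub>"
      using gS.hom_mult[OF hSc a] gS.hom_zero by simp
    obtain r where r: "r \<in> units S" "r \<otimes>\<^bsub>fobj B' S\<^esub> \<gamma> S (hS S [^]\<^bsub>CS S\<^esub> (1::nat)) = \<one>\<^bsub>fobj B' S\<^esub>"
      using units_inverse[OF S] by blast
    have rc: "r \<in> carrier (fobj B' S)" using r(1) units_closed[OF S] by blast
    have "\<gamma> S a = (r \<otimes>\<^bsub>fobj B' S\<^esub> \<gamma> S (hS S)) \<otimes>\<^bsub>fobj B' S\<^esub> \<gamma> S a"
      using r(2) hSc gS.hom_closed[OF a] by simp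
    also have "\<dots> = r \<otimes>\<^bsub>fobj B' S\<^esub> (\<gamma> S (hS S) \<otimes>\<^bsub>fobj B' S\<^esub> \<gamma> S a)"
      by (rule BS.m_assoc[OF rc gS.hom_closed[OF hSc] gS.hom_closed[OF a]])
    finally show False using rc \<gamma>a unfolding ha by simp
  qed
  \<comment> \<open>The relation found has leading coefficient \<open>h^M a\<close>, while
    \<open>leads\<close> demands a power of \<open>h a\<close>. Multiplying by \<open>h a^M\<close>
    completes it to \<open>(h a)^(M + 1)\<close>.\<close>
  have relM: "inc S ?T (?h1 [^]\<^bsub>CS S\<^esub> Suc M) \<otimes>\<^bsub>CS ?T\<^esub> X ?U ?t u \<in> gspan (CS ?T) ?P (lower ?U ?t u)"
  proof -
    have "inc S ?T (?h1 [^]\<^bsub>CS S\<^esub> Suc M) = (hS ?T \<otimes>\<^bsub>CS ?T\<^esub> b) [^]\<^bsub>CS ?T\<^esub> Suc M"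
      unfolding i.hom_pow[OF h1c] i.hom_mult[OF hSc a] inc_hS[OF S T ST] b_def ..
    also have "\<dots> = (hS ?T [^]\<^bsub>CS ?T\<^esub> (1::nat) \<otimes>\<^bsub>CS ?T\<^esub> b [^]\<^bsub>CS ?T\<^esub> M) \<otimes>\<^bsub>CS ?T\<^esub> (hS ?T [^]\<^bsub>CS ?T\<^esub> M \<otimes>\<^bsub>CS ?T\<^esub> b)"
      using hTc bc by (simp add: C.nat_pow_distrib C.m_ac)
    finally have eq: "inc S ?T (?h1 [^]\<^bsub>CS S\<^esub> Suc M) \<otimes>\<^bsub>CS ?T\<^esub> X ?U ?t u =
        (hS ?T [^]\<^bsub>CS ?T\<^esub> (1::nat) \<otimes>\<^bsub>CS ?T\<^esub> b [^]\<^bsub>CS ?T\<^esub> M) \<otimes>\<^bsub>CS ?T\<^esub> ((hS ?T [^]\<^bsub>CS ?T\<^esub> M \<otimes>\<^bsub>CS ?T\<^esub> b) \<otimes>\<^bsub>CS ?T\<^esub> X ?U ?t u)"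
      using hTc bc Xc by (simp add: C.m_assoc)
    have bM: "b [^]\<^bsub>CS ?T\<^esub> M \<in> ?P"
      unfolding b_def i.hom_pow[OF a, symmetric] using a by (intro imageI) simp
    have d: "hS ?T [^]\<^bsub>CS ?T\<^esub> (1::nat) \<otimes>\<^bsub>CS ?T\<^esub> b [^]\<^bsub>CS ?T\<^esub> M \<in> ?P" by (rule Pm[OF hpP bM])
    show ?thesis unfolding eq
      by (rule C.gspan_scale[OF P _ Pm[OF d] rel0]) (rule subsetD[OF P1 d])
  qed
  have inc_eq: "fi_sum_map S\<^sub>0 S (\<lambda>i\<in>S. i) x = x" if "x \<in> SS S" for x
    using that by (auto simp: fi_sum_eq)
  have SSU: "?U = insert ?t (SS S)" by (auto simp: fi_sum_eq)
  have tnot: "?t \<notin> SS S" using s by (auto simp: fi_sum_eq)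
  have incm: "fi_sum_map S\<^sub>0 S (\<lambda>i\<in>S. i) \<in> fi_hom (SS S) ?U" by (rule fi_sum_map_hom[OF fi_hom_subset[OF ST]])
  have "lead_rel (SS S) ?h1 u (Suc M) V \<pi> t"
    if V: "finite V" and pi: "\<pi> \<in> fi_hom (SS S) V" and t: "t \<in> V - \<pi> ` SS S" for V \<pi> t
  proof -
    \<comment> \<open>Every triple \<open>(V, \<pi>, t)\<close> receives an injection from the model
      \<open>?U\<close>: it is \<open>\<pi>\<close> on the old points and sends the new point to
      \<open>t\<close>, which lies outside the image of \<open>\<pi>\<close>. The one relation over
      \<open>?U\<close> thus gives all that \<open>leads\<close> quantifies over.\<close>
    define \<rho> where "\<rho> = (\<lambda>x\<in>?U. if x = ?t then t else \<pi> x)"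
    have rho: "\<rho> \<in> fi_hom ?U V"
    proof (rule fi_homI)
      show "\<rho> \<in> ?U \<rightarrow>\<^sub>E V" unfolding \<rho>_def SSU using t fi_hom_mem[OF pi] by auto
      show "inj_on \<rho> ?U"
        unfolding inj_on_def \<rho>_def SSU using t tnot fi_hom_eq_iff[OF pi] by auto
    qed
    have rt: "\<rho> ?t = t" unfolding \<rho>_def using tU by simp
    have comp: "compose (SS S) \<rho> (fi_sum_map S\<^sub>0 S (\<lambda>i\<in>S. i)) = \<pi>"
    proof (rule ext)
      fix x show "compose (SS S) \<rho> (fi_sum_map S\<^sub>0 S (\<lambda>i\<in>S. i)) x = \<pi> x"
      proof (cases "x \<in> SS S")
        case True
        then show ?thesis using tnot inc_eq[OF True] by (auto simp: compose_def \<rho>_def SSU)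
      next
        case False
        have "\<pi> \<in> SS S \<rightarrow>\<^sub>E V" using pi unfolding fi_hom_def by blast
        then have "\<pi> x = undefined" using False by (rule PiE_arb)
        then show ?thesis using False by (simp add: compose_def)
      qed
    qed
    have fm: "fmap B (SS S) V \<pi> x = fmap B ?U V \<rho> (inc S ?T x)" if "x \<in> carrier (CS S)" for x
      using map_comp[OF fin_sum[OF S] fU V incm rho that] unfolding comp inc_def .
    have rhom: "fmap B ?U V \<rho> \<in> ring_hom (CS ?T) (fobj B V)" by (rule map_ring_hom[OF fU V rho])
    have "fmap B ?U V \<rho> (inc S ?T (?h1 [^]\<^bsub>CS S\<^esub> Suc M) \<otimes>\<^bsub>CS ?T\<^esub> X ?U ?t u)
        \<in> gspan (fobj B V) (fmap B ?U V \<rho> ` ?P) (fmap B ?U V \<rho> ` lower ?U ?t u)"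
      by (rule gspan_hom[OF C.cring_axioms cring_obj[OF V] rhom P relM])
    moreover have "fmap B ?U V \<rho> ` ?P = fmap B (SS S) V \<pi> ` carrier (CS S)"
      unfolding image_image by (rule image_cong[OF refl fm[symmetric]])
    moreover have hc: "?h1 [^]\<^bsub>CS S\<^esub> Suc M \<in> carrier (CS S)" by (rule D.nat_pow_closed[OF h1c])
    moreover have "fmap B ?U V \<rho> (inc S ?T (?h1 [^]\<^bsub>CS S\<^esub> Suc M) \<otimes>\<^bsub>CS ?T\<^esub> X ?U ?t u) =
        fmap B (SS S) V \<pi> (?h1 [^]\<^bsub>CS S\<^esub> Suc M) \<otimes>\<^bsub>fobj B V\<^esub> X V t u"
      unfolding ring_hom_mult[OF rhom i.hom_closed[OF hc] Xc] fm[OF hc] X_map[OF fU V rho tU] rt ..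
    ultimately show ?thesis unfolding lead_rel_def lower_map[OF fU V rho tU] rt by simp
  qed
  then have u1: "u \<in> leads (SS S) ?h1" unfolding leads_def using u(1) by blast
  \<comment> \<open>A relation led by \<open>h^m\<close> becomes one led by \<open>(h a)^m\<close>
    after multiplication by \<open>a^m\<close>. Its coefficients come from
    \<open>fobj B S\<^sub>0\<close>, hence also from the larger ring B(S_0 + S) through which the
    map factors.\<close>
  have "leads S\<^sub>0 h \<subseteq> leads (SS S) ?h1"
  proof
    fix w assume w: "w \<in> leads S\<^sub>0 h"
    then obtain m where m: "\<And>U \<pi> t. finite U \<Longrightarrow> \<pi> \<in> fi_hom S\<^sub>0 U \<Longrightarrow> t \<in> U - \<pi> ` S\<^sub>0 \<Longrightarrow> lead_rel S\<^sub>0 h w m U \<pi> t"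
      unfolding leads_def by blast
    have "lead_rel (SS S) ?h1 w m V \<pi> t"
      if V: "finite V" and pi: "\<pi> \<in> fi_hom (SS S) V" and t: "t \<in> V - \<pi> ` SS S" for V \<pi> t
    proof -
      let ?\<rho> = "compose S\<^sub>0 \<pi> (fi_inl S\<^sub>0)"
      interpret V: cring "fobj B V" by (rule cring_obj[OF V])
      interpret p: ring_hom_cring "CS S" "fobj B V" "fmap B (SS S) V \<pi>"
        using map_ring_hom[OF fin_sum[OF S] V pi]
        by (simp add: ring_hom_cring_def ring_hom_cring_axioms_def D.cring_axioms V.cring_axioms)
      have rho: "?\<rho> \<in> fi_hom S\<^sub>0 V" by (rule fi_hom_compose[OF fi_inl_hom pi])
      have tV: "t \<in> V" using t by blast
      have "t \<notin> ?\<rho> ` S\<^sub>0" using t fi_hom_mem[OF fi_inl_hom[of S\<^sub>0 S]] by (auto simp: compose_def)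
      then have "lead_rel S\<^sub>0 h w m V ?\<rho> t" using m[OF V rho] tV by blast
      moreover have fm: "fmap B S\<^sub>0 V ?\<rho> x = fmap B (SS S) V \<pi> (inl S x)" if "x \<in> carrier (fobj B S\<^sub>0)" for x
        unfolding inl_def by (rule map_comp[OF fin_S0 fin_sum[OF S] V fi_inl_hom pi that])
      moreover have "h [^]\<^bsub>fobj B S\<^sub>0\<^esub> m \<in> carrier (fobj B S\<^sub>0)"
        using cring_obj[OF fin_S0] h_closed by (simp add: cring_def ring.is_monoid monoid.nat_pow_closed)
      ultimately have "fmap B (SS S) V \<pi> (hS S [^]\<^bsub>CS S\<^esub> m) \<otimes>\<^bsub>fobj B V\<^esub> X V t w
          \<in> gspan (fobj B V) (fmap B S\<^sub>0 V ?\<rho> ` carrier (fobj B S\<^sub>0)) (lower V t w)"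
        unfolding lead_rel_def using inl_pow[OF S] by simp
      moreover have "fmap B S\<^sub>0 V ?\<rho> ` carrier (fobj B S\<^sub>0) \<subseteq> fmap B (SS S) V \<pi> ` carrier (CS S)"
      proof (rule image_subsetI)
        fix x assume "x \<in> carrier (fobj B S\<^sub>0)"
        then show "fmap B S\<^sub>0 V ?\<rho> x \<in> fmap B (SS S) V \<pi> ` carrier (CS S)"
          using fm ring_hom_closed[OF inl_hom[OF S]] by (metis imageI)
      qed
      ultimately have 1: "fmap B (SS S) V \<pi> (hS S [^]\<^bsub>CS S\<^esub> m) \<otimes>\<^bsub>fobj B V\<^esub> X V t w
          \<in> gspan (fobj B V) (fmap B (SS S) V \<pi> ` carrier (CS S)) (lower V t w)"
        by (rule gspan_mono[OF _ _ order_refl])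
      have am: "a [^]\<^bsub>CS S\<^esub> m \<in> carrier (CS S)" and hm: "hS S [^]\<^bsub>CS S\<^esub> m \<in> carrier (CS S)" using a hSc by simp_all
      have "fmap B (SS S) V \<pi> (a [^]\<^bsub>CS S\<^esub> m) \<otimes>\<^bsub>fobj B V\<^esub> (fmap B (SS S) V \<pi> (hS S [^]\<^bsub>CS S\<^esub> m) \<otimes>\<^bsub>fobj B V\<^esub> X V t w)
          \<in> gspan (fobj B V) (fmap B (SS S) V \<pi> ` carrier (CS S)) (lower V t w)"
      proof (rule V.gspan_scale[OF image_carrier_closed[OF fin_sum[OF S] V pi] lower_closed[OF V tV] p.hom_closed[OF am] _ 1])
        fix c assume "c \<in> fmap B (SS S) V \<pi> ` carrier (CS S)"
        then obtain c' where c: "c = fmap B (SS S) V \<pi> c'" "c' \<in> carrier (CS S)" by (rule imageE)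
        show "fmap B (SS S) V \<pi> (a [^]\<^bsub>CS S\<^esub> m) \<otimes>\<^bsub>fobj B V\<^esub> c \<in> fmap B (SS S) V \<pi> ` carrier (CS S)"
          unfolding c(1) p.hom_mult[OF am c(2), symmetric] by (intro imageI D.m_closed am c)
      qed
      moreover have "fmap B (SS S) V \<pi> (a [^]\<^bsub>CS S\<^esub> m) \<otimes>\<^bsub>fobj B V\<^esub> (fmap B (SS S) V \<pi> (hS S [^]\<^bsub>CS S\<^esub> m) \<otimes>\<^bsub>fobj B V\<^esub> X V t w)
          = fmap B (SS S) V \<pi> (?h1 [^]\<^bsub>CS S\<^esub> m) \<otimes>\<^bsub>fobj B V\<^esub> X V t w"
        unfolding D.nat_pow_distrib[OF hSc a] p.hom_mult[OF hm am]
        using p.hom_closed[OF am] p.hom_closed[OF hm] X_closed[OF V tV] by (simp only: V.m_ac)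
      ultimately show ?thesis unfolding lead_rel_def by simp
    qed
    then show "w \<in> leads (SS S) ?h1" using w unfolding leads_def by blast
  qed
  then have "leads (SS S) ?h1 \<subseteq> leads S\<^sub>0 h" by (rule max[OF fin_sum[OF S] h1c h1])
  then show False using u1 u(2) by blast
qed

text \<open>Among the basis elements with nonzero coefficient, take the one of largest exponent and
  move the other terms to the right. This expresses a multiple of a standard monomial through lower
  monomials, so \<open>leading_coeff_zero\<close> makes its coefficient zero, contrary to the
  choice.\<close>

lemma E_indep_one:
  assumes S: "finite S" and s: "s \<notin> S" and V: "finite V" "V \<subseteq> E" and g: "g \<in> V \<rightarrow> carrier (fobj B' S)"
    and sum: "(\<Oplus>\<^bsub>fobj B' (insert s S)\<^esub>v\<in>V. B'.incl S (insert s S) (g v) \<otimes>\<^bsub>fobj B' (insert s S)\<^esub> B'.jmap (insert s S) s v)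
        = \<zero>\<^bsub>fobj B' (insert s S)\<^esub>"
  shows "\<forall>v\<in>V. g v = \<zero>\<^bsub>fobj B' S\<^esub>"
proof (rule ccontr)
  assume nz: "\<not> (\<forall>v\<in>V. g v = \<zero>\<^bsub>fobj B' S\<^esub>)"
  define W where "W = {v \<in> V. g v \<noteq> \<zero>\<^bsub>fobj B' S\<^esub>}"
  have W: "finite W" "W \<noteq> {}" "W \<subseteq> V" unfolding W_def using V(1) nz by auto
  let ?T = "insert s S" and ?U = "SS (insert s S)" and ?t = "enr s"
  have T: "finite ?T" and ST: "S \<subseteq> ?T" and sT: "s \<in> ?T" using S by auto
  interpret B: cring "fobj B' ?T" by (rule B'.cring_obj[OF T])
  interpret BS: cring "fobj B' S" by (rule B'.cring_obj[OF S])
  interpret i: ring_hom_cring "fobj B' S" "fobj B' ?T" "B'.incl S ?T"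
    using B'.incl_hom[OF S T ST] by (simp add: ring_hom_cring_def ring_hom_cring_axioms_def B.cring_axioms BS.cring_axioms)
  \<comment> \<open>The elements of \<open>E\<close> are ring elements, so an exponent outside
    \<open>leads\<close> is chosen for each. As \<open>e (r v) = v\<close>, distinct elements have
    distinct exponents, and the maximum is attained only once.\<close>
  define r where "r v = (SOME u. length u = n \<and> u \<notin> leads S\<^sub>0 h \<and> e u = v)" for v
  have r: "length (r v) = n" "r v \<notin> leads S\<^sub>0 h" "e (r v) = v" if "v \<in> V" for v
  proof -
    have "\<exists>u. length u = n \<and> u \<notin> leads S\<^sub>0 h \<and> e u = v" using that V(2) unfolding E_def by blast
    then have "length (r v) = n \<and> r v \<notin> leads S\<^sub>0 h \<and> e (r v) = v" unfolding r_def by (rule someI_ex)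
    then show "length (r v) = n" "r v \<notin> leads S\<^sub>0 h" "e (r v) = v" by blast+
  qed
  have "Max (r ` W) \<in> r ` W" using W by (intro Max_in) auto
  then obtain v0 where v0: "v0 \<in> W" "r v0 = Max (r ` W)" by auto
  have less: "r v < r v0" if v: "v \<in> W - {v0}" for v
  proof -
    have "r v \<le> r v0" unfolding v0(2) using W(1) v by (intro Max_ge finite_imageI imageI) auto
    moreover have "r v \<noteq> r v0"
    proof
      assume "r v = r v0"
      moreover have "v \<in> V" "v0 \<in> V" using v v0(1) W(3) by blast+
      ultimately have "v = v0" using r(3) by metis
      then show False using v by blast
    qed
    ultimately show ?thesis by simp
  qed
  let ?x = "\<lambda>v. B'.jmap ?T s v"
  have x_eq: "?x v = \<gamma> ?T (X ?U ?t (r v))" if "v \<in> V" for v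
    using jmap_e[OF T sT, of "r v"] r(3)[OF that] by simp
  have xc: "?x v \<in> carrier (fobj B' ?T)" if "v \<in> V" for v
    using that V(2) E_closed by (intro ring_hom_closed[OF B'.jmap_hom[OF T sT]]) blast
  have gc: "g v \<in> carrier (fobj B' S)" if "v \<in> V" for v using g that by (rule Pi_mem)
  have tc: "B'.incl S ?T (g v) \<otimes>\<^bsub>fobj B' ?T\<^esub> ?x v \<in> carrier (fobj B' ?T)" if "v \<in> V" for v
    by (rule B.m_closed[OF i.hom_closed[OF gc[OF that]] xc[OF that]])
  have "(\<Oplus>\<^bsub>fobj B' ?T\<^esub>v\<in>W. B'.incl S ?T (g v) \<otimes>\<^bsub>fobj B' ?T\<^esub> ?x v) =
      (\<Oplus>\<^bsub>fobj B' ?T\<^esub>v\<in>V. B'.incl S ?T (g v) \<otimes>\<^bsub>fobj B' ?T\<^esub> ?x v)"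
  proof (rule B.finsum_neutral_superset[OF V(1) W(3)])
    fix v assume v: "v \<in> V - W"
    then have gv: "g v = \<zero>\<^bsub>fobj B' S\<^esub>" and vV: "v \<in> V" by (simp_all add: W_def)
    show "B'.incl S ?T (g v) \<otimes>\<^bsub>fobj B' ?T\<^esub> ?x v = \<zero>\<^bsub>fobj B' ?T\<^esub>"
      unfolding gv i.hom_zero by (rule B.l_null[OF xc[OF vV]])
  next
    fix v assume "v \<in> W"
    then show "B'.incl S ?T (g v) \<otimes>\<^bsub>fobj B' ?T\<^esub> ?x v \<in> carrier (fobj B' ?T)"
      by (rule tc[OF subsetD[OF W(3)]])
  qed
  then have W0: "(\<Oplus>\<^bsub>fobj B' ?T\<^esub>v\<in>W. B'.incl S ?T (g v) \<otimes>\<^bsub>fobj B' ?T\<^esub> ?x v) = \<zero>\<^bsub>fobj B' ?T\<^esub>"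
    using sum by simp
  let ?rest = "\<Oplus>\<^bsub>fobj B' ?T\<^esub>v\<in>W - {v0}. B'.incl S ?T (g v) \<otimes>\<^bsub>fobj B' ?T\<^esub> ?x v"
  have v0V: "v0 \<in> V" using v0(1) W(3) by blast
  have "(\<Oplus>\<^bsub>fobj B' ?T\<^esub>v\<in>insert v0 (W - {v0}). B'.incl S ?T (g v) \<otimes>\<^bsub>fobj B' ?T\<^esub> ?x v) = \<zero>\<^bsub>fobj B' ?T\<^esub>"
    unfolding insert_Diff[OF v0(1)] by (rule W0)
  moreover have "(\<Oplus>\<^bsub>fobj B' ?T\<^esub>v\<in>insert v0 (W - {v0}). B'.incl S ?T (g v) \<otimes>\<^bsub>fobj B' ?T\<^esub> ?x v) =
      B'.incl S ?T (g v0) \<otimes>\<^bsub>fobj B' ?T\<^esub> ?x v0 \<oplus>\<^bsub>fobj B' ?T\<^esub> ?rest"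
    using W(1,3) v0V by (intro B.finsum_insert Pi_I tc) blast+
  moreover have rc: "?rest \<in> carrier (fobj B' ?T)" using W(3) by (intro B.finsum_closed Pi_I tc) blast
  ultimately have top: "B'.incl S ?T (g v0) \<otimes>\<^bsub>fobj B' ?T\<^esub> ?x v0 = \<ominus>\<^bsub>fobj B' ?T\<^esub> ?rest"
    using B.minus_equality[OF _ rc tc[OF v0V]] by simp
  let ?P = "B'.incl S ?T ` carrier (fobj B' S)" and ?L = "\<gamma> ?T ` lower ?U ?t (r v0)"
  have P1: "?P \<subseteq> carrier (fobj B' ?T)" by (rule image_subsetI) (rule i.hom_closed)
  have L: "?L \<subseteq> carrier (fobj B' ?T)"
    using lower_closed[OF fin_sum[OF T] enr_mem[OF sT]] ring_hom_closed[OF \<gamma>_hom[OF T]] by blast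
  have rest: "?rest \<in> gspan (fobj B' ?T) ?P ?L"
  proof (rule B.gspan_finsum[OF P1 L])
    show "finite (W - {v0})" using W(1) by simp
    fix v assume v: "v \<in> W - {v0}"
    then have vV: "v \<in> V" using W(3) by blast
    show "B'.incl S ?T (g v) \<in> ?P" by (rule imageI[OF gc[OF vV]])
    show "?x v \<in> ?L"
      unfolding x_eq[OF vV] lower_def using less[OF v] r(1)[OF vV] by blast
  qed
  \<comment> \<open>Moving the terms across the equation introduces a sign. It is absorbed into the
    coefficients, which form the image of a ring and are closed under negation.\<close>
  have mone: "\<ominus>\<^bsub>fobj B' ?T\<^esub> \<one>\<^bsub>fobj B' ?T\<^esub> \<in> carrier (fobj B' ?T)" by simp
  have "\<ominus>\<^bsub>fobj B' ?T\<^esub> \<one>\<^bsub>fobj B' ?T\<^esub> \<otimes>\<^bsub>fobj B' ?T\<^esub> ?rest \<in> gspan (fobj B' ?T) ?P ?L"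
  proof (rule B.gspan_scale[OF P1 L mone _ rest])
    fix c assume "c \<in> ?P"
    then obtain c' where c: "c = B'.incl S ?T c'" "c' \<in> carrier (fobj B' S)" by (rule imageE)
    have "\<ominus>\<^bsub>fobj B' ?T\<^esub> \<one>\<^bsub>fobj B' ?T\<^esub> \<otimes>\<^bsub>fobj B' ?T\<^esub> c = B'.incl S ?T (\<ominus>\<^bsub>fobj B' S\<^esub> c')"
      unfolding c(1) using i.hom_closed[OF c(2)] c(2) by (simp add: B.l_minus)
    then show "\<ominus>\<^bsub>fobj B' ?T\<^esub> \<one>\<^bsub>fobj B' ?T\<^esub> \<otimes>\<^bsub>fobj B' ?T\<^esub> c \<in> ?P" using c(2) by (metis BS.a_inv_closed imageI)
  qed
  then have "\<ominus>\<^bsub>fobj B' ?T\<^esub> ?rest \<in> gspan (fobj B' ?T) ?P ?L" using rc by (simp add: B.l_minus)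
  then have "B'.incl S ?T (g v0) \<otimes>\<^bsub>fobj B' ?T\<^esub> \<gamma> ?T (X ?U ?t (r v0)) \<in> gspan (fobj B' ?T) ?P ?L"
    unfolding top[symmetric] x_eq[OF v0V] .
  then have "g v0 = \<zero>\<^bsub>fobj B' S\<^esub>" by (rule leading_coeff_zero[OF S s r(1,2)[OF v0V] gc[OF v0V]])
  then show False using v0(1) unfolding W_def by blast
qed

section \<open>The isomorphism of FI-op-schemes\<close>

lemma shift_localize_isomorphic:
  assumes "fi_nice B"
  shows "fi_op_isomorphic (spec R) (fi_spec R B') (fibre_powers R (fobj B' one_pt))"
proof (rule B'.fi_op_isomorphic_fibre_powers)
  show "c = \<zero>\<^bsub>R\<^esub>" if "c \<in> carrier R" "B'.unit {} c = \<zero>\<^bsub>fobj B' {}\<^esub>" for c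
    by (rule zero_B'[OF assms that])
  show "E \<subseteq> carrier (fobj B' one_pt)" by (rule E_closed)
  show "carrier (fobj B' one_pt) \<subseteq> gspan (fobj B' one_pt) {B'.unit one_pt c | c. c \<in> carrier R} E"
    using E_span unfolding units_def .
  show "\<forall>v\<in>V. g v = \<zero>\<^bsub>fobj B' S\<^esub>"
    if "finite S" "s \<notin> S" "finite V" "V \<subseteq> E" "g \<in> V \<rightarrow> carrier (fobj B' S)"
      "(\<Oplus>\<^bsub>fobj B' (insert s S)\<^esub>v\<in>V. B'.incl S (insert s S) (g v) \<otimes>\<^bsub>fobj B' (insert s S)\<^esub> B'.jmap (insert s S) s v)
        = \<zero>\<^bsub>fobj B' (insert s S)\<^esub>" for S s V g
    by (rule E_indep_one[OF that])
  show "carrier (fobj B' S) \<subseteq>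
      generate_ring (fobj B' S) (B'.unit S ` carrier R \<union> (\<Union>s\<in>S. B'.jmap S s ` carrier (fobj B' one_pt)))"
    if "finite S" for S
    by (rule gen_B'[OF that])
qed

end

theorem theorem3p1:
  fixes K :: "('k, 'm) ring_scheme" and B :: "('k, 'b) fi_alg"
  assumes "fi_algebra K B"
    and "fi_reduced B"
    and "fi_nice B"
    and "fi_fin_gen_width_le_1 K B"
    and "\<one>\<^bsub>fobj B {}\<^esub> \<noteq> \<zero>\<^bsub>fobj B {}\<^esub>"
  shows "\<exists>S\<^sub>0 h. finite S\<^sub>0 \<and> h \<in> carrier (fobj B S\<^sub>0) \<and> h \<noteq> \<zero>\<^bsub>fobj B S\<^sub>0\<^esub> \<and>
    (let R = localization_away (fobj B S\<^sub>0) h;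
         B' = fi_localize h (fi_shift S\<^sub>0 B);
         X' = fi_spec R B'
     in fi_op_isomorphic (spec R) X' (fibre_powers R (fobj B' {1..1})))"
proof -
  interpret fi_algebra K B by fact
  obtain bs where bs: "set bs \<subseteq> carrier A1"
    "\<forall>S. finite S \<longrightarrow> carrier (fobj B S) \<subseteq>
      generate_ring (fobj B S) (incl {} S ` carrier (fobj B {}) \<union> (\<Union>s\<in>S. jmap S s ` set bs))"
    using assms(4) by (rule fin_gen_width_le_1_generators)
  interpret fi_gen K B bs
    by (intro fi_gen.intro fi_gen_axioms.intro assms(1) bs(1) bs(2)[rule_format])
  obtain S\<^sub>0 h where S0: "finite S\<^sub>0" "h \<in> carrier (fobj B S\<^sub>0)" "h \<noteq> \<zero>\<^bsub>fobj B S\<^sub>0\<^esub>"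
    and max: "\<And>T h'. finite T \<Longrightarrow> h' \<in> carrier (fobj B T) \<Longrightarrow> h' \<noteq> \<zero>\<^bsub>fobj B T\<^esub> \<Longrightarrow>
      leads S\<^sub>0 h \<subseteq> leads T h' \<Longrightarrow> leads T h' \<subseteq> leads S\<^sub>0 h"
    using exists_maximal_leads[OF assms(5)] by metis
  interpret fi_max K B bs S\<^sub>0 h
    by (intro fi_max.intro fi_max_axioms.intro fi_gen_axioms S0 max)
  show ?thesis
    using S0 shift_localize_isomorphic[OF assms(3)] unfolding Let_def one_pt_def by blast
qed

end
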